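(* Let $\mathcal{E}=\{W\subseteq\mathbb{P} : \mathbb{Z}\text{ is existentially definable in }R_W\}$. The following are equivalent. (1) The class $\mathcal{E}$ is not meager in $2^{\mathbb{P}}$. (2) There is a $\sigma\in 2^{<\mathbb{P}}$ and a single polynomial $g$ which existentially defines $\mathbb{Z}$ in all HTP-generic subrings $R_V$ with $V\in\mathcal{U}_\sigma$. (3) $\mathbb{P}\in\mathcal{E}$; that is, $\mathbb{Z}$ is existentially definable in $\mathbb{Q}$. (4) There is a single existential formula which defines $\mathbb{Z}$ in every subring of $\mathbb{Q}$.
   Context: $\mathbb{P}$ is the set of all prime numbers. For $W\subseteq\mathbb{P}$, $R_W=\mathbb{Z}[\frac1p : p\in W]$ is the corresponding subring of $\mathbb{Q}$ (every subring of $\mathbb{Q}$ has this form; $R_{\mathbb{P}}=\mathbb{Q}$). For a subring $R\subseteq\mathbb{Q}$, $\mathrm{HTP}(R)$ denotes the set of polynomials (each in finitely many variables, with coefficients in $\mathbb{Z}$ or, equivalently after clearing denominators, in $R$) that have a zero with all coordinates in $R$. Existential definability: in a ring $R\subseteq\mathbb{Q}$, a polynomial $g\in\mathbb{Z}[X,\vec{Y}]$ existentially defines $\mathbb{Z}$ if for every $q\in R$, $q\in\mathbb{Z}\iff g(q,\vec{Y})\in\mathrm{HTP}(R)$ (i.e. iff $g(q,\vec y)=0$ for some tuple $\vec y$ from $R$). $\mathbb{Z}$ is existentially definable in $R$ if such a polynomial $g$ exists. An existential formula in (4) means a parameter-free existential first-order formula, with one free variable, in the language of rings. Topology: the power set $2^{\mathbb{P}}$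 of $\mathbb{P}$ carries the Cantor-space (product) topology, identifying $W\subseteq\mathbb{P}$ with its characteristic function $\mathbb{P}\to\{0,1\}$. $2^{<\mathbb{P}}$ is the set of functions $\sigma$ from finite initial segments of $\mathbb{P}$ (in increasing order) to $\{0,1\}$, and $\mathcal{U}_\sigma=\{W\subseteq\mathbb{P} : \sigma\subset W\}$ is the basic open set of those $W$ whose characteristic function extends $\sigma$. A set is nowhere dense if its closure contains no nonempty open set, and meager if it is a countable union of nowhere dense sets. HTP-generic: for $f\in\mathbb{Z}[X_0,X_1,\ldots]$ let $\mathcal{A}(f)=\{W\subseteq\mathbb{P} : f\in\mathrm{HTP}(R_W)\}$ (an open set), and let $\mathcal{B}(f)=2^{\mathbb{P}}-\mathcal{A}(f)-\mathrm{Int}(2^{\mathbb{P}}-\mathcal{A}(f))$ be its topological boundary. A set $W\subseteq\mathbb{P}$, and the corresponding subring $R_W$, is HTP-generic if $W\notin\mathcal{B}(f)$ for every $f\in\mathbb{Z}[X_0,X_1,\ldots]$. *)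

theory Defs
  imports
    "HOL-Analysis.Abstract_Topology"
    "HOL-Analysis.Product_Topology"
    "HOL-Analysis.Function_Topology"
    "HOL-Computational_Algebra.Primes"
    "HOL-Library.Poly_Mapping"
begin

section \<open>Subrings of the rationals\<close>

abbreviation primes :: "nat set" where
  "primes \<equiv> {p. prime p}"

definition rat_subring :: "rat set \<Rightarrow> bool" where
  "rat_subring R \<longleftrightarrow> 1 \<in> R \<and> (\<forall>x\<in>R. \<forall>y\<in>R. x - y \<in> R \<and> x * y \<in> R)"

definition ring_inverting :: "nat set \<Rightarrow> rat set" where
  "ring_inverting W = rat_subring hull {1 / of_nat p |p. p \<in> W}"

lemma rat_subring_add:
  assumes "rat_subring R" "x \<in> R" "y \<in> R"
  shows "x + y \<in> R"
proof -
  have "y - y \<in> R" using assms unfolding rat_subring_def by blast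
  then have "(y - y) - y \<in> R" using assms unfolding rat_subring_def by blast
  then have "x - ((y - y) - y) \<in> R" using assms unfolding rat_subring_def by blast
  then show ?thesis by simp
qed

lemma rat_subring_of_int:
  assumes "rat_subring R"
  shows "of_int k \<in> R"
proof (induction k rule: int_induct[of _ 0])
  have one: "1 \<in> R" using assms unfolding rat_subring_def by blast
  have "(1::rat) - 1 \<in> R" using assms unfolding rat_subring_def by blast
  then show "of_int 0 \<in> R" by simp
  show "of_int (i + 1) \<in> R" if "of_int i \<in> R" for i
    using rat_subring_add[OF assms that one] by simp
  show "of_int (i - 1) \<in> R" if "of_int i \<in> R" for i
    using assms that one unfolding rat_subring_def of_int_diff of_int_1 by blast
qed

lemma rat_subring_ring_inverting: "rat_subring (ring_inverting W)"
  unfolding ring_inverting_def by (rule hull_in) (auto simp: rat_subring_def)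

lemma ring_inverting_primes: "ring_inverting primes = UNIV"
proof -
  let ?R = "ring_inverting primes"
  have R: "rat_subring ?R" by (rule rat_subring_ring_inverting)
  have mult: "x * y \<in> ?R" if "x \<in> ?R" "y \<in> ?R" for x y
    using R that unfolding rat_subring_def by blast
  have inv: "1 / of_nat n \<in> ?R" if "n > 0" for n
    using that
  proof (induction n rule: less_induct)
    case (less n)
    show ?case
    proof (cases "n = 1")
      case True
      then show ?thesis using R unfolding rat_subring_def by simp
    next
      case False
      obtain p where p: "prime p" "p dvd n" using prime_factor_nat[OF False] by blast
      then obtain m where m: "n = p * m" by (elim dvdE)
      have "m > 0" "m < n" using m less.prems prime_gt_1_nat[OF p(1)] by auto
      then have "1 / of_nat m \<in> ?R" by (rule less.IH[rotated])
      moreover have "1 / of_nat p \<in> ?R"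
        unfolding ring_inverting_def by (rule hull_inc) (use p in blast)
      ultimately have "1 / of_nat p * (1 / of_nat m) \<in> ?R" by (intro mult)
      then show ?thesis by (simp add: m)
    qed
  qed
  have "q \<in> ?R" for q
  proof (cases q)
    case (Fract a b)
    then have "q = of_int a * (1 / of_nat (nat b))" by (simp add: Fract_of_int_quotient)
    moreover have "1 / of_nat (nat b) \<in> ?R" using Fract by (intro inv) simp
    ultimately show ?thesis using mult rat_subring_of_int[OF R] by blast
  qed
  then show ?thesis by blast
qed


section \<open>Integer polynomials and HTP\<close>

text \<open>Elements of \<open>\<int>[X\<^sub>0, X\<^sub>1, \<dots>]\<close>: a monomial is its finitely supported exponent vector.\<close>

type_synonym zpoly = "(nat \<Rightarrow>\<^sub>0 nat) \<Rightarrow>\<^sub>0 int"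

definition zpoly_eval :: "zpoly \<Rightarrow> (nat \<Rightarrow> rat) \<Rightarrow> rat" where
  "zpoly_eval f x =
     (\<Sum>m\<in>Poly_Mapping.keys f. of_int (Poly_Mapping.lookup f m) *
        (\<Prod>i\<in>Poly_Mapping.keys m. x i ^ Poly_Mapping.lookup m i))"

text \<open>Points are given as infinite sequences. Only the finitely many coordinates whose variables
  occur in the polynomial affect the value; the remaining ones may be taken to be \<open>0\<close>.\<close>

definition HTP :: "rat set \<Rightarrow> zpoly set" where
  "HTP R = {f. \<exists>x. (\<forall>i. x i \<in> R) \<and> zpoly_eval f x = 0}"

text \<open>The variable \<open>X\<close> is \<open>X\<^sub>0\<close>; the variables \<open>Y\<^sub>0, Y\<^sub>1, \<dots>\<close> are \<open>X\<^sub>1, X\<^sub>2, \<dots>\<close>.\<close>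

definition existentially_defines_ints :: "zpoly \<Rightarrow> rat set \<Rightarrow> bool" where
  "existentially_defines_ints g R \<longleftrightarrow>
     (\<forall>q\<in>R. q \<in> \<int> \<longleftrightarrow> (\<exists>y. (\<forall>i. y i \<in> R) \<and> zpoly_eval g (case_nat q y) = 0))"

definition ints_existentially_definable :: "rat set \<Rightarrow> bool" where
  "ints_existentially_definable R \<longleftrightarrow> (\<exists>g. existentially_defines_ints g R)"


section \<open>Existential formulas in the language of rings\<close>

datatype rterm =
    TVar nat
  | TZero
  | TOne
  | TNeg rterm
  | TAdd rterm rterm
  | TMul rterm rterm

datatype qf_formula =
    QEq rterm rterm
  | QNot qf_formula
  | QAnd qf_formula qf_formula
  | QOr qf_formula qf_formula

text \<open>Existential formulas in prenex form: a block of quantifiers, each binding a named variable,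
  in front of a quantifier-free matrix.\<close>

datatype ex_formula =
    Matrix qf_formula
  | Ex nat ex_formula

primrec term_vars :: "rterm \<Rightarrow> nat set" where
  "term_vars (TVar i) = {i}"
| "term_vars TZero = {}"
| "term_vars TOne = {}"
| "term_vars (TNeg s) = term_vars s"
| "term_vars (TAdd s t) = term_vars s \<union> term_vars t"
| "term_vars (TMul s t) = term_vars s \<union> term_vars t"

primrec qf_vars :: "qf_formula \<Rightarrow> nat set" where
  "qf_vars (QEq s t) = term_vars s \<union> term_vars t"
| "qf_vars (QNot a) = qf_vars a"
| "qf_vars (QAnd a b) = qf_vars a \<union> qf_vars b"
| "qf_vars (QOr a b) = qf_vars a \<union> qf_vars b"

primrec free_vars :: "ex_formula \<Rightarrow> nat set" where
  "free_vars (Matrix a) = qf_vars a"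
| "free_vars (Ex i \<phi>) = free_vars \<phi> - {i}"

primrec term_val :: "(nat \<Rightarrow> rat) \<Rightarrow> rterm \<Rightarrow> rat" where
  "term_val e (TVar i) = e i"
| "term_val e TZero = 0"
| "term_val e TOne = 1"
| "term_val e (TNeg s) = - term_val e s"
| "term_val e (TAdd s t) = term_val e s + term_val e t"
| "term_val e (TMul s t) = term_val e s * term_val e t"

primrec qf_sat :: "(nat \<Rightarrow> rat) \<Rightarrow> qf_formula \<Rightarrow> bool" where
  "qf_sat e (QEq s t) \<longleftrightarrow> term_val e s = term_val e t"
| "qf_sat e (QNot a) \<longleftrightarrow> \<not> qf_sat e a"
| "qf_sat e (QAnd a b) \<longleftrightarrow> qf_sat e a \<and> qf_sat e b"
| "qf_sat e (QOr a b) \<longleftrightarrow> qf_sat e a \<or> qf_sat e b"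

primrec ex_sat :: "rat set \<Rightarrow> (nat \<Rightarrow> rat) \<Rightarrow> ex_formula \<Rightarrow> bool" where
  "ex_sat R e (Matrix a) \<longleftrightarrow> qf_sat e a"
| "ex_sat R e (Ex i \<phi>) \<longleftrightarrow> (\<exists>a\<in>R. ex_sat R (e(i := a)) \<phi>)"

text \<open>For a formula whose only free variable is variable \<open>0\<close>. The constant environment
  \<open>\<lambda>_. q\<close> matters only at \<open>0\<close>.\<close>

definition formula_defines_ints :: "ex_formula \<Rightarrow> rat set \<Rightarrow> bool" where
  "formula_defines_ints \<phi> R \<longleftrightarrow> (\<forall>q\<in>R. q \<in> \<int> \<longleftrightarrow> ex_sat R (\<lambda>_. q) \<phi>)"


section \<open>The Cantor space of sets of primes\<close>

text \<open>The topology on \<open>Pow primes\<close> is transported from the product topology along the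
  identification of a set with its characteristic function.\<close>

definition cantor_topology :: "nat set topology" where
  "cantor_topology =
     pullback_topology (Pow primes) (\<lambda>W. restrict (\<lambda>p. p \<in> W) primes)
       (product_topology (\<lambda>_. discrete_topology (UNIV :: bool set)) primes)"

text \<open>Functions from finite initial segments of the primes to two values, as partial maps.\<close>

definition prime_strings :: "(nat \<rightharpoonup> bool) set" where
  "prime_strings = {\<sigma>. \<exists>n. dom \<sigma> = {p. prime p \<and> p < n}}"

definition cylinder :: "(nat \<rightharpoonup> bool) \<Rightarrow> nat set set" where
  "cylinder \<sigma> = {W. W \<subseteq> primes \<and> (\<forall>p\<in>dom \<sigma>. \<sigma> p = Some (p \<in> W))}"

definition nowhere_dense_in :: "'a topology \<Rightarrow> 'a set \<Rightarrow> bool" where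
  "nowhere_dense_in X S \<longleftrightarrow> S \<subseteq> topspace X \<and> X interior_of (X closure_of S) = {}"

definition meager_in :: "'a topology \<Rightarrow> 'a set \<Rightarrow> bool" where
  "meager_in X S \<longleftrightarrow>
     (\<exists>\<N>. countable \<N> \<and> (\<forall>N\<in>\<N>. nowhere_dense_in X N) \<and> S = \<Union>\<N>)"

lemma topspace_cantor_topology: "topspace cantor_topology = Pow primes"
  by (auto simp: cantor_topology_def topspace_pullback_topology)


section \<open>HTP-generic sets\<close>

definition solvable_set :: "zpoly \<Rightarrow> nat set set" where
  "solvable_set f = {W. W \<subseteq> primes \<and> f \<in> HTP (ring_inverting W)}"

definition boundary_set :: "zpoly \<Rightarrow> nat set set" where
  "boundary_set f =
     Pow primes - solvable_set f - cantor_topology interior_of (Pow primes - solvable_set f)"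

definition HTP_generic :: "nat set \<Rightarrow> bool" where
  "HTP_generic W \<longleftrightarrow> W \<subseteq> primes \<and> (\<forall>f. W \<notin> boundary_set f)"

definition ex_definable_class :: "nat set set" where
  "ex_definable_class = {W. W \<subseteq> primes \<and> ints_existentially_definable (ring_inverting W)}"

end

theory Submission
  imports
    Defs
    "HOL-Number_Theory.Number_Theory"
    "HOL-Real_Asymp.Real_Asymp"
    "HOL-Analysis.Summation_Tests"
    "HOL-Analysis.Urysohn"
    "HOL-Computational_Algebra.Squarefree"
begin

text \<open>All four conditions amount to one of them: \<open>\<int>\<close> is existentially definable in \<open>\<rat>\<close>. Three ideas
  lead there and back.

  \<^item> From \<open>\<rat>\<close> to its subrings. Putting the unknowns over a common denominator turns a definition of
    \<open>\<int>\<close> in \<open>\<rat>\<close> into a condition \<open>G(q, b, a) = 0 \<and> b \<noteq> 0\<close> that forces \<open>q \<in> \<int>\<close> for all rational \<open>b, a\<close>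
    and that has a solution in integers for every \<open>q \<in> \<int>\<close>. Integers belong to every subring, so this
    condition defines \<open>\<int>\<close> in every subring; it is an existential formula. (Conversely, an
    existential formula over \<open>\<rat>\<close> can be rewritten as a single equation with further unknowns.) A
    polynomial definition has to express \<open>b \<noteq> 0\<close> by an equation. If neither 2 nor 3 is inverted, \<open>2u - 1\<close> and \<open>3v - 1\<close> never vanish,
    while every positive integer divides some number \<open>(2u - 1)(3v - 1)\<close>; so \<open>b w = (2u - 1)(3v - 1)\<close>
    serves. The resulting polynomial works for all sets in a cylinder, and by Baire's theorem a cylinder
    is not meager.

  \<^item> From a non-meager class to the generic sets. Boundary sets are nowhere dense and there are
    countably many of them. If \<open>\<int>\<close> is definable for a non-meager class of sets, some single \<open>g\<close> therefore
    works for a set of generic \<open>W\<close> that is dense in a cylinder. For another generic \<open>V\<close> in that cylinder,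
    solvability of \<open>g(q, y) = 0\<close> is decided on a whole neighbourhood of \<open>V\<close>, and this neighbourhood
    contains one of the \<open>W\<close>.

  \<^item> From the generic sets back to \<open>\<rat>\<close>. Suppose that \<open>g\<close> works for the generic sets in a cylinder, and
    let \<open>V\<^sub>0\<close> be the largest set of the cylinder: all primes outside a finite set \<open>F\<close>. A zero of a polynomial
    involves finitely many primes, so zeros over \<open>V\<^sub>0\<close> are also zeros over generic sets close to \<open>V\<^sub>0\<close>,
    and \<open>g\<close> defines \<open>\<int>\<close> over \<open>V\<^sub>0\<close> as well. This ring consists of the rationals that are integral at each
    \<open>p \<in> F\<close>, and it remains to define \<open>p\<close>-integrality by a polynomial equation over \<open>\<rat>\<close>.

  For the last point let \<open>N\<close> be the norm form of \<open>\<rat>(\<surd>-e)\<close>, where the prime \<open>e\<close> is 3 modulo 4 and \<open>p\<close>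
  is inert. If \<open>1 + p N(\<alpha>)\<close> is a norm, then a descent on the denominator shows that the
  trace of \<open>\<alpha>\<close> is \<open>p\<close>-integral. Conversely, every integer divisible by \<open>8e\<close> is the trace of such an
  \<open>\<alpha>\<close> (\<open>norm_representation\<close>). So finitely many translates of the set of these traces cover
  \<open>\<int>\<close> without leaving the \<open>p\<close>-integral numbers, and a rational number is \<open>p\<close>-integral iff it is
  \<open>a / (1 + p c)\<close> for two elements \<open>a, c\<close> of this cover (\<open>p_integral_criterion\<close>).

  The representation as a norm comes from two applications of Legendre's theorem on ternary forms,
  \<open>legendre_conic\<close>, linked by an auxiliary prime with prescribed quadratic residue symbols. Such a prime
  exists by Dirichlet's argument, carried out for real characters only: the sums of
  \<open>\<Lambda>(d) \<psi>(d) / d\<close> over \<open>d \<le> n\<close>, with \<open>\<Lambda>\<close> the von Mangoldt function, are bounded because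
  \<open>L(1, \<psi>) \<noteq> 0\<close> (\<open>L_nonzero\<close>, by Monsky's proof), whereas those of \<open>\<Lambda>(d) / d\<close> are not.\<close>

section \<open>Sums of the von Mangoldt function\<close>

lemma abel_summation_bound:
  fixes f a :: "nat \<Rightarrow> real"
  assumes F: "\<And>n. \<bar>\<Sum>i<n. f i\<bar> \<le> K"
    and anti: "\<And>i. m \<le> i \<Longrightarrow> a (Suc i) \<le> a i" and nonneg: "\<And>i. m \<le> i \<Longrightarrow> 0 \<le> a i"
  shows "\<bar>\<Sum>i=m..<n. f i * a i\<bar> \<le> 2 * K * a m"
proof (cases "m \<le> n")
  case False
  have "K \<ge> 0" using F[of 0] by simp
  then show ?thesis using False nonneg[of m] by simp
next
  case True
  define F where "F n = (\<Sum>i<n. f i)" for n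
  have FK: "\<bar>F n\<bar> \<le> K" for n using F by (simp add: F_def)
  have K0: "K \<ge> 0" using F[of 0] by simp
  have "(\<Sum>i=m..<n. f i * a i) = F n * a n - F m * a m + (\<Sum>i=m..<n. F (Suc i) * (a i - a (Suc i)))"
    using True
  proof (induction n rule: dec_induct)
    case (step n)
    have "F (Suc n) = F n + f n" by (simp add: F_def)
    then show ?case using step by (simp add: algebra_simps)
  qed simp
  moreover have "\<bar>\<Sum>i=m..<n. F (Suc i) * (a i - a (Suc i))\<bar> \<le> (\<Sum>i=m..<n. K * (a i - a (Suc i)))"
    by (rule order.trans[OF sum_abs sum_mono])
       (use FK anti K0 in \<open>auto simp: abs_mult intro!: mult_mono\<close>)
  moreover have "(\<Sum>i=m..<n. K * (a i - a (Suc i))) = K * (a m - a n)"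
    using True by (induction n rule: dec_induct) (auto simp: algebra_simps)
  moreover have "\<bar>F n * a n\<bar> \<le> K * a n" "\<bar>F m * a m\<bar> \<le> K * a m"
    using FK nonneg[of n] nonneg[of m] True by (auto simp: abs_mult intro!: mult_right_mono)
  ultimately show ?thesis by (simp add: algebra_simps)
qed

lemma sum_over_divisors_swap:
  fixes g :: "nat \<Rightarrow> nat \<Rightarrow> real"
  shows "(\<Sum>m=1..n. \<Sum>d | d dvd m. g d m) = (\<Sum>d=1..n. \<Sum>e=1..n div d. g d (d * e))"
proof -
  have le: "b \<le> n" if "b * k \<le> n" "0 < k" for b k :: nat
    using that by (metis Suc_leI le_trans mult.right_neutral mult_le_mono2 One_nat_def)
  have "(\<Sum>m=1..n. \<Sum>d | d dvd m. g d m) = (\<Sum>(m,d)\<in>Sigma {1..n} (\<lambda>m. {d. d dvd m}). g d m)"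
    by (rule sum.Sigma) auto
  also have "\<dots> = (\<Sum>(d,e)\<in>Sigma {1..n} (\<lambda>d. {1..n div d}). g d (d * e))"
    by (rule sum.reindex_bij_witness[of _ "\<lambda>(d,e). (d * e, d)" "\<lambda>(m,d). (d, m div d)"])
       (auto simp: less_eq_div_iff_mult_less_eq mult.commute Suc_le_eq elim!: dvdE
          intro: le)
  also have "\<dots> = (\<Sum>d=1..n. \<Sum>e=1..n div d. g d (d * e))"
    by (rule sum.Sigma[symmetric]) auto
  finally show ?thesis .
qed

lemma ln_fact_eq_sum_mangoldt:
  "ln (fact n) = (\<Sum>d=1..n. mangoldt d * real (n div d))"
proof -
  have "ln (fact n :: real) = (\<Sum>m=1..n. ln (real m))"
    by (induction n) (auto simp: ln_mult add.commute)
  also have "\<dots> = (\<Sum>m=1..n. \<Sum>d | d dvd m. mangoldt d)"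
    by (intro sum.cong refl) (simp add: mangoldt_sum)
  also have "\<dots> = (\<Sum>d=1..n. mangoldt d * real (n div d))"
    by (subst sum_over_divisors_swap) (simp add: mult.commute)
  finally show ?thesis .
qed

text \<open>The coefficient \<open>2m div d - 2 (m div d)\<close> is never negative, and it is 1 for \<open>m < d \<le> 2m\<close>. The sum of
  \<open>mangoldt\<close> with these coefficients is the logarithm of the central binomial coefficient, which is
  at most \<open>2m\<close>. The bound follows by halving \<open>n\<close> repeatedly.\<close>

lemma chebyshev_upper_bound: "(\<Sum>d=1..n. mangoldt d) \<le> 4 * real n"
proof (induction n rule: less_induct)
  case (less n)
  have double: "(\<Sum>d=1..2*m. mangoldt d :: real) \<le> (\<Sum>d=1..m. mangoldt d) + 2 * real m" for m
  proof -
    have "(\<Sum>d=1..2*m. mangoldt d) - (\<Sum>d=1..m. mangoldt d) = (\<Sum>d=m+1..2*m. mangoldt d :: real)"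
      using sum.ub_add_nat[of 1 m "mangoldt :: nat \<Rightarrow> real" m] by (simp add: mult_2)
    also have "\<dots> \<le> (\<Sum>d=m+1..2*m. mangoldt d * (real (2*m div d) - 2 * real (m div d)))"
    proof (rule sum_mono)
      fix d assume d: "d \<in> {m+1..2*m}"
      then have "m div d = 0" by simp
      moreover have "2 * m div d \<ge> 1" using d by (simp add: Suc_le_eq div_greater_zero_iff)
      ultimately have "1 \<le> real (2*m div d) - 2 * real (m div d)" by linarith
      then show "mangoldt d \<le> mangoldt d * (real (2*m div d) - 2 * real (m div d))"
        using mult_left_mono[OF _ mangoldt_nonneg[of d], of 1] by simp
    qed
    also have "\<dots> \<le> (\<Sum>d=1..2*m. mangoldt d * (real (2*m div d) - 2 * real (m div d)))"
    proof (rule sum_mono2)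
      fix d
      have "2 * (m div d) \<le> 2 * m div d"
      proof (cases "d = 0")
        case False
        have "2 * (m div d) * d \<le> 2 * m" by (simp add: mult.assoc)
        then show ?thesis using False by (simp add: less_eq_div_iff_mult_less_eq)
      qed simp
      then show "0 \<le> mangoldt d * (real (2*m div d) - 2 * real (m div d))"
        using mangoldt_nonneg[of d] by (intro mult_nonneg_nonneg) linarith+
    qed auto
    also have "\<dots> = ln (fact (2 * m)) - 2 * ln (fact m)"
    proof -
      have "(\<Sum>d=1..2*m. mangoldt d * real (m div d)) = (\<Sum>d=1..m. mangoldt d * real (m div d))"
        by (rule sum.mono_neutral_right) auto
      moreover have "mangoldt d * (real (2*m div d) - 2 * real (m div d)) =
          mangoldt d * real (2*m div d) - 2 * (mangoldt d * real (m div d))" for d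
        by (simp add: algebra_simps)
      ultimately show ?thesis
        unfolding ln_fact_eq_sum_mangoldt by (simp add: sum_subtractf flip: sum_distrib_left)
    qed
    also have "\<dots> = ln (real (2 * m choose m))"
      by (simp add: binomial_fact ln_div ln_mult)
    also have "\<dots> \<le> ln (2 ^ (2 * m))"
    proof -
      have "2 * m choose m \<le> 2 ^ (2 * m)"
        using member_le_sum[of m "{..2*m}" "\<lambda>k. 2 * m choose k"] choose_row_sum[of "2*m"] by simp
      then have "real (2 * m choose m) \<le> real (2 ^ (2 * m))" by (rule of_nat_mono)
      then have "real (2 * m choose m) \<le> 2 ^ (2 * m)" by simp
      then show ?thesis by (subst ln_le_cancel_iff) auto
    qed
    also have "\<dots> \<le> 2 * real m" using ln_2_less_1 by (simp add: ln_realpow mult_left_le)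
    finally show ?thesis by simp
  qed
  show ?case
  proof (cases "n = 0")
    case False
    define m where "m = n div 2"
    have IH: "(\<Sum>d=1..m. mangoldt d) \<le> 4 * real m" using less False by (simp add: m_def)
    consider "n = 2 * m" | "n = Suc (2 * m)" unfolding m_def by linarith
    then show ?thesis
    proof cases
      case 1
      then show ?thesis using double[of m] IH by simp
    next
      case 2
      have "mangoldt n \<le> ln (real n)" using False by (intro mangoldt_le) auto
      also have "\<dots> \<le> 2 * real m" using ln_le_minus_one[of "real n"] 2 by simp
      finally show ?thesis using double[of m] IH 2 by simp
    qed
  qed simp
qed

text \<open>Dropping the floors in \<open>ln_fact_eq_sum_mangoldt\<close> gives \<open>n\<close> times the sum in question, and
  \<open>ln (n!) \<ge> n ln n - n\<close>.\<close>

lemma mertens_lower_bound: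
  assumes "n > 0"
  shows "ln (real n) - 1 \<le> (\<Sum>d=1..n. mangoldt d / real d)"
proof -
  have "real n * ln (real n) - real n \<le> ln (fact n)"
    using assms
  proof (induction n rule: nat_induct_non_zero)
    case (Suc n)
    have "ln (real (Suc n)) - ln (real n) = ln (1 + 1 / real n)"
      using Suc.hyps ln_div[of "real (Suc n)" "real n"] by (simp add: add_divide_distrib add.commute)
    also have "\<dots> \<le> 1 / real n" by (rule ln_add_one_self_le_self) simp
    finally have "real n * (ln (real (Suc n)) - ln (real n)) \<le> 1"
      using Suc.hyps by (simp add: field_simps)
    moreover have "ln (fact (Suc n) :: real) = ln (real (Suc n)) + ln (fact n)"
      unfolding fact_Suc by (subst ln_mult) auto
    ultimately show ?case using Suc.IH by (simp add: algebra_simps)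
  qed simp
  also have "\<dots> \<le> (\<Sum>d=1..n. mangoldt d * (real n / real d))"
    unfolding ln_fact_eq_sum_mangoldt
    by (intro sum_mono mult_left_mono mangoldt_nonneg of_nat_div_le_of_nat)
  also have "\<dots> = real n * (\<Sum>d=1..n. mangoldt d / real d)"
    by (simp add: sum_distrib_left field_simps)
  finally have "real n * (ln (real n) - 1) \<le> real n * (\<Sum>d=1..n. mangoldt d / real d)"
    by (simp add: algebra_simps)
  then show ?thesis using assms by simp
qed

text \<open>The powers \<open>p\<^sup>2, p\<^sup>3, \<dots>\<close> of a prime contribute at most \<open>ln p / (p (p - 1))\<close> by the geometric series, and
  these numbers have a finite sum.\<close>

lemma sum_mangoldt_nonprime_bounded:
  "\<exists>C. \<forall>n. (\<Sum>d | d \<in> {1..n} \<and> \<not> prime d. mangoldt d / real d) \<le> C"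
proof -
  have sm: "summable (\<lambda>p. ln (real p) / (real p * (real p - 1)))"
  proof (rule summable_comparison_test_bigo)
    show "summable (\<lambda>n. norm (real n powr (-3/2)))"
      by (simp add: summable_real_powr_iff)
    show "(\<lambda>p. ln (real p) / (real p * (real p - 1))) \<in> O(\<lambda>n. real n powr (-3/2))"
      by real_asymp
  qed
  have "(\<Sum>d | d \<in> {1..n} \<and> \<not> prime d. mangoldt d / real d)
      \<le> suminf (\<lambda>p. ln (real p) / (real p * (real p - 1)))" for n
  proof -
    define A where "A = {d \<in> {1..n}. primepow d \<and> \<not> prime d}"
    define B where "B = {2..n} \<times> {2..n}"
    have "(\<Sum>d | d \<in> {1..n} \<and> \<not> prime d. mangoldt d / real d) = (\<Sum>d\<in>A. mangoldt d / real d)"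
      unfolding A_def by (rule sum.mono_neutral_right) (auto simp: mangoldt_def)
    also have "\<dots> = (\<Sum>d\<in>A. ln (real (aprimedivisor d)) / real d)"
      by (rule sum.cong) (auto simp: A_def mangoldt_def)
    also have "\<dots> \<le> (\<Sum>(p,k)\<in>B. ln (real p) / real p ^ k)"
    proof (rule sum_le_included[where i = "\<lambda>(p,k). p ^ k"])
      show "\<forall>d\<in>A. \<exists>x\<in>B. (case x of (p, k) \<Rightarrow> p ^ k) = d \<and>
              ln (real (aprimedivisor d)) / real d \<le> (case x of (p, k) \<Rightarrow> ln (real p) / real p ^ k)"
      proof
        fix d assume d: "d \<in> A"
        then obtain p k where pk: "prime p" "d = p ^ k" "k > 0"
          unfolding A_def primepow_def by auto
        have "k \<noteq> 1" using d pk by (auto simp: A_def)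
        then have k2: "k \<ge> 2" using pk by simp
        have p2: "p \<ge> 2" using pk prime_ge_2_nat by blast
        have "k < p ^ k" using p2 by (metis less_exp order_less_le_trans power_mono zero_le)
        moreover have "p \<le> p ^ k" using p2 pk by (simp add: self_le_power)
        moreover have "p ^ k \<le> n" using d pk by (simp add: A_def)
        ultimately have "(p, k) \<in> B" using p2 k2 by (auto simp: B_def)
        moreover have "aprimedivisor d = p" using pk by (simp add: aprimedivisor_prime_power)
        ultimately show "\<exists>x\<in>B. (case x of (p, k) \<Rightarrow> p ^ k) = d \<and>
              ln (real (aprimedivisor d)) / real d \<le> (case x of (p, k) \<Rightarrow> ln (real p) / real p ^ k)"
          using pk by (intro bexI[of _ "(p,k)"]) auto
      qed
    qed (auto simp: A_def B_def)
    also have "\<dots> = (\<Sum>p=2..n. ln (real p) * (\<Sum>k=2..n. 1 / real p ^ k))"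
      unfolding B_def by (simp add: sum_distrib_left flip: sum.cartesian_product)
    also have "\<dots> \<le> (\<Sum>p=2..n. ln (real p) * (1 / (real p * (real p - 1))))"
    proof (intro sum_mono mult_left_mono)
      fix p assume p: "p \<in> {2..n}"
      have "(\<Sum>k=2..<2+j. 1 / real p ^ k) * (real p * (real p - 1)) = 1 - 1 / real p ^ j" for j
      proof (induction j)
        case (Suc j)
        have "1 / real p ^ (2 + j) * (real p * (real p - 1)) = 1 / real p ^ j - 1 / real p ^ Suc j"
          using p by (simp add: field_simps power2_eq_square)
        then show ?case using Suc by (simp add: distrib_right)
      qed simp
      then have "(\<Sum>k=2..<2+j. 1 / real p ^ k) = (1 - 1 / real p ^ j) / (real p * (real p - 1))" for j
        using p by (simp add: eq_divide_eq)
      from this[of "n - 1"] have "(\<Sum>k=2..n. 1 / real p ^ k) = (1 - 1 / real p ^ (n - 1)) / (real p * (real p - 1))"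
        using p by (metis (no_types, lifting) Suc_1 Suc_eq_plus1 add_2_eq_Suc atLeastAtMost_iff
            atLeastLessThanSuc_atLeastAtMost le_add_diff_inverse plus_1_eq_Suc
            add_Suc_shift one_le_numeral order_trans)
      also have "\<dots> \<le> 1 / (real p * (real p - 1))"
        using p by (intro divide_right_mono) auto
      finally show "(\<Sum>k=2..n. 1 / real p ^ k) \<le> 1 / (real p * (real p - 1))" .
    qed auto
    also have "\<dots> \<le> suminf (\<lambda>p. ln (real p) / (real p * (real p - 1)))"
    proof -
      have "0 \<le> ln (real p) / (real p * (real p - 1))" for p
        by (cases "p = 0") auto
      then show ?thesis using sum_le_suminf[OF sm, of "{2..n}"] by simp
    qed
    finally show ?thesis .
  qed
  then show ?thesis by blast
qed

section \<open>Real characters and their L-series at 1\<close>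

text \<open>The last condition says that the character is not principal.\<close>

locale quadratic_character =
  fixes \<psi> :: "nat \<Rightarrow> real" and k :: nat
  assumes k_pos: "k > 0"
    and psi_mult: "\<psi> (m * n) = \<psi> m * \<psi> n"
    and psi_one: "\<psi> 1 = 1"
    and periodic: "\<psi> (n + k) = \<psi> n"
    and psi_values: "\<psi> n \<in> {-1, 0, 1}"
    and sum_zero: "(\<Sum>r<k. \<psi> r) = 0"
begin

lemma abs_le_1: "\<bar>\<psi> n\<bar> \<le> 1"
  using psi_values[of n] by auto

lemma psi_power: "\<psi> (n ^ i) = \<psi> n ^ i"
  using psi_one by (induction i) (auto simp: psi_mult)

lemma partial_sum_bound: "\<bar>\<Sum>i<n. \<psi> i\<bar> \<le> real k"
proof -
  have shift: "(\<Sum>i<n + k. \<psi> i) = (\<Sum>i<n. \<psi> i)" for n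
    by (induction n) (auto simp: sum_zero periodic)
  have "(\<Sum>i<r + j * k. \<psi> i) = (\<Sum>i<r. \<psi> i)" for r j
  proof (induction j)
    case (Suc j)
    then show ?case using shift[of "r + j * k"] by (simp add: ac_simps)
  qed simp
  from this[of "n mod k" "n div k"] have "(\<Sum>i<n. \<psi> i) = (\<Sum>i<n mod k. \<psi> i)" by simp
  also have "\<bar>\<dots>\<bar> \<le> (\<Sum>i<n mod k. 1)"
    by (rule order.trans[OF sum_abs sum_mono]) (rule abs_le_1)
  also have "\<dots> \<le> real k" using k_pos by (simp add: less_imp_le)
  finally show ?thesis .
qed

lemmas weighted_sum_bound = abel_summation_bound[OF partial_sum_bound]

text \<open>Since \<open>1 / 0 = 0\<close>, the series may start at index 0.\<close>

definition L :: real where "L = suminf (\<lambda>n. \<psi> n / real n)"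

lemma sums_L: "(\<lambda>n. \<psi> n / real n) sums L"
proof -
  have bd: "\<bar>\<Sum>i=m..<n. \<psi> i / real i\<bar> \<le> 2 * real k / real m" if "m > 0" for m n
    using weighted_sum_bound[of m "\<lambda>i. 1 / real i" n] that by (simp add: field_simps)
  have "summable (\<lambda>n. \<psi> n / real n)"
    unfolding summable_Cauchy
  proof (intro allI impI)
    fix e :: real assume e: "e > 0"
    obtain N :: nat where N: "2 * real k / e < real N" using reals_Archimedean2 by blast
    have "N > 0" using N e k_pos by (intro gr0I) (auto simp: field_simps mult_less_0_iff)
    show "\<exists>N. \<forall>m\<ge>N. \<forall>n. norm (\<Sum>i=m..<n. \<psi> i / real i) < e"
    proof (intro exI[of _ N] allI impI)
      fix m n assume m: "N \<le> m"
      have "2 * real k < e * real m" using N e m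
        by (smt (verit, best) mult.commute mult_left_mono of_nat_mono pos_divide_less_eq)
      then have "2 * real k / real m < e" using m \<open>N > 0\<close> by (simp add: field_simps)
      then show "norm (\<Sum>i=m..<n. \<psi> i / real i) < e" using bd[of m n] m \<open>N > 0\<close> by simp
    qed
  qed
  then show ?thesis unfolding L_def by (rule summable_sums)
qed

lemma L_tail: "\<bar>L - (\<Sum>i=1..n. \<psi> i / real i)\<bar> \<le> 2 * real k / real (n + 1)"
proof (rule LIMSEQ_le_const2)
  have "(\<Sum>i<N. \<psi> i / real i) - (\<Sum>i=1..n. \<psi> i / real i) = (\<Sum>i=n+1..<N. \<psi> i / real i)"
    if "N \<ge> n + 1" for N
  proof -
    have "{..<N} = insert 0 ({1..n} \<union> {n+1..<N})" using that by auto
    moreover have "{1..n} \<inter> {n+1..<N} = {}" by auto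
    ultimately show ?thesis by (simp add: sum.union_disjoint)
  qed
  moreover have "\<bar>\<Sum>i=n+1..<N. \<psi> i / real i\<bar> \<le> 2 * real k / real (n + 1)" for N
    using weighted_sum_bound[of "n+1" "\<lambda>i. 1 / real i" N] by (simp add: field_simps)
  ultimately show "\<exists>N0. \<forall>N\<ge>N0. \<bar>(\<Sum>i<N. \<psi> i / real i) - (\<Sum>i=1..n. \<psi> i / real i)\<bar> \<le> 2 * real k / real (n + 1)"
    by (intro exI[of _ "n+1"]) simp
  show "(\<lambda>N. \<bar>(\<Sum>i<N. \<psi> i / real i) - (\<Sum>i=1..n. \<psi> i / real i)\<bar>) \<longlonglongrightarrow> \<bar>L - (\<Sum>i=1..n. \<psi> i / real i)\<bar>"
    using sums_L unfolding sums_def by (intro tendsto_intros)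
qed

lemma log_sum_bounded: "\<exists>C. \<forall>n. \<bar>\<Sum>i=1..n. \<psi> i * (ln (real i) / real i)\<bar> \<le> C"
proof -
  define g where "g i = \<psi> i * (ln (real i) / real i)" for i
  (* The function ln x / x decreases only from x = exp 1 on. *)
  have bd: "\<bar>\<Sum>i=3..<n. g i\<bar> \<le> 2 * real k * (ln 3 / 3)" for n
    unfolding g_def
  proof (rule weighted_sum_bound[of 3 "\<lambda>i. ln (real i) / real i" n, THEN order.trans])
    fix i :: nat assume i: "3 \<le> i"
    have "exp 1 \<le> real i" using exp_le i by linarith
    then have "1 \<le> ln (real i)" using i by (subst ln_ge_iff) auto
    moreover have "ln (real (Suc i)) - ln (real i) \<le> 1 / real i"
      using i ln_div[of "real (Suc i)" "real i"] ln_add_one_self_le_self[of "1 / real i"]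
      by (simp add: add_divide_distrib add.commute)
    ultimately have "real i * (ln (real (Suc i)) - ln (real i)) \<le> ln (real i)"
      using i by (simp add: field_simps)
    then show "ln (real (Suc i)) / real (Suc i) \<le> ln (real i) / real i"
      using i by (simp add: field_simps)
  qed auto
  have "\<bar>\<Sum>i=1..n. g i\<bar> \<le> 2 * real k * (ln 3 / 3) + \<bar>g 1\<bar> + \<bar>g 2\<bar>" for n
  proof (cases "n \<ge> 2")
    case True
    then have "{1..n} = {1, 2} \<union> {3..<Suc n}" by auto
    then have "(\<Sum>i=1..n. g i) = g 1 + g 2 + (\<Sum>i=3..<Suc n. g i)"
      by (simp add: sum.union_disjoint)
    then show ?thesis using bd[of "Suc n"] by linarith
  next
    case False
    then consider "n = 0" | "n = 1" by linarith
    then show ?thesis using bd[of 0] by cases auto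
  qed
  then show ?thesis unfolding g_def by blast
qed

text \<open>Expanding \<open>ln i\<close> as a divisor sum of \<open>mangoldt\<close> turns the bounded sum of \<open>\<psi> i ln i / i\<close> into the sum of
  \<open>mangoldt d \<psi> d / d\<close> times the partial sum of the L-series up to \<open>n div d\<close>. Replacing these partial
  sums by \<open>L\<close> costs \<open>O(d / n)\<close> in each term, which is \<open>O(1)\<close> in total by Chebyshev's bound.\<close>

lemma mangoldt_sum_times_L_bounded:
  "\<exists>C. \<forall>n. \<bar>L * (\<Sum>d=1..n. mangoldt d * \<psi> d / real d)\<bar> \<le> C"
proof -
  obtain C where C: "\<And>n. \<bar>\<Sum>i=1..n. \<psi> i * (ln (real i) / real i)\<bar> \<le> C"
    using log_sum_bounded by blast
  have "\<bar>L * (\<Sum>d=1..n. mangoldt d * \<psi> d / real d)\<bar> \<le> C + 8 * real k" for n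
  proof (cases "n = 0")
    case True
    then show ?thesis using C[of 0] by simp
  next
    case False
    define h where "h d = mangoldt d * \<psi> d / real d" for d
    have "(\<Sum>i=1..n. \<psi> i * (ln (real i) / real i)) =
        (\<Sum>m=1..n. \<Sum>d | d dvd m. mangoldt d * (\<psi> m / real m))"
    proof (rule sum.cong)
      fix m assume "m \<in> {1..n}"
      then have "ln (real m) = (\<Sum>d | d dvd m. mangoldt d)" by (simp add: mangoldt_sum)
      then show "\<psi> m * (ln (real m) / real m) = (\<Sum>d | d dvd m. mangoldt d * (\<psi> m / real m))"
        by (simp only: sum_distrib_right[symmetric]) (simp add: mult.commute)
    qed simp
    also have "\<dots> = (\<Sum>d=1..n. \<Sum>e=1..n div d. mangoldt d * (\<psi> (d * e) / real (d * e)))"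
      by (rule sum_over_divisors_swap)
    also have "\<dots> = (\<Sum>d=1..n. h d * (\<Sum>e=1..n div d. \<psi> e / real e))"
      by (simp add: h_def psi_mult sum_distrib_left mult_ac)
    finally have id: "(\<Sum>i=1..n. \<psi> i * (ln (real i) / real i)) =
        (\<Sum>d=1..n. h d * (\<Sum>e=1..n div d. \<psi> e / real e))" .
    have "\<bar>L * (\<Sum>d=1..n. h d) - (\<Sum>d=1..n. h d * (\<Sum>e=1..n div d. \<psi> e / real e))\<bar>
        = \<bar>\<Sum>d=1..n. h d * (L - (\<Sum>e=1..n div d. \<psi> e / real e))\<bar>"
      by (simp add: right_diff_distrib sum_subtractf sum_distrib_left mult.commute)
    also have "\<dots> \<le> (\<Sum>d=1..n. mangoldt d * (2 * real k / real n))"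
    proof (rule order.trans[OF sum_abs sum_mono])
      fix d assume d: "d \<in> {1..n}"
      have "\<bar>h d\<bar> \<le> mangoldt d / real d"
        using abs_le_1[of d] mangoldt_nonneg[of d] d
        by (simp add: h_def abs_mult divide_right_mono mult_left_le)
      moreover have "\<bar>L - (\<Sum>e=1..n div d. \<psi> e / real e)\<bar> \<le> 2 * real k / real (n div d + 1)"
        by (rule L_tail)
      moreover have "2 * real k / real (n div d + 1) \<le> 2 * real k * real d / real n"
      proof -
        have "n < d * (n div d + 1)" using d
          by (metis Suc_eq_plus1 atLeastAtMost_iff dividend_less_times_div less_le_trans mult_Suc_right add.commute zero_less_one)
        then have "real n \<le> real d * real (n div d + 1)"
          by (metis less_imp_le of_nat_le_iff of_nat_mult)
        then have "2 * real k * real n \<le> 2 * real k * (real d * real (n div d + 1))"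
          by (intro mult_left_mono) auto
        then show ?thesis using False by (simp add: field_simps)
      qed
      ultimately have "\<bar>h d\<bar> * \<bar>L - (\<Sum>e=1..n div d. \<psi> e / real e)\<bar>
          \<le> mangoldt d / real d * (2 * real k * real d / real n)"
        using mangoldt_nonneg[of d] by (intro mult_mono) (auto intro: order.trans)
      also have "\<dots> = mangoldt d * (2 * real k / real n)" using d by simp
      finally show "\<bar>h d * (L - (\<Sum>e=1..n div d. \<psi> e / real e))\<bar> \<le> mangoldt d * (2 * real k / real n)"
        by (simp add: abs_mult)
    qed
    also have "\<dots> = (\<Sum>d=1..n. mangoldt d) * (2 * real k / real n)"
      by (rule sum_distrib_right[symmetric])
    also have "\<dots> \<le> 4 * real n * (2 * real k / real n)"
      by (intro mult_right_mono chebyshev_upper_bound) auto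
    also have "\<dots> = 8 * real k" using False by simp
    finally have "\<bar>L * (\<Sum>d=1..n. h d) - (\<Sum>i=1..n. \<psi> i * (ln (real i) / real i))\<bar> \<le> 8 * real k"
      unfolding id .
    then show ?thesis using C[of n] unfolding h_def by linarith
  qed
  then show ?thesis by blast
qed

end

section \<open>Non-vanishing of the L-series at 1\<close>

context quadratic_character
begin

text \<open>The Dirichlet convolution of \<open>\<psi>\<close> with the constant 1. For the character of a quadratic field it is the
  number of ideals of norm \<open>n\<close>, which explains its positivity properties.\<close>

definition divisor_sum :: "nat \<Rightarrow> real" where
  "divisor_sum n = (\<Sum>d | d dvd n. \<psi> d)"

lemma divisor_sum_split:
  assumes p: "prime p" and m: "\<not> p dvd m" "m > 0"
  shows "divisor_sum (p ^ a * m) = (\<Sum>i\<le>a. \<psi> p ^ i) * divisor_sum m"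
proof -
  have "divisor_sum (p ^ a * m) = (\<Sum>(i,d)\<in>{..a} \<times> {d. d dvd m}. \<psi> (p ^ i * d))"
    unfolding divisor_sum_def
  proof (rule sum.reindex_bij_betw[symmetric, of "\<lambda>(i,d). p ^ i * d", THEN trans])
    show "bij_betw (\<lambda>(i,d). p ^ i * d) ({..a} \<times> {d. d dvd m}) {d. d dvd p ^ a * m}"
      unfolding bij_betw_def
    proof
      show "inj_on (\<lambda>(i,d). p ^ i * d) ({..a} \<times> {d. d dvd m})"
      proof (rule inj_onI, clarify)
        fix i d j e assume d: "d dvd m" "e dvd m" and eq: "p ^ i * d = p ^ j * e"
        have "\<not> p dvd d" "\<not> p dvd e" "d > 0" "e > 0" using d m dvd_trans by (auto intro: gr0I)
        then have "multiplicity p (p ^ i * d) = i" "multiplicity p (p ^ j * e) = j"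
          using p by (simp_all add: multiplicity_prime_elem_times_other
              prime_elem_multiplicity_mult_distrib not_dvd_imp_multiplicity_0)
        then have "i = j" using eq by simp
        then show "i = j \<and> d = e" using eq p by (auto dest: prime_gt_0_nat)
      qed
      show "(\<lambda>(i,d). p ^ i * d) ` ({..a} \<times> {d. d dvd m}) = {d. d dvd p ^ a * m}"
      proof (intro subset_antisym subsetI)
        fix x assume "x \<in> {d. d dvd p ^ a * m}"
        then obtain u v where uv: "u dvd p ^ a" "v dvd m" "x = u * v"
          using division_decomp by blast
        obtain i where "i \<le> a" "u = p ^ i" using uv(1) p by (auto simp: divides_primepow_nat)
        then show "x \<in> (\<lambda>(i,d). p ^ i * d) ` ({..a} \<times> {d. d dvd m})" using uv by force
      qed (auto intro: mult_dvd_mono le_imp_power_dvd)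
    qed
  qed (simp add: case_prod_unfold)
  also have "\<dots> = (\<Sum>i\<le>a. \<psi> p ^ i) * (\<Sum>d | d dvd m. \<psi> d)"
    unfolding sum_product sum.cartesian_product by (simp add: psi_mult psi_power)
  finally show ?thesis by (simp add: divisor_sum_def)
qed

lemma geometric_nonneg: "(\<Sum>i\<le>a. \<psi> p ^ i) \<ge> 0"
  and geometric_ge_1: "even a \<Longrightarrow> (\<Sum>i\<le>a. \<psi> p ^ i) \<ge> 1"
proof -
  have "\<psi> p = -1 \<Longrightarrow> (\<Sum>i\<le>a. \<psi> p ^ i) = (if even a then 1 else 0)"
    by (induction a) auto
  moreover have "\<psi> p = 0 \<Longrightarrow> (\<Sum>i\<le>a. \<psi> p ^ i) = 1" by (induction a) auto
  moreover have "\<psi> p = 1 \<Longrightarrow> (\<Sum>i\<le>a. \<psi> p ^ i) = real a + 1" by (induction a) auto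
  ultimately show "(\<Sum>i\<le>a. \<psi> p ^ i) \<ge> 0" "even a \<Longrightarrow> (\<Sum>i\<le>a. \<psi> p ^ i) \<ge> 1"
    using psi_values[of p] by auto
qed

lemma divisor_sum_1: "divisor_sum 1 = 1"
  using psi_one by (simp add: divisor_sum_def)

text \<open>Multiplicativity reduces this and the next lemma to powers of a single prime, that is, to the
  geometric sums above.\<close>

lemma divisor_sum_nonneg: "n > 0 \<Longrightarrow> divisor_sum n \<ge> 0"
proof (induction n rule: less_induct)
  case (less n)
  show ?case
  proof (cases "n = 1")
    case False
    then obtain p where p: "prime p" "p dvd n" using prime_factor_nat by blast
    obtain m where m: "n = p ^ multiplicity p n * m" "\<not> p dvd m"
      using multiplicity_decompose'[of n p] less.prems p by (metis neq0_conv not_prime_unit)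
    have "multiplicity p n > 0" using p less.prems
      by (simp add: prime_multiplicity_gt_zero_iff)
    then have "1 < p ^ multiplicity p n" using p by (intro one_less_power prime_gt_1_nat)
    then have "0 < m" "m < n" using m(1) less.prems by (metis gr0I mult_0_right, metis gr0I
        mult.left_neutral mult_0_right mult_less_cancel2)
    then show ?thesis using less.IH[of m] divisor_sum_split[OF p(1) m(2)] geometric_nonneg m(1)
      by (metis mult_nonneg_nonneg)
  qed (use divisor_sum_1 in simp)
qed

lemma divisor_sum_square: "j > 0 \<Longrightarrow> divisor_sum (j ^ 2) \<ge> 1"
proof (induction j rule: less_induct)
  case (less j)
  show ?case
  proof (cases "j = 1")
    case False
    then obtain p where p: "prime p" "p dvd j" using prime_factor_nat by blast
    obtain m where m: "j = p ^ multiplicity p j * m" "\<not> p dvd m"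
      using multiplicity_decompose'[of j p] less.prems p by (metis neq0_conv not_prime_unit)
    define b where "b = multiplicity p j"
    have "b > 0" using p less.prems
      by (simp add: b_def prime_multiplicity_gt_zero_iff)
    then have "1 < p ^ b" using p by (intro one_less_power prime_gt_1_nat)
    then have m0: "0 < m" "m < j" using m(1) less.prems by (metis gr0I mult_0_right, metis gr0I b_def
        mult.left_neutral mult_0_right mult_less_cancel2)
    have "j ^ 2 = p ^ (2 * b) * m ^ 2"
      by (subst m(1)) (simp add: b_def power_mult_distrib mult.commute flip: power_mult)
    moreover have "\<not> p dvd m ^ 2" using m(2) p prime_dvd_power by blast
    ultimately have "divisor_sum (j ^ 2) = (\<Sum>i\<le>2 * b. \<psi> p ^ i) * divisor_sum (m ^ 2)"
      using divisor_sum_split[OF p(1), of "m ^ 2" "2 * b"] m0 by simp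
    moreover have "1 * 1 \<le> (\<Sum>i\<le>2 * b. \<psi> p ^ i) * divisor_sum (m ^ 2)"
      using less.IH[OF m0(2,1)] geometric_ge_1[of "2 * b" p] by (intro mult_mono) auto
    ultimately show ?thesis by simp
  qed (use divisor_sum_1 in simp)
qed

end

text \<open>The inequality of the arithmetic and the geometric mean for the powers \<open>1, s\<^sup>2, \<dots>, s\<^bsup>2n\<^esup>\<close>, proved by
  pairing the first power with the last one.\<close>

lemma geometric_sum_am_gm:
  fixes s :: real
  assumes "0 \<le> s" 
  shows "real (Suc n) * s ^ n \<le> (\<Sum>i\<le>n. s ^ (2 * i))"
proof (induction n rule: nat_less_induct)
  case (1 n)
  consider "n = 0" | "n = 1" | m where "n = Suc (Suc m)"
    by (metis One_nat_def not0_implies_Suc)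
  then show ?case
  proof cases
    case 2
    have "0 \<le> (1 - s)\<^sup>2" by simp
    then show ?thesis using 2 by (simp add: power2_eq_square algebra_simps)
  next
    case 3
    have "(\<Sum>i\<le>n. s ^ (2 * i)) = 1 + s ^ 2 * (\<Sum>i\<le>m. s ^ (2 * i)) + (s ^ n)\<^sup>2"
    proof -
      have "(\<Sum>i\<le>n. s ^ (2 * i)) = s ^ (2 * 0) + (\<Sum>i\<le>m. s ^ (2 * Suc i)) + s ^ (2 * n)"
        unfolding 3 by (subst sum.atMost_Suc, subst sum.atMost_Suc_shift) (rule refl)
      moreover have "(\<Sum>i\<le>m. s ^ (2 * Suc i)) = s ^ 2 * (\<Sum>i\<le>m. s ^ (2 * i))"
        unfolding sum_distrib_left by (intro sum.cong) (simp_all add: power2_eq_square mult.assoc)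
      ultimately show ?thesis by (simp add: power_even_eq)
    qed
    moreover have "s ^ 2 * (real (Suc m) * s ^ m) \<le> s ^ 2 * (\<Sum>i\<le>m. s ^ (2 * i))"
      using 1 3 by (intro mult_left_mono) auto
    moreover have "2 * s ^ n \<le> 1 + (s ^ n)\<^sup>2"
      using zero_le_power2[of "1 - s ^ n"] by (simp add: power2_eq_square algebra_simps)
    ultimately show ?thesis unfolding 3 by (simp add: power2_eq_square algebra_simps)
  qed simp
qed

text \<open>As \<open>t\<close> tends to 1, the term \<open>t\<^sup>n / (1 - t\<^sup>n)\<close> of a Lambert series behaves like \<open>1 / (n (1 - t))\<close>; the
  weight is what is left after subtracting. When \<open>L = 0\<close> the leading parts cancel in the sum against
  \<open>\<psi>\<close>, and the weights alone determine the size of the Lambert series.\<close>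

definition monsky_weight :: "real \<Rightarrow> nat \<Rightarrow> real" where
  "monsky_weight t n = 1 / (real n * (1 - t)) - t ^ n / (1 - t ^ n)"

text \<open>With \<open>S\<^sub>m = 1 + t + \<dots> + t\<^bsup>m-1\<^esup>\<close>, so that \<open>1 - t\<^sup>m = (1 - t) S\<^sub>m\<close>, the decrease of the weights amounts to
  \<open>n (n + 1) t\<^sup>n \<le> S\<^sub>n S\<^bsub>n+1\<^esub>\<close>, which is the product of two instances of \<open>geometric_sum_am_gm\<close>.\<close>

lemma monsky_weight:
  assumes t: "0 < t" "t < 1" and n: "n \<ge> 1"
  shows monsky_weight_nonneg: "0 \<le> monsky_weight t n"
    and monsky_weight_antimono: "monsky_weight t (Suc n) \<le> monsky_weight t n"
proof -
  define S where "S m = (\<Sum>i<m. t ^ i)" for m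
  have S: "1 - t ^ m = (1 - t) * S m" for m
    using one_diff_power_eq[of t m] by (simp add: S_def)
  have Spos: "S m > 0" if "m \<ge> 1" for m
  proof -
    have "t ^ m < 1" using t that by (simp add: power_less_one_iff)
    then show ?thesis using S[of m] t by (metis diff_gt_0_iff_gt zero_less_mult_pos)
  qed
  have "real n * t ^ n = (\<Sum>i<n. t ^ n)" by simp
  also have "\<dots> \<le> S n" unfolding S_def using t by (intro sum_mono power_decreasing) auto
  finally have le: "real n * t ^ n \<le> S n" .
  have "t ^ n / (1 - t ^ n) \<le> 1 / (real n * (1 - t))"
  proof -
    have "t ^ n / S n \<le> 1 / real n" using le Spos[OF n] n by (simp add: field_simps)
    then have "t ^ n / S n / (1 - t) \<le> 1 / real n / (1 - t)" using t by (intro divide_right_mono) auto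
    then show ?thesis unfolding S by (simp add: mult.commute)
  qed
  then show "0 \<le> monsky_weight t n" by (simp add: monsky_weight_def)
  define s where "s = sqrt t"
  have s: "0 < s" "s < 1" "t = s ^ 2" using t by (auto simp: s_def)
  obtain m where m: "n = Suc m" using n by (cases n) auto
  have "S (Suc j) = (\<Sum>i\<le>j. s ^ (2 * i))" for j
    unfolding S_def s(3) by (simp only: lessThan_Suc_atMost power_mult)
  then have "real n * s ^ m \<le> S n" "real (Suc n) * s ^ n \<le> S (Suc n)"
    using geometric_sum_am_gm[of s m] geometric_sum_am_gm[of s n] s m by auto
  then have "(real n * s ^ m) * (real (Suc n) * s ^ n) \<le> S n * S (Suc n)"
    using s Spos[OF n] by (intro mult_mono) (auto simp: less_imp_le)
  moreover have "t ^ n \<le> s ^ m * s ^ n"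
  proof -
    have "t ^ n = s ^ (2 * n)" by (simp add: s(3) power_mult)
    also have "\<dots> \<le> s ^ (m + n)" using s m by (intro power_decreasing) auto
    finally show ?thesis by (simp add: power_add)
  qed
  then have "real n * real (Suc n) * t ^ n \<le> (real n * s ^ m) * (real (Suc n) * s ^ n)"
    using mult_left_mono[of "t ^ n" "s ^ m * s ^ n" "real n * real (Suc n)"] by (simp add: mult_ac)
  ultimately have key: "real n * real (Suc n) * t ^ n \<le> S n * S (Suc n)" by linarith
  have "t ^ n / (1 - t ^ n) - t ^ Suc n / (1 - t ^ Suc n) = t ^ n * (1 - t) / ((1 - t ^ n) * (1 - t ^ Suc n))"
  proof -
    have "1 - t ^ n \<noteq> 0" "1 - t ^ Suc n \<noteq> 0"
      using S[of n] S[of "Suc n"] Spos[OF n] Spos[of "Suc n"] t by auto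
    then show ?thesis by (simp add: field_simps)
  qed
  also have "\<dots> = t ^ n / ((1 - t) * (S n * S (Suc n)))"
  proof -
    have "x * u / ((u * a) * (u * b)) = x / (u * (a * b))" if "u \<noteq> 0" for x u a b :: real
      using that by (simp add: field_simps)
    then show ?thesis unfolding S using t by simp
  qed
  also have "\<dots> \<le> 1 / ((1 - t) * (real n * real (Suc n)))"
  proof -
    have "x / (u * a) \<le> 1 / (u * b)" if "b * x \<le> a" "u > 0" "a > 0" "b > 0" for x u a b :: real
    proof -
      have "x / a \<le> 1 / b" using that by (simp add: field_simps)
      then have "x / a / u \<le> 1 / b / u" using that by (intro divide_right_mono) auto
      then show ?thesis by (simp add: mult.commute)
    qed
    then show ?thesis using key t n Spos[OF n] Spos[of "Suc n"] by simp
  qed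
  also have "\<dots> = 1 / (real n * (1 - t)) - 1 / (real (Suc n) * (1 - t))"
  proof -
    have "1 / (u * (a * (a + 1))) = 1 / (a * u) - 1 / ((a + 1) * u)" if "u > 0" "a > 0" for u a :: real
    proof -
      have "1 / (a * (a + 1)) = 1 / a - 1 / (a + 1)" using that by (simp add: field_simps)
      then have "1 / (a * (a + 1)) / u = 1 / a / u - 1 / (a + 1) / u" by (simp add: diff_divide_distrib)
      then show ?thesis by (simp add: mult.commute)
    qed
    from this[of "1 - t" "real n"] show ?thesis using t n by (simp add: add.commute)
  qed
  finally show "monsky_weight t (Suc n) \<le> monsky_weight t n"
    by (simp add: monsky_weight_def)
qed

context quadratic_character
begin

text \<open>The series of \<open>divisor_sum m t\<^sup>m\<close> dominates the series of \<open>t\<close> to the square powers. It is also the Lambert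
  series of \<open>\<psi>\<close>, which for \<open>L = 0\<close> is the negative sum of \<open>\<psi> d\<close> times the Monsky weights; Abel
  summation bounds the latter independently of \<open>t\<close>.\<close>

lemma divisor_series_bound:
  assumes L0: "L = 0" and t: "0 < t" "t < 1"
  shows "(\<Sum>j=1..J. t ^ (j ^ 2)) \<le> 2 * real k"
proof (rule tendsto_le[OF sequentially_bot])
  (* The last two summands are the errors made by stopping at M: one from the partial sum of the
     L-series, one from cutting the geometric series in t ^ d at exponent M. *)
  define R where "R M = 2 * real k + \<bar>\<Sum>d=1..M. \<psi> d / real d\<bar> / (1 - t) + real M * t ^ M / (1 - t)" for M
  have "(\<lambda>M. \<Sum>d=1..M. \<psi> d / real d) \<longlonglongrightarrow> 0"
  proof -
    have "(\<lambda>M. \<Sum>d<Suc M. \<psi> d / real d) \<longlonglongrightarrow> 0"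
      using sums_L L0 unfolding sums_def by (subst filterlim_sequentially_Suc) simp
    moreover have "(\<Sum>d<Suc M. \<psi> d / real d) = (\<Sum>d=1..M. \<psi> d / real d)" for M
      by (rule sum.mono_neutral_right) (auto simp: not_le)
    ultimately show ?thesis by simp
  qed
  moreover have "(\<lambda>M. real M * t ^ M) \<longlonglongrightarrow> 0"
    using t by (intro powser_times_n_limit_0) auto
  ultimately have "R \<longlonglongrightarrow> 2 * real k + \<bar>0\<bar> / (1 - t) + 0 / (1 - t)"
    unfolding R_def using t by (intro tendsto_intros) auto
  then show "R \<longlonglongrightarrow> 2 * real k" by simp
  show "(\<lambda>_. \<Sum>j=1..J. t ^ (j ^ 2)) \<longlonglongrightarrow> (\<Sum>j=1..J. t ^ (j ^ 2))" by simp
  show "\<forall>\<^sub>F M in sequentially. (\<Sum>j=1..J. t ^ (j ^ 2)) \<le> R M"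
    unfolding eventually_sequentially
  proof (intro exI[of _ "J ^ 2"] allI impI)
    fix M assume M: "J ^ 2 \<le> M"
    have tpow: "0 < 1 - t ^ d" "1 - t \<le> 1 - t ^ d" if "d \<ge> 1" for d
      using t that by (auto simp: power_less_one_iff power_decreasing[of 1 d t, simplified])
    have "(\<Sum>j=1..J. t ^ (j ^ 2)) = (\<Sum>m\<in>(\<lambda>j. j ^ 2) ` {1..J}. t ^ m)"
      by (subst sum.reindex) (auto simp: inj_on_def)
    also have "\<dots> \<le> (\<Sum>m\<in>(\<lambda>j. j ^ 2) ` {1..J}. divisor_sum m * t ^ m)"
      using divisor_sum_square t by (intro sum_mono) (auto simp: mult_le_cancel_right1)
    also have "\<dots> \<le> (\<Sum>m=1..M. divisor_sum m * t ^ m)"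
    proof (rule sum_mono2)
      have "j ^ 2 \<le> M" if "j \<le> J" for j using M that power_mono[of j J 2] by linarith
      then show "(\<lambda>j. j ^ 2) ` {1..J} \<subseteq> {1..M}" by auto
    qed (use divisor_sum_nonneg t in auto)
    also have "\<dots> = (\<Sum>m=1..M. \<Sum>d | d dvd m. \<psi> d * t ^ m)"
      by (simp add: divisor_sum_def sum_distrib_right)
    also have "\<dots> = (\<Sum>d=1..M. \<Sum>e=1..M div d. \<psi> d * t ^ (d * e))"
      by (rule sum_over_divisors_swap)
    also have "\<dots> = (\<Sum>d=1..M. \<psi> d * (t ^ d / (1 - t ^ d)) - \<psi> d * (t ^ (d * (M div d + 1)) / (1 - t ^ d)))"
    proof (rule sum.cong)
      fix d assume d: "d \<in> {1..M}"
      have "(\<Sum>e=1..N. x ^ e) * (1 - x) = x - x ^ (N + 1)" for N and x :: real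
      proof (induction N)
        case (Suc N)
        have "x ^ Suc N * (1 - x) = x ^ Suc N - x ^ (Suc N + 1)" by (simp add: algebra_simps)
        then show ?case using Suc by (simp add: distrib_right del: power_Suc)
      qed simp
      from this[of "t ^ d"] have "(\<Sum>e=1..M div d. t ^ (d * e)) = (t ^ d - t ^ (d * (M div d + 1))) / (1 - t ^ d)"
        using tpow(1)[of d] d by (subst eq_divide_eq) (auto simp: power_mult power_add)
      then show "(\<Sum>e=1..M div d. \<psi> d * t ^ (d * e)) =
          \<psi> d * (t ^ d / (1 - t ^ d)) - \<psi> d * (t ^ (d * (M div d + 1)) / (1 - t ^ d))"
        by (simp add: right_diff_distrib diff_divide_distrib flip: sum_distrib_left)
    qed simp
    also have "\<dots> = (\<Sum>d=1..M. \<psi> d / real d) / (1 - t) - (\<Sum>d=1..M. \<psi> d * monsky_weight t d)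
        - (\<Sum>d=1..M. \<psi> d * (t ^ (d * (M div d + 1)) / (1 - t ^ d)))"
      unfolding monsky_weight_def
      by (simp add: right_diff_distrib sum_subtractf sum_divide_distrib)
    also have "\<dots> \<le> R M"
    proof -
      have "\<bar>\<Sum>d=1..<Suc M. \<psi> d * monsky_weight t d\<bar> \<le> 2 * real k * monsky_weight t 1"
        using monsky_weight[OF t] by (intro weighted_sum_bound) auto
      moreover have "monsky_weight t 1 = 1" using t by (simp add: monsky_weight_def diff_divide_distrib[symmetric])
      ultimately have 1: "\<bar>\<Sum>d=1..M. \<psi> d * monsky_weight t d\<bar> \<le> 2 * real k"
        by (simp add: atLeastLessThanSuc_atLeastAtMost)
      have "\<bar>\<Sum>d=1..M. \<psi> d * (t ^ (d * (M div d + 1)) / (1 - t ^ d))\<bar> \<le> (\<Sum>d=1..M. t ^ M / (1 - t))"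
      proof (rule order.trans[OF sum_abs sum_mono])
        fix d assume d: "d \<in> {1..M}"
        have "M \<le> d * (M div d + 1)" using d
          by (metis Suc_eq_plus1 atLeastAtMost_iff dividend_less_times_div less_imp_le less_le_trans mult_Suc_right add.commute zero_less_one)
        then have "t ^ (d * (M div d + 1)) \<le> t ^ M" using t by (intro power_decreasing) auto
        then have "t ^ (d * (M div d + 1)) / (1 - t ^ d) \<le> t ^ M / (1 - t)"
          using tpow[of d] d t by (intro frac_le) auto
        moreover have "0 \<le> t ^ (d * (M div d + 1)) / (1 - t ^ d)" using tpow(1)[of d] d t by auto
        ultimately have "\<bar>\<psi> d\<bar> * (t ^ (d * (M div d + 1)) / (1 - t ^ d)) \<le> 1 * (t ^ M / (1 - t))"
          using abs_le_1[of d] by (intro mult_mono) auto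
        then show "\<bar>\<psi> d * (t ^ (d * (M div d + 1)) / (1 - t ^ d))\<bar> \<le> t ^ M / (1 - t)"
          unfolding abs_mult using \<open>0 \<le> t ^ (d * (M div d + 1)) / (1 - t ^ d)\<close> by (simp only: abs_of_nonneg mult_1)
      qed
      then have 2: "\<bar>\<Sum>d=1..M. \<psi> d * (t ^ (d * (M div d + 1)) / (1 - t ^ d))\<bar> \<le> real M * t ^ M / (1 - t)"
        by simp
      have "(\<Sum>d=1..M. \<psi> d / real d) / (1 - t) \<le> \<bar>\<Sum>d=1..M. \<psi> d / real d\<bar> / (1 - t)"
        using t by (intro divide_right_mono) auto
      then show ?thesis using 1 2 unfolding R_def by linarith
    qed
    finally show "(\<Sum>j=1..J. t ^ (j ^ 2)) \<le> R M" .
  qed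
qed

text \<open>Otherwise \<open>2k + 1\<close> powers of \<open>t\<close>, each tending to 1 with \<open>t\<close>, would have a sum of at most \<open>2k\<close>.\<close>

lemma L_nonzero: "L \<noteq> 0"
proof
  assume L0: "L = 0"
  define J where "J = 2 * k + 1"
  have "((\<lambda>t. \<Sum>j=1..J. t ^ (j ^ 2)) \<longlongrightarrow> (\<Sum>j=1..J. 1 ^ (j ^ 2))) (at_left (1::real))"
    by (intro tendsto_intros)
  moreover have "\<forall>\<^sub>F t in at_left (1::real). (\<Sum>j=1..J. t ^ (j ^ 2)) \<le> 2 * real k"
    using divisor_series_bound[OF L0] by (intro eventually_at_leftI[of 0]) auto
  ultimately have "(\<Sum>j=1..J. 1 ^ (j ^ 2)) \<le> 2 * real k"
    by (rule tendsto_upperbound) simp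
  then show False by (simp add: J_def)
qed

lemma mangoldt_sum_bounded: "\<exists>C. \<forall>n. \<bar>\<Sum>d=1..n. mangoldt d * \<psi> d / real d\<bar> \<le> C"
proof -
  obtain C where "\<And>n. \<bar>L * (\<Sum>d=1..n. mangoldt d * \<psi> d / real d)\<bar> \<le> C"
    using mangoldt_sum_times_L_bounded by blast
  then have "\<bar>\<Sum>d=1..n. mangoldt d * \<psi> d / real d\<bar> \<le> C / \<bar>L\<bar>" for n
    using L_nonzero by (simp add: abs_mult field_simps)
  then show ?thesis by blast
qed

end

section \<open>Primes with prescribed character values\<close>

text \<open>The product \<open>H d\<close> of the factors \<open>1 + s i \<psi>\<^sub>i d\<close> vanishes at every prime \<open>d > k\<close> without the prescribed
  signs. Expand the product in the sum of \<open>mangoldt d H d / d\<close>: the constant 1 contributes at least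
  \<open>ln n - 1\<close>, and every other term a bounded amount, because by \<open>indep\<close> a product of some of the \<open>\<psi>\<^sub>i\<close> is
  again a non-principal character. So the sum is unbounded; but if no prime had the prescribed signs,
  only prime powers and the primes up to \<open>k\<close> would contribute to it, again a bounded amount.\<close>

theorem prime_with_prescribed_signs:
  fixes \<psi> :: "'i \<Rightarrow> nat \<Rightarrow> real" and s :: "'i \<Rightarrow> real"
  assumes I: "finite I" and k: "k > 0"
    and mult: "\<And>i m n. i \<in> I \<Longrightarrow> \<psi> i (m * n) = \<psi> i m * \<psi> i n"
    and one: "\<And>i. i \<in> I \<Longrightarrow> \<psi> i 1 = 1"
    and periodic: "\<And>i n. i \<in> I \<Longrightarrow> \<psi> i (n + k) = \<psi> i n"
    and val: "\<And>i n. i \<in> I \<Longrightarrow> \<psi> i n \<in> {-1, 0, 1}"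
    and nonzero: "\<And>i n. i \<in> I \<Longrightarrow> coprime n k \<Longrightarrow> \<psi> i n \<noteq> 0"
    and indep: "\<And>T. T \<subseteq> I \<Longrightarrow> T \<noteq> {} \<Longrightarrow> (\<Sum>r<k. \<Prod>i\<in>T. \<psi> i r) = 0"
    and s: "\<And>i. i \<in> I \<Longrightarrow> s i \<in> {-1, 1}"
  shows "\<exists>q. prime q \<and> q > k \<and> (\<forall>i\<in>I. \<psi> i q = s i)"
proof (rule ccontr)
  assume no: "\<not> ?thesis"
  define H where "H n = (\<Prod>i\<in>I. 1 + s i * \<psi> i n)" for n
  have s_abs: "0 \<le> 1 + s i * \<psi> i n \<and> 1 + s i * \<psi> i n \<le> 2" if "i \<in> I" for i n
    using s[OF that] val[OF that, of n] by auto
  have H_nonneg: "0 \<le> H n" for n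
    unfolding H_def by (rule prod_nonneg) (use s_abs[where n = n] in force)
  have H_le: "H n \<le> 2 ^ card I" for n
  proof -
    have "H n \<le> (\<Prod>i\<in>I. 2)"
      unfolding H_def by (rule prod_mono) (use s_abs[where n = n] in force)
    then show ?thesis by simp
  qed
  have H_prime: "H q = 0" if q: "prime q" "q > k" for q
  proof -
    obtain i where i: "i \<in> I" "\<psi> i q \<noteq> s i" using no q by blast
    have "coprime q k" using q k by (intro prime_imp_coprime) (auto dest: dvd_imp_le)
    then have "\<psi> i q = - s i" using nonzero[OF i(1), of q] val[OF i(1), of q] s[OF i(1)] i(2) by auto
    then have "1 + s i * \<psi> i q = 0" using s[OF i(1)] by auto
    then show ?thesis unfolding H_def using I i(1) by (intro prod_zero) auto
  qed
  have bounded: "\<exists>C. \<forall>n. \<bar>\<Sum>d=1..n. mangoldt d * (\<Prod>i\<in>T. s i * \<psi> i d) / real d\<bar> \<le> C"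
    if T: "T \<subseteq> I" "T \<noteq> {}" for T
  proof -
    have TI: "i \<in> I" if "i \<in> T" for i using that T by blast
    interpret quadratic_character "\<lambda>n. \<Prod>i\<in>T. \<psi> i n" k
    proof
      show "(\<Prod>i\<in>T. \<psi> i n) \<in> {-1, 0, 1}" for n
        using finite_subset[OF T(1) I] TI
      proof (induction T rule: finite_induct)
        case (insert i T)
        then show ?case using val[of i n] by fastforce
      qed simp
    qed (use k mult one periodic indep T TI in \<open>auto simp: prod.distrib intro!: prod.neutral prod.cong\<close>)
    obtain C where C: "\<And>n. \<bar>\<Sum>d=1..n. mangoldt d * (\<Prod>i\<in>T. \<psi> i d) / real d\<bar> \<le> C"
      using mangoldt_sum_bounded by blast
    have "\<bar>\<Prod>i\<in>T. s i\<bar> = 1"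
      unfolding abs_prod by (rule prod.neutral) (use s TI in fastforce)
    moreover have "(\<Sum>d=1..n. mangoldt d * (\<Prod>i\<in>T. s i * \<psi> i d) / real d)
        = (\<Prod>i\<in>T. s i) * (\<Sum>d=1..n. mangoldt d * (\<Prod>i\<in>T. \<psi> i d) / real d)" for n
      by (simp add: prod.distrib sum_distrib_left mult_ac)
    ultimately show ?thesis using C by (auto simp: abs_mult intro!: exI[of _ C])
  qed
  obtain C where C: "\<And>T n. T \<subseteq> I \<Longrightarrow> T \<noteq> {} \<Longrightarrow>
      \<bar>\<Sum>d=1..n. mangoldt d * (\<Prod>i\<in>T. s i * \<psi> i d) / real d\<bar> \<le> C T"
    using bounded by metis
  obtain D where D: "\<And>n. (\<Sum>d | d \<in> {1..n} \<and> \<not> prime d. mangoldt d / real d) \<le> D"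
    using sum_mangoldt_nonprime_bounded by blast
  define B where "B = (\<Sum>T\<in>Pow I - {{}}. C T)"
  define E where "E = 2 ^ card I * (D + (\<Sum>d=1..k. mangoldt d / real d))"
  have "ln (real n) \<le> 1 + B + E" if n: "n > 0" for n
  proof -
    have "(\<Sum>d=1..n. mangoldt d * H d / real d)
        = (\<Sum>d=1..n. \<Sum>T\<in>Pow I. mangoldt d * (\<Prod>i\<in>T. s i * \<psi> i d) / real d)"
    proof (rule sum.cong)
      fix d
      have "H d = (\<Sum>T\<in>Pow I. \<Prod>i\<in>T. s i * \<psi> i d)"
        unfolding H_def using prod_add[OF I, of "\<lambda>i. s i * \<psi> i d" "\<lambda>_. 1"] by (simp add: add.commute)
      then show "mangoldt d * H d / real d = (\<Sum>T\<in>Pow I. mangoldt d * (\<Prod>i\<in>T. s i * \<psi> i d) / real d)"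
        by (simp add: sum_distrib_left sum_divide_distrib)
    qed simp
    also have "\<dots> = (\<Sum>T\<in>Pow I. \<Sum>d=1..n. mangoldt d * (\<Prod>i\<in>T. s i * \<psi> i d) / real d)"
      by (rule sum.swap)
    also have "\<dots> = (\<Sum>d=1..n. mangoldt d / real d)
        + (\<Sum>T\<in>Pow I - {{}}. \<Sum>d=1..n. mangoldt d * (\<Prod>i\<in>T. s i * \<psi> i d) / real d)"
      using I by (subst sum.remove[of _ "{}"]) auto
    also have "\<dots> \<ge> (ln (real n) - 1) + (- B)"
    proof (rule add_mono)
      show "ln (real n) - 1 \<le> (\<Sum>d=1..n. mangoldt d / real d)" by (rule mertens_lower_bound[OF n])
      have "\<bar>\<Sum>T\<in>Pow I - {{}}. \<Sum>d=1..n. mangoldt d * (\<Prod>i\<in>T. s i * \<psi> i d) / real d\<bar> \<le> B"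
        unfolding B_def by (rule order.trans[OF sum_abs sum_mono]) (use C in auto)
      then show "- B \<le> (\<Sum>T\<in>Pow I - {{}}. \<Sum>d=1..n. mangoldt d * (\<Prod>i\<in>T. s i * \<psi> i d) / real d)"
        by linarith
    qed
    finally have lower: "ln (real n) - 1 - B \<le> (\<Sum>d=1..n. mangoldt d * H d / real d)" by simp
    have "(\<Sum>d=1..n. mangoldt d * H d / real d)
        = (\<Sum>d\<in>{d\<in>{1..n}. \<not> prime d} \<union> {d\<in>{1..n}. d \<le> k \<and> prime d}. mangoldt d * H d / real d)"
    proof (rule sum.mono_neutral_right)
      show "\<forall>d\<in>{1..n} - ({d\<in>{1..n}. \<not> prime d} \<union> {d\<in>{1..n}. d \<le> k \<and> prime d}). mangoldt d * H d / real d = 0"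
      proof
        fix d assume "d \<in> {1..n} - ({d\<in>{1..n}. \<not> prime d} \<union> {d\<in>{1..n}. d \<le> k \<and> prime d})"
        then have "prime d" "d > k" by auto
        then show "mangoldt d * H d / real d = 0" using H_prime by simp
      qed
    qed auto
    also have "\<dots> = (\<Sum>d | d \<in> {1..n} \<and> \<not> prime d. mangoldt d * H d / real d)
        + (\<Sum>d | d \<in> {1..n} \<and> d \<le> k \<and> prime d. mangoldt d * H d / real d)"
      by (rule sum.union_disjoint) auto
    also have "\<dots> \<le> 2 ^ card I * (\<Sum>d | d \<in> {1..n} \<and> \<not> prime d. mangoldt d / real d)
        + 2 ^ card I * (\<Sum>d | d \<in> {1..n} \<and> d \<le> k \<and> prime d. mangoldt d / real d)"
    proof -
      have "mangoldt d * H d / real d \<le> 2 ^ card I * (mangoldt d / real d)" for d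
        using mult_left_mono[OF H_le mangoldt_nonneg[of d]] 
        by (simp add: divide_right_mono mult.commute)
      then show ?thesis unfolding sum_distrib_left by (intro add_mono sum_mono)
    qed
    also have "\<dots> \<le> 2 ^ card I * D + 2 ^ card I * (\<Sum>d=1..k. mangoldt d / real d)"
    proof (intro add_mono mult_left_mono)
      show "(\<Sum>d | d \<in> {1..n} \<and> d \<le> k \<and> prime d. mangoldt d / real d) \<le> (\<Sum>d=1..k. mangoldt d / real d)"
        by (rule sum_mono2) (auto simp: mangoldt_nonneg)
    qed (use D in auto)
    finally show ?thesis using lower by (simp add: E_def distrib_left)
  qed
  then have "ln (real n) \<le> 1 + B + E" if "n > 0" for n :: nat using that by blast
  moreover obtain n :: nat where n: "exp (1 + B + E) < real n" using reals_Archimedean2 by blast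
  ultimately have "ln (real n) \<le> 1 + B + E"
    using less_trans[OF exp_gt_zero n] by simp
  moreover have "1 + B + E < ln (real n)"
    using n less_trans[OF exp_gt_zero n] by (metis ln_exp ln_less_cancel_iff exp_gt_zero)
  ultimately show False by linarith
qed

section \<open>Legendre's theorem on diagonal ternary forms\<close>

lemma exists_int_sqrt:
  fixes n :: int
  assumes "n \<ge> 0"
  obtains r where "r \<ge> 0" "r ^ 2 \<le> n" "n < (r + 1) ^ 2"
proof -
  have fin: "finite {m::nat. m ^ 2 \<le> nat n}"
    by (rule finite_subset[of _ "{..nat n}"]) (auto simp: power2_eq_square intro: order.trans[OF le_square])
  define r where "r = Max {m::nat. m ^ 2 \<le> nat n}"
  have "0 \<in> {m::nat. m ^ 2 \<le> nat n}" by simp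
  then have r: "r ^ 2 \<le> nat n" using Max_in[OF fin] unfolding r_def by blast
  have "\<not> Suc r ^ 2 \<le> nat n"
    using Max_ge[OF fin, of "Suc r"] unfolding r_def by auto
  then have "nat n < Suc r ^ 2" by simp
  then have "int (nat n) < int (Suc r ^ 2)" by (simp only: of_nat_less_iff)
  moreover have "int (r ^ 2) \<le> int (nat n)" using r by (simp only: of_nat_le_iff)
  ultimately show ?thesis using that[of "int r"] assms by (simp add: add.commute)
qed

text \<open>Mordell's pigeonhole argument. By the residue conditions \<open>a x\<^sup>2 + b y\<^sup>2 - c z\<^sup>2\<close> is, up to a unit, divisible
  by a linear form modulo each of \<open>a\<close>, \<open>b\<close> and \<open>c\<close>. A box of sides about the square roots of \<open>bc\<close>,
  \<open>ac\<close>, \<open>ab\<close> has more than \<open>abc\<close> points, so all three linear forms vanish, modulo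
  \<open>a\<close>, \<open>b\<close>, \<open>c\<close>, at the difference of two of them.
  At this difference the quadratic form is a multiple of \<open>abc\<close> strictly between \<open>-abc\<close> and \<open>2abc\<close>.\<close>

theorem legendre_conic:
  fixes a b c :: int
  assumes pos: "a > 0" "b > 0" "c > 0"
    and cop: "coprime a b" "coprime b c" "coprime a c"
    and nonsq: "\<And>x. x ^ 2 \<noteq> a * b" "\<And>x. x ^ 2 \<noteq> b * c" "\<And>x. x ^ 2 \<noteq> a * c"
    and res: "QuadRes a (b * c)" "QuadRes b (a * c)" "QuadRes c (- (a * b))"
  obtains x y z :: int where "z \<noteq> 0" "a * x ^ 2 + b * y ^ 2 = c * z ^ 2"
proof -
  obtain r1 where r1: "a dvd r1 ^ 2 - b * c" using res(1) by (auto simp: QuadRes_def cong_iff_dvd_diff)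
  obtain r2 where r2: "b dvd r2 ^ 2 - a * c" using res(2) by (auto simp: QuadRes_def cong_iff_dvd_diff)
  obtain r3 where r3: "c dvd r3 ^ 2 + a * b" using res(3) by (auto simp: QuadRes_def cong_iff_dvd_diff)
  have nn: "0 \<le> b * c" "0 \<le> a * c" "0 \<le> a * b" using pos by auto
  obtain A where A: "A \<ge> 0" "A ^ 2 \<le> b * c" "b * c < (A + 1) ^ 2" using exists_int_sqrt[OF nn(1)] by blast
  obtain B where B: "B \<ge> 0" "B ^ 2 \<le> a * c" "a * c < (B + 1) ^ 2" using exists_int_sqrt[OF nn(2)] by blast
  obtain C where C: "C \<ge> 0" "C ^ 2 \<le> a * b" "a * b < (C + 1) ^ 2" using exists_int_sqrt[OF nn(3)] by blast
  have lt: "a * b * c < (A + 1) * (B + 1) * (C + 1)"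
  proof (rule power_less_imp_less_base)
    have "(a * b * c) ^ 2 = (b * c) * (a * c) * (a * b)" by (simp add: power2_eq_square)
    also have "\<dots> < (A + 1) ^ 2 * (B + 1) ^ 2 * (C + 1) ^ 2"
      using A B C pos by (intro mult_strict_mono) auto
    also have "\<dots> = ((A + 1) * (B + 1) * (C + 1)) ^ 2" by (simp add: power_mult_distrib)
    finally show "(a * b * c) ^ 2 < ((A + 1) * (B + 1) * (C + 1)) ^ 2" .
  qed (use A B C in auto)
  define D where "D = {0..A} \<times> {0..B} \<times> {0..C}"
  define R where "R = {0..<a} \<times> {0..<b} \<times> {0..<c}"
  define \<phi> where "\<phi> = (\<lambda>(x,y,z). ((b * y - r1 * z) mod a, (c * z - r2 * x) mod b, (a * x - r3 * y) mod c))"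
  have "card R < card D"
  proof -
    have "int (card R) = a * b * c" using pos by (simp add: R_def card_cartesian_product)
    moreover have "int (card D) = (A + 1) * (B + 1) * (C + 1)"
      using A B C by (simp add: D_def card_cartesian_product)
    ultimately show ?thesis using lt by linarith
  qed
  moreover have "\<phi> ` D \<subseteq> R" using pos by (auto simp: \<phi>_def R_def)
  then have "card (\<phi> ` D) \<le> card R" by (intro card_mono) (auto simp: R_def)
  ultimately have "\<not> inj_on \<phi> D" using card_image[of \<phi> D] by linarith
  then obtain u v where "u \<in> D" "v \<in> D" "u \<noteq> v" "\<phi> u = \<phi> v" unfolding inj_on_def by blast
  then obtain x1 y1 z1 x2 y2 z2 where in_D: "(x1,y1,z1) \<in> D" "(x2,y2,z2) \<in> D"
    and ne: "(x1,y1,z1) \<noteq> (x2,y2,z2)" and eq: "\<phi> (x1,y1,z1) = \<phi> (x2,y2,z2)"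
    by (metis prod_cases3)
  define x y z where xyz: "x = x1 - x2" "y = y1 - y2" "z = z1 - z2"
  have d1: "a dvd b * y - r1 * z"
  proof -
    have "a dvd (b * y1 - r1 * z1) - (b * y2 - r1 * z2)" using eq by (simp add: \<phi>_def mod_eq_dvd_iff)
    then show ?thesis by (simp add: xyz algebra_simps)
  qed
  have d2: "b dvd c * z - r2 * x"
  proof -
    have "b dvd (c * z1 - r2 * x1) - (c * z2 - r2 * x2)" using eq by (simp add: \<phi>_def mod_eq_dvd_iff)
    then show ?thesis by (simp add: xyz algebra_simps)
  qed
  have d3: "c dvd a * x - r3 * y"
  proof -
    have "c dvd (a * x1 - r3 * y1) - (a * x2 - r3 * y2)" using eq by (simp add: \<phi>_def mod_eq_dvd_iff)
    then show ?thesis by (simp add: xyz algebra_simps)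
  qed
  define V where "V = a * x ^ 2 + b * y ^ 2 - c * z ^ 2"
  have "a dvd V"
  proof -
    have "b * V = a * (b * x ^ 2) + (b * y - r1 * z) * (b * y + r1 * z) + (r1 ^ 2 - b * c) * z ^ 2"
      by (simp add: V_def power2_eq_square algebra_simps)
    then have "a dvd b * V" using d1 r1 by simp
    then show ?thesis using cop by (simp add: coprime_dvd_mult_right_iff)
  qed
  moreover have "b dvd V"
  proof -
    have "c * V = b * (c * y ^ 2) - (c * z - r2 * x) * (c * z + r2 * x) - (r2 ^ 2 - a * c) * x ^ 2"
      by (simp add: V_def power2_eq_square algebra_simps)
    then have "b dvd c * V" using d2 r2 by simp
    then show ?thesis using cop by (simp add: coprime_dvd_mult_right_iff)
  qed
  moreover have "c dvd V"
  proof -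
    have "a * V = c * (- a * z ^ 2) + (a * x - r3 * y) * (a * x + r3 * y) + (r3 ^ 2 + a * b) * y ^ 2"
      by (simp add: V_def power2_eq_square algebra_simps)
    then have "c dvd a * V" using d3 r3 by simp
    then show ?thesis using cop by (simp add: coprime_dvd_mult_right_iff coprime_commute)
  qed
  ultimately have "a * b * c dvd V" using cop by (intro divides_mult) auto
  then obtain m where m: "V = a * b * c * m" by (elim dvdE)
  have sq: "u ^ 2 < N" if "\<bar>u\<bar> \<le> U" "U ^ 2 \<le> N" "\<And>w. w ^ 2 \<noteq> N" for u U N :: int
  proof -
    have "u ^ 2 \<le> U ^ 2" using that(1) abs_le_square_iff[of u U] by linarith
    then show ?thesis using that(2) that(3)[of u] by linarith
  qed
  have "\<bar>x\<bar> \<le> A" "\<bar>y\<bar> \<le> B" "\<bar>z\<bar> \<le> C" using in_D by (auto simp: D_def xyz)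
  then have "x ^ 2 < b * c" "y ^ 2 < a * c" "z ^ 2 < a * b"
    using sq[of x A "b * c"] sq[of y B "a * c"] sq[of z C "a * b"] A B C nonsq by blast+
  then have "a * x ^ 2 < a * (b * c)" "b * y ^ 2 < b * (a * c)" "c * z ^ 2 < c * (a * b)"
    using pos by simp_all
  moreover have "a * x ^ 2 \<ge> 0" "b * y ^ 2 \<ge> 0" "c * z ^ 2 \<ge> 0" using pos by simp_all
  ultimately have "- (a * b * c) < V" "V < 2 * (a * b * c)" unfolding V_def by (auto simp: mult_ac)
  then have "a * b * c * (- 1) < a * b * c * m" "a * b * c * m < a * b * c * 2" using m by auto
  then have "-1 < m" "m < 2"
    using pos mult_less_cancel_left_pos[of "a * b * c"] by (metis mult_pos_pos)+
  then have "m = 0 \<or> m = 1" by linarith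
  then show ?thesis
  proof
    assume "m = 0"
    then have eq: "a * x ^ 2 + b * y ^ 2 = c * z ^ 2" using m by (simp add: V_def)
    moreover have "z \<noteq> 0"
    proof
      assume "z = 0"
      then have "a * x ^ 2 = 0 \<and> b * y ^ 2 = 0"
        using eq pos by (intro add_nonneg_eq_0_iff[THEN iffD1]) auto
      then have "x = 0 \<and> y = 0" using pos by simp
      then show False using ne \<open>z = 0\<close> by (auto simp: xyz)
    qed
    ultimately show ?thesis using that by blast
  next
    assume "m = 1"
    then have V: "a * x ^ 2 + b * y ^ 2 = c * (z ^ 2 + a * b)" using m by (simp add: V_def algebra_simps)
    (* Composition with z ^ 2 + a * b turns the value a * b * c into 0. *)
    have "a * (x * z + b * y) ^ 2 + b * (y * z - a * x) ^ 2 = (a * x ^ 2 + b * y ^ 2) * (z ^ 2 + a * b)"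
      by (simp add: power2_eq_square algebra_simps)
    also have "\<dots> = c * (z ^ 2 + a * b) ^ 2" unfolding V by (simp add: power2_eq_square)
    finally have "a * (x * z + b * y) ^ 2 + b * (y * z - a * x) ^ 2 = c * (z ^ 2 + a * b) ^ 2" .
    moreover have "z ^ 2 + a * b \<noteq> 0" using pos by (smt (verit) mult_pos_pos zero_le_power2)
    ultimately show ?thesis using that by blast
  qed
qed

section \<open>Legendre symbols\<close>

lemma Legendre_values: "Legendre a p \<in> {-1, 0, 1}"
  by (simp add: Legendre_def)

lemma Legendre_cong: "[a = b] (mod p) \<Longrightarrow> Legendre a p = Legendre b p"
proof -
  assume "[a = b] (mod p)"
  then have "[c = a] (mod p) \<longleftrightarrow> [c = b] (mod p)" "[a = c] (mod p) \<longleftrightarrow> [b = c] (mod p)" for c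
    by (simp_all add: unique_euclidean_semiring_class.cong_def)
  then show ?thesis by (simp add: Legendre_def QuadRes_def)
qed

lemma Legendre_eq_0_iff: "Legendre a p = 0 \<longleftrightarrow> p dvd a"
  by (simp add: Legendre_def cong_0_iff)

lemma Legendre_eq_1_imp_QuadRes: "Legendre a p = 1 \<Longrightarrow> QuadRes p a"
  by (simp add: Legendre_def split: if_splits)

lemma Legendre_square:
  assumes "\<not> p dvd a" "[y ^ 2 = a] (mod p)"
  shows "Legendre a p = 1"
  using assms by (auto simp: Legendre_def QuadRes_def cong_0_iff)

lemma small_multiple_eq_0:
  fixes x :: int
  assumes "int p dvd x" "\<bar>x\<bar> \<le> 2" "p > 2"
  shows "x = 0"
proof (rule ccontr)
  assume "x \<noteq> 0"
  then have "\<bar>int p\<bar> \<le> \<bar>x\<bar>" using assms(1) by (rule dvd_imp_le_int)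
  then show False using assms by linarith
qed

lemma Legendre_mult:
  assumes "prime p" "p > (2::nat)"
  shows "Legendre (a * b) p = Legendre a p * Legendre b p"
proof -
  have "[Legendre (a * b) p = (a * b) ^ ((p - 1) div 2)] (mod p)"
    using assms by (rule euler_criterion)
  moreover have "[Legendre a p * Legendre b p = a ^ ((p - 1) div 2) * b ^ ((p - 1) div 2)] (mod p)"
    using assms by (intro cong_mult euler_criterion)
  ultimately have "[Legendre (a * b) p = Legendre a p * Legendre b p] (mod p)"
    by (simp add: power_mult_distrib unique_euclidean_semiring_class.cong_def)
  then have dvd: "int p dvd Legendre (a * b) p - Legendre a p * Legendre b p"
    by (simp add: cong_iff_dvd_diff)
  have "\<bar>Legendre (a * b) p - Legendre a p * Legendre b p\<bar> \<le> 2"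
    using Legendre_values[of "a * b" p] Legendre_values[of a p] Legendre_values[of b p] by auto
  from small_multiple_eq_0[OF dvd this assms(2)] show ?thesis by simp
qed

text \<open>Squaring modulo \<open>p\<close> is not injective, as it identifies 1 and -1, and so it is not surjective.\<close>

lemma exists_nonresidue:
  assumes "prime p" "p > (2::nat)"
  obtains a :: nat where "Legendre a p = -1"
proof -
  define h where "h x = x ^ 2 mod int p" for x :: int
  have "\<not> inj_on h {0..<int p}"
  proof
    assume inj: "inj_on h {0..<int p}"
    have "h (int p - 1) = h 1"
      unfolding h_def mod_eq_dvd_iff by (simp add: power2_eq_square algebra_simps)
    then show False using inj_onD[OF inj, of "int p - 1" 1] assms by auto
  qed
  moreover have "h ` {0..<int p} \<subseteq> {0..<int p}" using assms by (auto simp: h_def)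
  ultimately have "h ` {0..<int p} \<noteq> {0..<int p}"
    by (metis eq_card_imp_inj_on finite_atLeastLessThan_int)
  then obtain a where a: "a \<in> {0..<int p}" "a \<notin> h ` {0..<int p}"
    using \<open>h ` {0..<int p} \<subseteq> {0..<int p}\<close> by blast
  have "\<not> QuadRes p a"
  proof
    assume "QuadRes p a"
    then obtain y :: int where "y ^ 2 mod int p = a" using a(1) by (auto simp: QuadRes_def unique_euclidean_semiring_class.cong_def)
    then have "h (y mod p) = a" by (simp add: h_def power_mod)
    moreover have "y mod p \<in> {0..<int p}" using assms by simp
    ultimately show False using a(2) by blast
  qed
  moreover have "a \<noteq> 0" using a(2) assms by (auto simp: h_def intro!: image_eqI[of _ _ 0])
  ultimately have "Legendre (int (nat a)) p = -1"
    using a by (auto simp: Legendre_def unique_euclidean_semiring_class.cong_def)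
  then show ?thesis using that by blast
qed

lemma Legendre_minus_1:
  assumes "prime p" "p > (2::nat)"
  shows "Legendre (-1) p = (-1) ^ ((p - 1) div 2)"
proof -
  have dvd: "int p dvd Legendre (-1) p - (-1) ^ ((p - 1) div 2)"
    using euler_criterion[OF assms, of "-1"] by (simp add: cong_iff_dvd_diff)
  have "\<bar>Legendre (-1) p - (-1) ^ ((p - 1) div 2)\<bar> \<le> 2"
    using Legendre_values[of "-1" p] by (cases "even ((p - 1) div 2)") auto
  from small_multiple_eq_0[OF dvd this assms(2)] show ?thesis by simp
qed

text \<open>A nonresidue raised to the power \<open>(p - 1) / 8\<close> is a primitive eighth root of unity \<open>w\<close>, with inverse
  \<open>-w\<^sup>3\<close>, and \<open>w + w\<^sup>-\<^sup>1\<close> is a square root of 2.\<close>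

lemma Legendre_2_mod_8:
  fixes p :: nat
  assumes "prime p" "[p = 1] (mod 8)"
  shows "Legendre 2 p = 1"
proof -
  have p: "p mod 8 = 1" using assms(2) by (simp add: unique_euclidean_semiring_class.cong_def)
  then have "p \<noteq> 2" by auto
  then have p2: "p > 2" using prime_gt_1_nat[OF assms(1)] by linarith
  obtain a :: nat where a: "Legendre a p = -1" by (rule exists_nonresidue[OF assms(1) p2])
  define t where "t = p div 8"
  have t: "p = 8 * t + 1" using div_mult_mod_eq[of p 8] p by (simp add: t_def)
  define w where "w = int a ^ t"
  have "(p - 1) div 2 = t * 4" using t by simp
  then have "w ^ 4 = int a ^ ((p - 1) div 2)" unfolding w_def by (simp only: power_mult)
  then have "[w ^ 4 = -1] (mod p)" using euler_criterion[OF assms(1) p2, of a] a by (simp add: cong_sym)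
  then have "int p dvd w ^ 4 + 1" by (simp add: cong_iff_dvd_diff)
  moreover have "(w - w ^ 3) ^ 2 - 2 = (w ^ 4 + 1) * (w ^ 2 - 2)"
    by (simp add: power2_eq_square power3_eq_cube power4_eq_xxxx algebra_simps)
  ultimately have "[(w - w ^ 3) ^ 2 = 2] (mod p)" by (simp add: cong_iff_dvd_diff)
  moreover have "\<not> int p dvd 2" using p2 by (auto dest: zdvd_imp_le)
  ultimately show ?thesis by (intro Legendre_square)
qed

lemma QuadRes_squarefree:
  assumes "squarefree (m::nat)" "\<And>p. prime p \<Longrightarrow> p dvd m \<Longrightarrow> QuadRes (int p) a"
  shows "QuadRes (int m) a"
  using assms
proof (induction m rule: less_induct)
  case (less m)
  show ?case
  proof (cases "m = 1")
    case True
    then show ?thesis by (simp add: QuadRes_def)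
  next
    case False
    then obtain p where p: "prime p" "p dvd m" using prime_factor_nat by blast
    then obtain n where n: "m = p * n" by (elim dvdE)
    have "m > 0" using less.prems(1) not_squarefree_0 by (metis gr0I)
    then have "n < m" using n prime_gt_1_nat[OF p(1)] by auto
    moreover have "squarefree n" using less.prems(1) n by (blast dest: squarefree_multD)
    ultimately have "QuadRes (int n) a" using less.IH less.prems(2) n by auto
    then obtain y where y: "[y ^ 2 = a] (mod int n)" by (auto simp: QuadRes_def)
    obtain x where x: "[x ^ 2 = a] (mod int p)" using less.prems(2) p by (auto simp: QuadRes_def)
    have "\<not> p dvd n"
    proof
      assume "p dvd n"
      then have "p ^ 2 dvd m" using n by (simp add: power2_eq_square mult_dvd_mono)
      then show False using squarefreeD[OF less.prems(1)] p(1) not_prime_unit by blast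
    qed
    then have cop: "coprime (int p) (int n)" using p prime_imp_coprime by auto
    obtain z where z: "[z = x] (mod int p)" "[z = y] (mod int n)"
      using binary_chinese_remainder_int[OF cop] by blast
    have "[z ^ 2 = a] (mod int p)" "[z ^ 2 = a] (mod int n)"
      using z x y by (meson cong_pow cong_trans)+
    then have "[z ^ 2 = a] (mod int m)" using cop by (simp add: n coprime_cong_mult)
    then show ?thesis by (auto simp: QuadRes_def)
  qed
qed

section \<open>Primes with prescribed quadratic residue symbols\<close>

text \<open>Indices 4 and 8 stand for the characters \<open>n \<mapsto> (-1 | n)\<close> and \<open>n \<mapsto> (2 | n)\<close>, which together
  determine an odd residue modulo 8. Every other index is a prime modulus.\<close>

definition sign_char :: "nat \<Rightarrow> nat \<Rightarrow> real" where
  "sign_char i n =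
     (if i = 4 then (if n mod 8 \<in> {1, 5} then 1 else if n mod 8 \<in> {3, 7} then -1 else 0)
      else if i = 8 then (if n mod 8 \<in> {1, 7} then 1 else if n mod 8 \<in> {3, 5} then -1 else 0)
      else of_int (Legendre (int n) (int i)))"

lemma mod_8_cases: "(n::nat) mod 8 \<in> {0,1,2,3,4,5,6,7}"
proof -
  have "m = 0 \<or> m = 1 \<or> m = 2 \<or> m = 3 \<or> m = 4 \<or> m = 5 \<or> m = 6 \<or> m = 7" if "m < 8" for m :: nat
    using that by linarith
  from this[of "n mod 8"] show ?thesis by simp
qed

lemma odd_mod_8_cases:
  assumes "odd (n::nat)"
  shows "n mod 8 \<in> {1,3,5,7}"
proof -
  have "odd (n mod 8)" using assms by (simp add: dvd_mod_iff)
  moreover have "m \<in> {1,3,5,7}" if "m \<in> {0,1,2,3,4,5,6,7}" "odd m" for m :: nat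
    using that by auto
  ultimately show ?thesis using mod_8_cases by blast
qed

lemma sign_char_mult:
  assumes "i \<in> {4,8} \<or> prime i \<and> i > 2"
  shows "sign_char i (m * n) = sign_char i m * sign_char i n"
proof (cases "i \<in> {4,8}")
  case True
  define f :: "nat \<Rightarrow> real" where "f r = (if r \<in> {1, 5} then 1 else if r \<in> {3, 7} then -1 else 0)" for r
  define g :: "nat \<Rightarrow> real" where "g r = (if r \<in> {1, 7} then 1 else if r \<in> {3, 5} then -1 else 0)" for r
  have fg: "f (a * b mod 8) = f a * f b \<and> g (a * b mod 8) = g a * g b"
    if "a \<in> {0,1,2,3,4,5,6,7}" "b \<in> {0,1,2,3,4,5,6,7}" for a b
  proof -
    have table: "f 0 = 0" "f 1 = 1" "f 2 = 0" "f 3 = -1" "f 4 = 0" "f 5 = 1" "f 6 = 0" "f 7 = -1"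
      "g 0 = 0" "g 1 = 1" "g 2 = 0" "g 3 = -1" "g 4 = 0" "g 5 = -1" "g 6 = 0" "g 7 = 1"
      by (simp_all add: f_def g_def)
    from that(1) show ?thesis
      by (elim insertE emptyE; use that(2) in \<open>elim insertE emptyE; simp add: table flip: One_nat_def\<close>)
  qed
  have "(m * n) mod 8 = (m mod 8) * (n mod 8) mod 8" by (simp add: mod_mult_eq)
  then have "f (m * n mod 8) = f (m mod 8) * f (n mod 8)" "g (m * n mod 8) = g (m mod 8) * g (n mod 8)"
    using fg[OF mod_8_cases mod_8_cases, of m n] by simp_all
  moreover have "sign_char 4 r = f (r mod 8)" "sign_char 8 r = g (r mod 8)" for r
    by (simp_all add: sign_char_def f_def g_def)
  ultimately show ?thesis using True by auto
next
  case False
  then show ?thesis using assms by (auto simp: sign_char_def Legendre_mult)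
qed

text \<open>The characters are independent: by the Chinese remainder theorem some \<open>a\<close> has value -1 under one
  of them and value 1 under all the others. Multiplication by \<open>a\<close> permutes the residues modulo \<open>k\<close> and
  changes the sign of every product that contains the chosen character, so that such a product has sum 0.\<close>

theorem prime_with_prescribed_residues:
  fixes S :: "nat set" and s :: "nat \<Rightarrow> int" and c :: nat
  assumes S: "finite S" "\<And>p. p \<in> S \<Longrightarrow> prime p \<and> p > 2"
    and s: "\<And>p. p \<in> S \<Longrightarrow> s p \<in> {-1, 1}" and c: "odd c"
  obtains q where "prime q" "\<And>p. p \<in> S \<Longrightarrow> p < q" "[q = c] (mod 8)" "\<And>p. p \<in> S \<Longrightarrow> Legendre (int q) (int p) = s p"
proof -
  define I where "I = {4, 8} \<union> S"
  define k where "k = 8 * \<Prod>S"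
  define \<sigma> where "\<sigma> i = (if i \<in> {4,8} then sign_char i c else of_int (s i))" for i :: nat
  have not48: "i \<notin> {4, 8}" if "i \<in> S" for i
  proof -
    have "odd i" using S(2)[OF that] prime_odd_nat by auto
    then show ?thesis by auto
  qed
  have I_prime: "i \<in> {4,8} \<or> prime i \<and> i > 2" if "i \<in> I" for i using that S(2) by (auto simp: I_def)
  have "\<Prod>S > 0" using S by (intro prod_pos) (auto intro: prime_gt_0_nat)
  then have k: "k > 0" by (simp add: k_def)
  have dvd_k: "i dvd k" if "i \<in> S" for i unfolding k_def using that S(1) by (intro dvd_mult dvd_prodI)
  have "8 dvd k" by (simp add: k_def)
  have nonzero: "sign_char i n \<noteq> 0" if "i \<in> I" "coprime n k" for i n
  proof (cases "i \<in> {4, 8}")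
    case True
    have "even k" by (simp add: k_def)
    then have "odd n" using that(2) coprime_common_divisor[of n k 2] by auto
    then show ?thesis using True odd_mod_8_cases[of n] by (auto simp: sign_char_def)
  next
    case False
    then have i: "i \<in> S" using that by (auto simp: I_def)
    have "\<not> i dvd n" using that(2) dvd_k[OF i] S(2)[OF i] coprime_common_divisor[of n k i] not_prime_unit by blast
    then show ?thesis using False by (simp add: sign_char_def Legendre_eq_0_iff)
  qed
  have per: "sign_char i (n mod k) = sign_char i n" if "i \<in> I" for i n
  proof (cases "i \<in> {4, 8}")
    case True
    have "n mod k mod 8 = n mod 8" using \<open>8 dvd k\<close> by (simp add: mod_mod_cancel)
    then show ?thesis using True by (auto simp: sign_char_def)
  next
    case False
    then have i: "i \<in> S" using that by (auto simp: I_def)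
    have "[n mod k = n] (mod i)" using dvd_k[OF i] by (simp add: unique_euclidean_semiring_class.cong_def mod_mod_cancel)
    then have "[int (n mod k) = int n] (mod int i)" by (simp add: cong_int_iff)
    then show ?thesis using False by (simp add: sign_char_def Legendre_cong)
  qed
  have separate: "\<exists>a. sign_char i a = -1 \<and> (\<forall>j\<in>I - {i}. sign_char j a = 1)" if i: "i \<in> I" for i
  proof -
    have "\<exists>b. i \<in> S \<longrightarrow> Legendre (int b) (int i) = -1" using exists_nonresidue S(2) by metis
    then obtain b where b: "i \<in> S \<longrightarrow> Legendre (int b) (int i) = -1" by blast
    (* Modulo 8, the residue 7 has value -1 only under index 4, and 5 only under index 8. *)
    define u where "u j = (if j = i \<and> i \<in> S then b else if j = 8 \<and> i = 4 then 7 else if j = 8 \<and> i = 8 then 5 else 1)" for j :: nat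
    have cop: "\<forall>x\<in>insert 8 S. \<forall>y\<in>insert 8 S. x \<noteq> y \<longrightarrow> coprime x y"
    proof (intro ballI impI)
      have "coprime 8 p" if "p \<in> S" for p :: nat
      proof -
        have "coprime 2 p" using S(2)[OF that] prime_odd_nat by (simp add: coprime_left_2_iff_odd)
        then have "coprime (2 ^ 3) p" by (rule coprime_power_left_iff[THEN iffD2, OF disjI1])
        then show ?thesis by simp
      qed
      then show "coprime x y" if "x \<in> insert 8 S" "y \<in> insert 8 S" "x \<noteq> y" for x y
        using that S(2) by (auto simp: primes_coprime coprime_commute)
    qed
    obtain a where a: "\<forall>j\<in>insert 8 S. [a = u j] (mod j)"
      using chinese_remainder_nat[of "insert 8 S" "\<lambda>j. j" u] cop S(1) by auto
    have S_eq: "sign_char j a = of_int (Legendre (int (u j)) (int j))" if "j \<in> S" for j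
    proof -
      have "[int a = int (u j)] (mod int j)" using a that by (simp add: cong_int_iff)
      then show ?thesis using not48[OF that] by (simp add: sign_char_def Legendre_cong)
    qed
    have one: "Legendre 1 (int j) = 1" if "j \<in> S" for j
      using Legendre_square[of "int j" 1 1] S(2)[OF that] not_prime_unit[of j] by auto
    have "a mod 8 = (if i = 4 then 7 else if i = 8 then 5 else 1)"
      using a not48[of i] by (auto simp: u_def unique_euclidean_semiring_class.cong_def split: if_splits)
    then have 48: "sign_char 4 a = (if i = 4 then -1 else 1)" "sign_char 8 a = (if i = 8 then -1 else 1)"
      by (auto simp: sign_char_def)
    show ?thesis
    proof (intro exI[of _ a] conjI ballI)
      show "sign_char i a = -1"
        using i 48 S_eq[of i] b by (auto simp: I_def u_def)
      fix j assume j: "j \<in> I - {i}"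
      then have "j \<in> S \<Longrightarrow> u j = 1" using not48[of j] by (auto simp: u_def)
      then show "sign_char j a = 1" using j 48 S_eq[of j] one[of j] by (auto simp: I_def)
    qed
  qed
  have "\<exists>q. prime q \<and> q > k \<and> (\<forall>i\<in>I. sign_char i q = \<sigma> i)"
  proof (rule prime_with_prescribed_signs[where \<psi> = sign_char])
    show "finite I" using S by (simp add: I_def)
    show "k > 0" by (rule k)
    show "sign_char i (m * n) = sign_char i m * sign_char i n" if "i \<in> I" for i m n
      using sign_char_mult I_prime[OF that] by blast
    show "sign_char i 1 = 1" if "i \<in> I" for i
      using that Legendre_square[of "int i" 1 1] S(2)[of i] not_prime_unit[of i]
      by (auto simp: I_def sign_char_def)
    show "sign_char i (n + k) = sign_char i n" if "i \<in> I" for i n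
      using per[OF that, of n] per[OF that, of "n + k"] by simp
    show "sign_char i n \<in> {-1, 0, 1}" if "i \<in> I" for i n
      using Legendre_values[of "int n" "int i"] by (auto simp: sign_char_def)
    show "sign_char i n \<noteq> 0" if "i \<in> I" "coprime n k" for i n using nonzero that by blast
    show "\<sigma> i \<in> {-1, 1}" if "i \<in> I" for i
      using that odd_mod_8_cases[OF c] s[of i] not48[of i] by (auto simp: \<sigma>_def I_def sign_char_def)
    show "(\<Sum>r<k. \<Prod>i\<in>T. sign_char i r) = 0" if T: "T \<subseteq> I" "T \<noteq> {}" for T
    proof -
      obtain i where i: "i \<in> T" using T by blast
      obtain a where a: "sign_char i a = -1" "\<And>j. j \<in> I - {i} \<Longrightarrow> sign_char j a = 1"
        using separate[of i] i T by blast
      have finT: "finite T" using T S finite_subset by (auto simp: I_def)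
      define f where "f r = (\<Prod>j\<in>T. sign_char j r)" for r
      have "f a = sign_char i a * (\<Prod>j\<in>T - {i}. sign_char j a)"
        unfolding f_def using finT i by (rule prod.remove)
      also have "(\<Prod>j\<in>T - {i}. sign_char j a) = 1" using a(2) T by (intro prod.neutral) blast
      finally have fa: "f a = -1" using a(1) by simp
      have f_step: "f (a * r mod k) = - f r" for r
      proof -
        have "f (a * r mod k) = (\<Prod>j\<in>T. sign_char j a * sign_char j r)"
          unfolding f_def using T I_prime by (intro prod.cong) (auto simp: per sign_char_mult)
        also have "\<dots> = f a * f r" by (simp add: f_def prod.distrib)
        finally show ?thesis using fa by simp
      qed
      have "coprime a k"
      proof (rule ccontr)
        assume "\<not> coprime a k"
        then obtain p where p: "prime p" "p dvd a" "p dvd k"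
          by (metis coprime_iff_gcd_eq_1 gcd_greatest_iff prime_factor_nat)
        have nz: "sign_char j a \<noteq> 0" if "j \<in> I" for j using a that by (cases "j = i") auto
        have "p = 2 \<or> p \<in> S"
        proof -
          have "p dvd 2 ^ 3 * \<Prod>S" using p by (simp add: k_def)
          then have "p dvd 2 \<or> p dvd \<Prod>S" using p(1) prime_dvd_mult_iff prime_dvd_power by blast
          then show ?thesis
          proof
            assume "p dvd \<Prod>S"
            then obtain x where "x \<in> S" "p dvd x" using p(1) S(1) by (auto simp: prime_dvd_prod_iff)
            then show ?thesis using S(2) p(1) primes_dvd_imp_eq by blast
          next
            assume "p dvd 2"
            then show ?thesis using p(1) primes_dvd_imp_eq two_is_prime_nat by blast
          qed
        qed
        then show False
        proof
          assume "p = 2"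
          then have "even (a mod 8)" using p by (simp add: dvd_mod_iff)
          then have "sign_char 4 a = 0" by (auto simp: sign_char_def)
          then show False using nz[of 4] by (simp add: I_def)
        next
          assume pS: "p \<in> S"
          then have "sign_char p a = 0" using p not48[OF pS] by (simp add: sign_char_def Legendre_eq_0_iff)
          then show False using nz[of p] pS by (simp add: I_def)
        qed
      qed
      have "inj_on (\<lambda>r. a * r mod k) {..<k}"
      proof (rule inj_onI)
        fix r r' assume r: "r \<in> {..<k}" "r' \<in> {..<k}" "a * r mod k = a * r' mod k"
        then have "[a * r = a * r'] (mod k)" by (simp add: unique_euclidean_semiring_class.cong_def)
        then have "[r = r'] (mod k)" using \<open>coprime a k\<close> by (simp add: cong_mult_lcancel_nat)
        then show "r = r'" using r by (simp add: cong_less_modulus_unique_nat)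
      qed
      moreover have "(\<lambda>r. a * r mod k) ` {..<k} \<subseteq> {..<k}" using k by auto
      ultimately have "bij_betw (\<lambda>r. a * r mod k) {..<k} {..<k}"
        by (simp add: bij_betw_def endo_inj_surj)
      from sum.reindex_bij_betw[OF this, of f] have "(\<Sum>r<k. f r) = - (\<Sum>r<k. f r)"
        by (simp add: f_step sum_negf)
      then show ?thesis by (simp add: f_def)
    qed
  qed
  then obtain q where q: "prime q" "q > k" "\<And>i. i \<in> I \<Longrightarrow> sign_char i q = \<sigma> i" by blast
  have "sign_char 4 q = sign_char 4 c" "sign_char 8 q = sign_char 8 c"
    using q(3)[of 4] q(3)[of 8] by (auto simp: I_def \<sigma>_def)
  then have "[q = c] (mod 8)" using mod_8_cases[of q] odd_mod_8_cases[OF c]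
    by (auto simp: sign_char_def unique_euclidean_semiring_class.cong_def)
  moreover have "p < q" if "p \<in> S" for p
    using dvd_imp_le[OF dvd_k[OF that]] k q(2) by linarith
  moreover have "Legendre (int q) (int p) = s p" if "p \<in> S" for p
  proof -
    have "of_int (Legendre (int q) (int p)) = (of_int (s p) :: real)"
      using q(3)[of p] not48[OF that] that by (simp add: I_def \<sigma>_def sign_char_def)
    then show ?thesis by simp
  qed
  ultimately show ?thesis using that q(1) by blast
qed

section \<open>Norms of the form 1 + p N\<close>

lemma prime_times_nonmultiple_not_square:
  fixes x m :: int
  assumes "prime p" "\<not> int p dvd m"
  shows "x ^ 2 \<noteq> int p * m"
proof
  assume eq: "x ^ 2 = int p * m"
  have "prime (int p)" using assms by simp
  then have "int p dvd x" using eq prime_dvd_power by (metis dvd_triv_left)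
  then obtain y where "x = int p * y" by (elim dvdE)
  then have "int p * (int p * y ^ 2) = int p * m" using eq by (simp add: power2_eq_square mult_ac)
  then have "m = int p * y ^ 2" using assms(1) prime_gt_0_nat by simp
  then show False using assms(2) by simp
qed

lemma Legendre_agree:
  assumes q: "prime q" "q > (2::nat)" and e: "prime e" "e > (2::nat)"
    and "m > (0::nat)" "\<And>l. prime l \<Longrightarrow> l dvd m \<Longrightarrow> Legendre (int l) (int q) = Legendre (int l) (int e)"
  shows "Legendre (int m) (int q) = Legendre (int m) (int e)"
  using assms(5,6)
proof (induction m rule: less_induct)
  case (less m)
  show ?case
  proof (cases "m = 1")
    case True
    have "Legendre 1 (int r) = 1" if "prime r" for r
      using Legendre_square[of "int r" 1 1] that by (cases "r = 1") auto
    then show ?thesis using True q e by simp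
  next
    case False
    then obtain l where l: "prime l" "l dvd m" using prime_factor_nat by blast
    then obtain n where n: "m = l * n" by (elim dvdE)
    have "0 < n" "n < m" using n less.prems(1) prime_gt_1_nat[OF l(1)] by auto
    then have "Legendre (int n) (int q) = Legendre (int n) (int e)"
      using less.IH less.prems(2) n by auto
    then show ?thesis using less.prems(2)[OF l] by (simp add: n Legendre_mult q e)
  qed
qed

lemma Legendre_square_part:
  assumes p: "prime p" "p > (2::nat)" and "[a * s ^ 2 = 1] (mod int p)"
  shows "Legendre a (int p) = 1"
proof -
  have "Legendre 1 (int p) = 1"
    using Legendre_square[of "int p" 1 1] not_prime_unit[of p] p by auto
  then have "Legendre (a * (s * s)) (int p) = 1"
    using Legendre_cong[OF assms(3)] by (simp add: power2_eq_square)
  then have "Legendre a (int p) * (Legendre s (int p) * Legendre s (int p)) = 1"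
    by (simp only: Legendre_mult[OF p])
  then show ?thesis using Legendre_values[of a "int p"] Legendre_values[of s "int p"] by auto
qed

lemma reciprocity_1_mod_4:
  assumes "prime p" "p > (2::nat)" "prime q" "q > (2::nat)" "p \<noteq> q" "[q = 1] (mod 4)"
  shows "Legendre (int p) (int q) = Legendre (int q) (int p)"
proof -
  have "q mod 4 = 1" using assms(6) by (simp add: unique_euclidean_semiring_class.cong_def)
  then have "even ((q - 1) div 2)" by presburger
  then have "Legendre (int p) (int q) * Legendre (int q) (int p) = 1"
    using Quadratic_Reciprocity[OF assms(1-5)] by simp
  then show ?thesis using Legendre_values[of "int p" "int q"] Legendre_values[of "int q" "int p"] by auto
qed

lemma reciprocity_minus_3_mod_4:
  assumes l: "prime l" "l > (2::nat)" and e: "prime e" "e > (2::nat)" and "l \<noteq> e" "[e = 3] (mod 4)"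
  shows "Legendre (- int e) (int l) = Legendre (int l) (int e)"
proof -
  have "e mod 4 = 3" using assms(6) by (simp add: unique_euclidean_semiring_class.cong_def)
  then have "odd ((e - 1) div 2)" by presburger
  then have "Legendre (int l) (int e) * Legendre (int e) (int l) = (-1) ^ ((l - 1) div 2)"
    using Quadratic_Reciprocity[OF l e assms(5)] by (cases "even ((l - 1) div 2)") simp_all
  moreover have "Legendre (- int e) (int l) = Legendre (-1) (int l) * Legendre (int e) (int l)"
    using Legendre_mult[OF l, of "-1" "int e"] by simp
  moreover have "Legendre (-1) (int l) = (-1) ^ ((l - 1) div 2)" by (rule Legendre_minus_1[OF l])
  ultimately show ?thesis
    using Legendre_values[of "int l" "int e"] Legendre_values[of "int e" "int l"]
    by (cases "even ((l - 1) div 2)") auto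
qed

text \<open>Let \<open>M\<^sub>0\<close> be the squarefree part of \<open>M = 1 + p n\<^sup>2\<close>. If \<open>q\<close> is a prime such that both
  \<open>x\<^sup>2 + e y\<^sup>2 = q z\<^sup>2\<close> and \<open>M\<^sub>0 X\<^sup>2 + p e Y\<^sup>2 = q Z\<^sup>2\<close> are solvable, then the second left-hand side is, up to
  a square, the norm \<open>x\<^sup>2 + e y\<^sup>2\<close>, and rescaling it to \<open>X\<^sup>2 = (M / M\<^sub>0)\<close> gives the claim. Legendre's theorem
  reduces both equations to conditions on the symbols of \<open>q\<close>: value 1 at \<open>e\<close> and at odd \<open>p\<close>, and at a prime
  \<open>l\<close> dividing \<open>M\<^sub>0\<close> the value of \<open>-e\<close>, since \<open>-p\<close> is a square modulo \<open>l\<close>. The remaining condition that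
  \<open>M\<^sub>0\<close> is a square modulo \<open>q\<close> follows by reciprocity from \<open>M \<equiv> 1\<close> modulo \<open>e\<close>.
  Choosing \<open>q \<equiv> 1\<close> modulo 8 makes 2 a square modulo \<open>q\<close> and the symbols of \<open>q\<close> with other primes
  symmetric.\<close>

theorem norm_representation:
  fixes p e n :: nat
  assumes p: "prime p" and e: "prime e" "[e = 3] (mod 4)" "e \<noteq> p" and n: "4 * e dvd n"
  shows "\<exists>t u v :: rat. 1 + of_nat p * (of_nat n ^ 2 + of_nat e * t ^ 2) = u ^ 2 + of_nat e * v ^ 2"
proof -
  have e_mod: "e mod 4 = 3" using e(2) by (simp add: unique_euclidean_semiring_class.cong_def)
  have e2: "e > 2"
  proof -
    have "e \<noteq> 2" using e_mod by auto
    then show ?thesis using prime_gt_1_nat[OF e(1)] by linarith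
  qed
  define M where "M = 1 + p * n ^ 2"
  define M0 where "M0 = squarefree_part M"
  define s where "s = square_part M"
  have M: "M = M0 * s ^ 2" unfolding M0_def s_def by (rule squarefree_decompose)
  have sqf: "squarefree M0" by (simp add: M0_def squarefree_squarefree_part)
  have M_pos: "M > 0" by (simp add: M_def)
  have M0_pos: "M0 > 0" and s_pos: "s > 0" using M M_pos by (metis gr0I mult_is_0 zero_power2)+
  obtain n' where n': "n = 4 * e * n'" using n by (elim dvdE)
  have not_dvd_M: "\<not> l dvd M0" if "prime l" "l dvd p * n" for l
  proof
    assume "l dvd M0"
    then have "l dvd M" using M by simp
    moreover have "l dvd p * n ^ 2" using that(2) by (simp add: power2_eq_square dvd_mult2 mult.assoc[symmetric])
    ultimately have "l dvd 1" unfolding M_def by (simp only: dvd_add_left_iff)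
    then show False using that(1) not_prime_unit by blast
  qed
  have p_M0: "\<not> p dvd M0" and e_M0: "\<not> e dvd M0" and two_M0: "\<not> 2 dvd M0"
    using not_dvd_M[OF p] not_dvd_M[OF e(1)] not_dvd_M[OF two_is_prime_nat] n' by auto
  define S where "S = {e} \<union> (if p = 2 then {} else {p}) \<union> {l. prime l \<and> l dvd M0}"
  define sg where "sg l = (if l dvd M0 then Legendre (- int e) (int l) else 1)" for l
  have S_prime: "prime l \<and> l > 2" if "l \<in> S" for l
  proof -
    have "l > 2" if "prime l" "l \<noteq> 2" for l :: nat using that prime_gt_1_nat[of l] by linarith
    moreover have "l \<noteq> 2" if "l dvd M0" for l using that two_M0 by auto
    ultimately show ?thesis using that e e2 p by (auto simp: S_def split: if_splits)
  qed
  have "finite {l. l dvd M0}" using M0_pos by simp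
  then have "finite {l. prime l \<and> l dvd M0}" by (rule rev_finite_subset) auto
  then have fin: "finite S" by (simp add: S_def)
  have sg: "sg l \<in> {-1, 1}" if "l \<in> S" for l
  proof (cases "l dvd M0")
    case True
    have "\<not> int l dvd - int e"
    proof
      assume "int l dvd - int e"
      then have "l dvd e" by simp
      then have "l = e" using e(1) S_prime[OF that] primes_dvd_imp_eq by blast
      then show False using True e_M0 by simp
    qed
    then show ?thesis using Legendre_values[of "- int e" "int l"] True
      by (auto simp: sg_def Legendre_eq_0_iff)
  qed (simp add: sg_def)
  obtain q where q: "prime q" "\<And>l. l \<in> S \<Longrightarrow> l < q" "[q = 1] (mod 8)"
      "\<And>l. l \<in> S \<Longrightarrow> Legendre (int q) (int l) = sg l"
    using prime_with_prescribed_residues[of S sg 1] fin S_prime sg by auto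
  have q4: "[q = 1] (mod 4)" using q(3) by (rule cong_dvd_modulus_nat) simp
  have qe: "q > e" using q(2) by (simp add: S_def)
  then have q2: "q > 2" using e2 by simp
  have qp: "q \<noteq> p" using q(2)[of p] q2 by (cases "p = 2") (auto simp: S_def)
  have q_M0: "\<not> q dvd M0"
  proof
    assume "q dvd M0"
    then have "q \<in> S" using q(1) by (simp add: S_def)
    then show False using q(2) by blast
  qed
  have L_q_e: "Legendre (int q) (int e) = 1" using q(4)[of e] e_M0 by (simp add: S_def sg_def)
  have L_e_q: "Legendre (- int e) (int q) = 1"
    using reciprocity_minus_3_mod_4[OF q(1) q2 e(1) e2 _ e(2)] qe L_q_e by simp
  have L_p_q: "Legendre (int p) (int q) = 1"
  proof (cases "p = 2")
    case True
    then show ?thesis using Legendre_2_mod_8[OF q(1) q(3)] by simp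
  next
    case False
    then have "p > 2" using prime_gt_1_nat[OF p] by simp
    moreover have "Legendre (int q) (int p) = 1" using q(4)[of p] p_M0 False by (simp add: S_def sg_def)
    ultimately show ?thesis using reciprocity_1_mod_4[OF p _ q(1) q2 _ q4] qp by simp
  qed
  have L_M0_e: "Legendre (int M0) (int e) = 1"
  proof (rule Legendre_square_part[OF e(1) e2])
    have "int e dvd int M - 1" by (simp add: M_def n' power2_eq_square)
    then show "[int M0 * int s ^ 2 = 1] (mod int e)"
      by (simp add: M cong_iff_dvd_diff)
  qed
  have L_M0_q: "Legendre (int M0) (int q) = 1"
  proof -
    have "Legendre (int M0) (int q) = Legendre (int M0) (int e)"
    proof (rule Legendre_agree[OF q(1) q2 e(1) e2 M0_pos])
      fix l assume l: "prime l" "l dvd M0"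
      then have lS: "l \<in> S" by (simp add: S_def)
      have "l \<noteq> e" using l e_M0 by auto
      moreover have "l \<noteq> q" using l q_M0 by auto
      ultimately show "Legendre (int l) (int q) = Legendre (int l) (int e)"
        using reciprocity_1_mod_4[OF l(1) _ q(1) q2 _ q4] reciprocity_minus_3_mod_4[OF l(1) _ e(1) e2 _ e(2)]
          S_prime[OF lS] q(4)[OF lS] l(2) by (simp add: sg_def)
    qed
    then show ?thesis using L_M0_e by simp
  qed
  have copr: "coprime (int M0) (int p * int e)" "coprime (int p * int e) (int q)" "coprime (int M0) (int q)"
    "coprime (int e) (int q)"
  proof -
    have "coprime p M0" "coprime e M0" "coprime q M0"
      using p_M0 e_M0 q_M0 p e(1) q(1) by (simp_all add: prime_imp_coprime)
    moreover have "coprime p q" "coprime e q" using p e(1) q(1) qp qe by (simp_all add: primes_coprime)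
    ultimately show "coprime (int M0) (int p * int e)" "coprime (int p * int e) (int q)" "coprime (int M0) (int q)"
      "coprime (int e) (int q)"
      by (simp_all add: coprime_commute)
  qed
  have q_ndvd: "\<not> int q dvd int p * int e" "\<not> int q dvd int M0" "\<not> int q dvd int e" "\<not> int e dvd 1" "\<not> int q dvd 1"
    using q_M0 qp qe q(1) p e(1) primes_dvd_imp_eq[of q p] primes_dvd_imp_eq[of q e] not_prime_unit[of e] not_prime_unit[of q]
    by (auto simp: prime_dvd_mult_iff)
  have p_ndvd: "\<not> int p dvd int M0 * int e"
    using p_M0 p e(1,3) primes_dvd_imp_eq[of p e] by (auto simp: prime_dvd_mult_iff)
  obtain x1 y1 z1 :: int where 1: "z1 \<noteq> 0" "1 * x1 ^ 2 + int e * y1 ^ 2 = int q * z1 ^ 2"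
  proof (rule legendre_conic[of 1 "int e" "int q"])
    show "QuadRes 1 (int e * int q)" by (simp add: QuadRes_def)
    show "QuadRes (int e) (1 * int q)" using L_q_e by (simp add: Legendre_eq_1_imp_QuadRes)
    show "QuadRes (int q) (- (1 * int e))" using L_e_q by (simp add: Legendre_eq_1_imp_QuadRes)
    show "x ^ 2 \<noteq> 1 * int e" "x ^ 2 \<noteq> int e * int q" "x ^ 2 \<noteq> 1 * int q" for x
      using prime_times_nonmultiple_not_square[OF e(1), of 1 x] prime_times_nonmultiple_not_square[OF q(1), of 1 x]
        prime_times_nonmultiple_not_square[OF q(1), of "int e" x] q_ndvd by (simp_all add: mult.commute)
  qed (use e2 q2 copr in auto)
  obtain x2 y2 z2 :: int where 2: "z2 \<noteq> 0" "int M0 * x2 ^ 2 + (int p * int e) * y2 ^ 2 = int q * z2 ^ 2"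
  proof (rule legendre_conic[of "int M0" "int p * int e" "int q"])
    show "x ^ 2 \<noteq> int M0 * (int p * int e)" "x ^ 2 \<noteq> (int p * int e) * int q" "x ^ 2 \<noteq> int M0 * int q" for x
      using prime_times_nonmultiple_not_square[OF p p_ndvd, of x]
        prime_times_nonmultiple_not_square[OF q(1), of "int p * int e" x]
        prime_times_nonmultiple_not_square[OF q(1), of "int M0" x] q_ndvd by (simp_all add: mult_ac)
    show "QuadRes (int M0) ((int p * int e) * int q)"
    proof (rule QuadRes_squarefree[OF sqf])
      fix l assume l: "prime l" "l dvd M0"
      then have lS: "l \<in> S" by (simp add: S_def)
      have l2: "l > 2" using S_prime[OF lS] by simp
      have "int l dvd (int p * int n) ^ 2 - - int p"
      proof -
        have "int l dvd int M" using l(2) M by (simp del: of_nat_mult)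
        then have "int l dvd int p * int M" by simp
        then show ?thesis by (simp add: M_def power2_eq_square algebra_simps)
      qed
      then have "[(int p * int n) ^ 2 = - int p] (mod int l)" by (simp add: cong_iff_dvd_diff)
      moreover have "\<not> int l dvd - int p" using l p p_M0 primes_dvd_imp_eq[of l p] by auto
      ultimately have "Legendre (- int p) (int l) = 1" by (intro Legendre_square)
      moreover have "Legendre (- int e) (int l) * Legendre (int q) (int l) = 1"
        using q(4)[OF lS] sg[OF lS] l(2) by (auto simp: sg_def)
      ultimately have "Legendre ((- int p) * ((- int e) * int q)) (int l) = 1"
        by (simp only: Legendre_mult[OF l(1) l2])
      then show "QuadRes (int l) ((int p * int e) * int q)"
        by (intro Legendre_eq_1_imp_QuadRes) (simp add: mult.assoc)
    qed
    have "QuadRes (int (p * e)) (int M0 * int q)"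
    proof (rule QuadRes_squarefree)
      show "squarefree (p * e)"
        using p e by (simp add: squarefree_mult_coprime primes_coprime squarefree_prime)
      fix l assume l: "prime l" "l dvd p * e"
      then consider "l = 2" "p = 2" | "l = p" "p > 2" | "l = e"
        using p e(1) prime_gt_1_nat[OF p] by (metis One_nat_def Suc_lessI numeral_2_eq_2 prime_dvd_mult_iff primes_dvd_imp_eq)
      then show "QuadRes (int l) (int M0 * int q)"
      proof cases
        case 1
        have "[int M0 * int q mod 2 = 0] (mod 2) \<or> [int M0 * int q mod 2 = 1] (mod 2)"
          by (cases "even (int M0 * int q)") (auto simp: unique_euclidean_semiring_class.cong_def even_iff_mod_2_eq_zero odd_iff_mod_2_eq_one)
        then have "[0 ^ 2 = int M0 * int q] (mod int l) \<or> [1 ^ 2 = int M0 * int q] (mod int l)"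
          using 1 by (auto simp: unique_euclidean_semiring_class.cong_def)
        then show ?thesis unfolding QuadRes_def by blast
      next
        case 2
        have "Legendre (int M0) (int p) = 1"
        proof (rule Legendre_square_part[OF p 2(2)])
          have "int p dvd int M - 1" by (simp add: M_def)
          then show "[int M0 * int s ^ 2 = 1] (mod int p)"
            by (simp add: M cong_iff_dvd_diff)
        qed
        moreover have "Legendre (int q) (int p) = 1" using q(4)[of p] p_M0 2 by (simp add: S_def sg_def)
        ultimately have "Legendre (int M0 * int q) (int p) = 1" using 2 by (simp add: Legendre_mult[OF p])
        then show ?thesis using 2 by (simp add: Legendre_eq_1_imp_QuadRes)
      next
        case 3
        have "Legendre (int M0 * int q) (int e) = 1" using L_M0_e L_q_e by (simp add: Legendre_mult[OF e(1) e2])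
        then show ?thesis using 3 by (simp add: Legendre_eq_1_imp_QuadRes)
      qed
    qed
    then show "QuadRes (int p * int e) (int M0 * int q)" by simp
    have "Legendre ((int M0 * int p) * (- int e)) (int q) = 1"
      using L_M0_q L_p_q L_e_q by (simp only: Legendre_mult[OF q(1) q2])
    then show "QuadRes (int q) (- (int M0 * (int p * int e)))"
      by (intro Legendre_eq_1_imp_QuadRes) (simp add: mult_ac)
  qed (use M0_pos p e2 q2 copr prime_gt_0_nat in auto)
  have "x2 \<noteq> 0"
  proof
    assume "x2 = 0"
    then have eq: "(int p * int e * y2) ^ 2 = int q * (int p * int e) * z2 ^ 2"
      using 2(2) by (simp add: power2_eq_square mult_ac)
    then have "z2 ^ 2 dvd (int p * int e * y2) ^ 2" by simp
    then have "z2 dvd int p * int e * y2" by (simp only: pow_divides_pow_iff zero_less_numeral)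
    then obtain w where "int p * int e * y2 = z2 * w" by (elim dvdE)
    then have "w ^ 2 * z2 ^ 2 = int q * (int p * int e) * z2 ^ 2" using eq by (simp add: power_mult_distrib mult.commute)
    then have "w ^ 2 = int q * (int p * int e)" using 2(1) by simp
    then show False using prime_times_nonmultiple_not_square[OF q(1) q_ndvd(1)] by blast
  qed
  define X Y Z x y z s' :: rat where defs: "X = of_int x2" "Y = of_int y2" "Z = of_int z2"
    "x = of_int x1" "y = of_int y1" "z = of_int z1" "s' = of_nat s"
  have nz: "X \<noteq> 0" "z \<noteq> 0" using \<open>x2 \<noteq> 0\<close> 1(1) by (auto simp: defs)
  have eq1: "x ^ 2 + of_nat e * y ^ 2 = of_nat q * z ^ 2"
    using arg_cong[OF 1(2), of "of_int :: int \<Rightarrow> rat"] by (simp add: defs)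
  have eq2: "of_nat M0 * X ^ 2 + of_nat p * of_nat e * Y ^ 2 = of_nat q * Z ^ 2"
    using arg_cong[OF 2(2), of "of_int :: int \<Rightarrow> rat"] by (simp add: defs)
  have eqM: "1 + of_nat p * of_nat n ^ 2 = of_nat M0 * s' ^ 2"
    using arg_cong[OF M, of "of_nat :: nat \<Rightarrow> rat"] by (simp add: defs M_def)
  have "1 + of_nat p * (of_nat n ^ 2 + of_nat e * (s' * Y / X) ^ 2) = of_nat M0 * s' ^ 2 + of_nat p * of_nat e * (s' * Y / X) ^ 2"
    by (simp add: eqM[symmetric] algebra_simps)
  also have "\<dots> = s' ^ 2 / X ^ 2 * (of_nat M0 * X ^ 2 + of_nat p * of_nat e * Y ^ 2)"
    using nz by (simp add: field_simps)
  also have "\<dots> = s' ^ 2 / X ^ 2 * (Z ^ 2 / z ^ 2 * (of_nat q * z ^ 2))"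
    using nz by (simp add: eq2)
  also have "\<dots> = (s' * Z * x / (X * z)) ^ 2 + of_nat e * (s' * Z * y / (X * z)) ^ 2"
    unfolding eq1[symmetric] using nz by (simp add: field_simps)
  finally show ?thesis by blast
qed

section \<open>A criterion for p-integrality\<close>

definition p_integral :: "nat \<Rightarrow> rat \<Rightarrow> bool" where
  "p_integral p x \<longleftrightarrow> (\<exists>a b. \<not> int p dvd b \<and> x = of_int a / of_int b)"

lemma p_integralI: "\<not> int p dvd b \<Longrightarrow> x = of_int a / of_int b \<Longrightarrow> p_integral p x"
  by (auto simp: p_integral_def)

lemma p_integral_of_int: "prime p \<Longrightarrow> p_integral p (of_int k)"
  by (rule p_integralI[of p 1 _ k]) (auto dest: not_prime_unit)

lemma p_integral_add:
  assumes p: "prime p" and "p_integral p x" "p_integral p y"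
  shows "p_integral p (x + y)"
proof -
  obtain a b c d where *: "\<not> int p dvd b" "x = of_int a / of_int b" "\<not> int p dvd d" "y = of_int c / of_int d"
    using assms by (auto simp: p_integral_def)
  then have "b \<noteq> 0" "d \<noteq> 0" by auto
  then have "x + y = of_int (a * d + c * b) / of_int (b * d)" using * by (simp add: field_simps)
  moreover have "\<not> int p dvd b * d" using * p by (simp add: prime_dvd_mult_iff)
  ultimately show ?thesis by (blast intro: p_integralI)
qed

lemma p_integral_quotient:
  assumes p: "prime p" and "p_integral p a" "p_integral p c"
  shows "1 + of_nat p * c \<noteq> 0" "p_integral p (a / (1 + of_nat p * c))"
proof -
  obtain u v where a: "\<not> int p dvd v" "a = of_int u / of_int v" using assms by (auto simp: p_integral_def)
  obtain r s where c: "\<not> int p dvd s" "c = of_int r / of_int s" using assms by (auto simp: p_integral_def)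
  have nz: "v \<noteq> 0" "s \<noteq> 0" using a c by auto
  have "\<not> int p dvd s + int p * r" using c by (simp add: dvd_add_left_iff)
  then have nz2: "s + int p * r \<noteq> 0" "\<not> int p dvd v * (s + int p * r)" using a p by (auto simp: prime_dvd_mult_iff)
  have eq: "1 + of_nat p * c = of_int (s + int p * r) / of_int s" using nz c by (simp add: field_simps)
  then show "1 + of_nat p * c \<noteq> 0" using nz nz2 by (simp del: of_int_add)
  have "a / (1 + of_nat p * c) = of_int (u * s) / of_int (v * (s + int p * r))"
    unfolding eq using a nz nz2 by (simp del: of_int_add)
  then show "p_integral p (a / (1 + of_nat p * c))" using nz2 by (blast intro: p_integralI)
qed

text \<open>A denominator \<open>b\<close> prime to \<open>p\<close> has an inverse modulo \<open>p\<close>; expanding the fraction by it makes the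
  denominator \<open>1 + p c\<close>. Unlike the condition on \<open>b\<close>, both \<open>a\<close> and \<open>c\<close> are then only required to be in
  some set between \<open>\<int>\<close> and the \<open>p\<close>-integral numbers.\<close>

lemma p_integral_iff_quotient:
  assumes p: "prime p" and D: "\<And>k. of_int k \<in> D" "\<And>x. x \<in> D \<Longrightarrow> p_integral p x"
  shows "p_integral p x \<longleftrightarrow> (\<exists>a\<in>D. \<exists>c\<in>D. x * (1 + of_nat p * c) = a)"
proof
  assume "p_integral p x"
  then obtain a b where x: "\<not> int p dvd b" "x = of_int a / of_int b" by (auto simp: p_integral_def)
  have "coprime b (int p)" using x(1) p prime_imp_coprime[of "int p" b] by (simp add: coprime_commute)
  then obtain b' where "[b * b' = 1] (mod int p)" using cong_solve_coprime_int by blast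
  then obtain c where c: "b * b' = 1 + int p * c"
    by (auto simp: cong_iff_dvd_diff elim!: dvdE) (metis add.commute diff_add_cancel)
  have "x * (1 + of_nat p * of_int c) = x * of_int (b * b')" by (simp add: c)
  also have "\<dots> = of_int (a * b')" using x by auto
  finally show "\<exists>a\<in>D. \<exists>c\<in>D. x * (1 + of_nat p * c) = a" using D(1) by blast
next
  assume "\<exists>a\<in>D. \<exists>c\<in>D. x * (1 + of_nat p * c) = a"
  then obtain a c where ac: "a \<in> D" "c \<in> D" "x * (1 + of_nat p * c) = a" by blast
  then have "1 + of_nat p * c \<noteq> 0" using p_integral_quotient(1)[OF p, of a c] D(2) by blast
  then have "x = a / (1 + of_nat p * c)" using ac(3) by (simp add: eq_divide_eq)
  then show "p_integral p x" using p_integral_quotient(2)[OF p] ac D(2) by simp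
qed

text \<open>With \<open>\<alpha> = (s + t \<surd>-e) / 2\<close> and \<open>\<beta> = (u + v \<surd>-e) / 2\<close> the equation says \<open>1 + p N(\<alpha>) = N(\<beta>)\<close> for the norm
  \<open>N\<close> of \<open>\<rat>(\<surd>-e)\<close>. The factor 4 clears the halves, which are natural because
  \<open>(1 + \<surd>-e) / 2\<close> is an algebraic integer for \<open>e \<equiv> 3\<close> modulo 4.\<close>

definition norm_gap_set :: "nat \<Rightarrow> nat \<Rightarrow> rat set" where
  "norm_gap_set p e = {s. \<exists>t u v. 4 + of_nat p * (s ^ 2 + of_nat e * t ^ 2) = u ^ 2 + of_nat e * v ^ 2}"

text \<open>The form is the norm form of the quadratic order of discriminant \<open>1 - 4k\<close>; for a prime \<open>p\<close> the
  condition says that \<open>p\<close> is inert there.\<close>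

definition anisotropic_mod :: "nat \<Rightarrow> int \<Rightarrow> bool" where
  "anisotropic_mod p k \<longleftrightarrow>
     (\<forall>x y::int. int p dvd x ^ 2 + x * y + k * y ^ 2 \<longrightarrow> int p dvd x \<and> int p dvd y)"

text \<open>If \<open>p\<close> divides \<open>d\<close>, then it divides the right-hand side, hence \<open>U\<close> and \<open>V\<close> by anisotropy; so \<open>p\<^sup>2\<close> divides
  the right-hand side, and \<open>p\<close> divides the form at \<open>(X, Y)\<close>, hence \<open>X\<close> and \<open>Y\<close>. Everything can be divided
  by \<open>p\<close>, until \<open>d\<close> is prime to \<open>p\<close>.\<close>

lemma norm_gap_descent:
  fixes X Y U V k :: int and d :: nat
  assumes p: "prime p" and an: "anisotropic_mod p k" and "d > 0"
    and "int d ^ 2 + int p * (X ^ 2 + X * Y + k * Y ^ 2) = U ^ 2 + U * V + k * V ^ 2"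
  shows "\<exists>d' X' Y'. \<not> p dvd d' \<and> X * int d' = X' * int d \<and> Y * int d' = Y' * int d"
  using assms(3,4)
proof (induction d arbitrary: X Y U V rule: less_induct)
  case (less d)
  show ?case
  proof (cases "p dvd d")
    case False
    then show ?thesis by blast
  next
    case True
    then obtain d1 where d1: "d = p * d1" by (elim dvdE)
    have p0: "int p \<noteq> 0" using p by auto
    have "U ^ 2 + U * V + k * V ^ 2 = int p * (int p * int d1 ^ 2 + (X ^ 2 + X * Y + k * Y ^ 2))"
      unfolding less.prems(2)[symmetric] d1 by (simp add: power2_eq_square algebra_simps)
    then have "int p dvd U ^ 2 + U * V + k * V ^ 2" by simp
    then obtain U1 V1 where UV: "U = int p * U1" "V = int p * V1"
      using an unfolding anisotropic_mod_def by (meson dvdE)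
    have "int p * (X ^ 2 + X * Y + k * Y ^ 2) = int p * (int p * (U1 ^ 2 + U1 * V1 + k * V1 ^ 2 - int d1 ^ 2))"
      using less.prems(2) unfolding d1 UV by (simp add: power2_eq_square algebra_simps)
    then have eq: "X ^ 2 + X * Y + k * Y ^ 2 = int p * (U1 ^ 2 + U1 * V1 + k * V1 ^ 2 - int d1 ^ 2)"
      using p0 by simp
    then have "int p dvd X ^ 2 + X * Y + k * Y ^ 2" by simp
    then obtain X1 Y1 where XY: "X = int p * X1" "Y = int p * Y1"
      using an unfolding anisotropic_mod_def by (meson dvdE)
    have "int p * (int p * (X1 ^ 2 + X1 * Y1 + k * Y1 ^ 2)) = int p * (U1 ^ 2 + U1 * V1 + k * V1 ^ 2 - int d1 ^ 2)"
      using eq unfolding XY by (simp add: power2_eq_square algebra_simps)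
    then have "int p * (X1 ^ 2 + X1 * Y1 + k * Y1 ^ 2) = U1 ^ 2 + U1 * V1 + k * V1 ^ 2 - int d1 ^ 2"
      using p0 by simp
    then have "int d1 ^ 2 + int p * (X1 ^ 2 + X1 * Y1 + k * Y1 ^ 2) = U1 ^ 2 + U1 * V1 + k * V1 ^ 2" by simp
    moreover have "d1 < d" "d1 > 0" using d1 less.prems(1) prime_gt_1_nat[OF p] by auto
    ultimately obtain d' X' Y' where "\<not> p dvd d'" "X1 * int d' = X' * int d1" "Y1 * int d' = Y' * int d1"
      using less.IH[of d1] by blast
    then show ?thesis unfolding XY d1 by (intro exI[of _ d'] exI[of _ X'] exI[of _ Y']) simp
  qed
qed

lemma common_denominator:
  fixes f :: "'i \<Rightarrow> rat"
  assumes "finite I"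
  shows "\<exists>d>0. \<forall>i\<in>I. \<exists>a. f i = of_int a / of_nat d"
  using assms
proof (induction I rule: finite_induct)
  case empty
  then show ?case by (intro exI[of _ 1]) auto
next
  case (insert i I)
  then obtain d where d: "d > 0" "\<forall>j\<in>I. \<exists>a. f j = of_int a / of_nat d" by blast
  obtain a b where ab: "f i = of_int a / of_int b" "b > 0"
    by (metis Fract_of_int_quotient Rat_cases)
  show ?case
  proof (intro exI[of _ "d * nat b"] conjI ballI)
    show "d * nat b > 0" using d ab by simp
    fix j assume "j \<in> insert i I"
    then show "\<exists>a. f j = of_int a / of_nat (d * nat b)"
    proof
      assume "j = i"
      then have "f j = of_int (a * int d) / of_nat (d * nat b)" using ab d by simp
      then show ?thesis by blast
    next
      assume "j \<in> I"
      then obtain c where "f j = of_int c / of_nat d" using d by blast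
      then have "f j = of_int (c * b) / of_nat (d * nat b)" using ab d by simp
      then show ?thesis by blast
    qed
  qed
qed

lemma norm_gap_set_p_integral:
  assumes p: "prime p" and an: "anisotropic_mod p k" and e: "int e = 4 * k - 1" and s: "s \<in> norm_gap_set p e"
  shows "p_integral p s"
proof -
  obtain t u v where eq: "4 + of_nat p * (s ^ 2 + of_nat e * t ^ 2) = u ^ 2 + of_nat e * v ^ 2"
    using s by (auto simp: norm_gap_set_def)
  (* In the coordinates x = (s - t) / 2 and y = t, the form s ^ 2 + e * t ^ 2 is 4 times the
     form x ^ 2 + x * y + k * y ^ 2. *)
  define f :: "nat \<Rightarrow> rat" where "f i = (if i = 0 then (s - t) / 2 else if i = 1 then t else if i = 2 then (u - v) / 2 else v)" for i
  obtain d where d: "d > 0" "\<forall>i\<in>{0,1,2,3}. \<exists>a. f i = of_int a / of_nat d"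
    using common_denominator[of "{0,1,2,3}" f] by auto
  obtain X Y U V :: int where XYUV: "(s - t) / 2 = of_int X / of_nat d" "t = of_int Y / of_nat d"
    "(u - v) / 2 = of_int U / of_nat d" "v = of_int V / of_nat d"
    using d(2) by (auto simp: f_def)
  have e': "of_nat e = (4 * of_int k - 1 :: rat)"
    using arg_cong[OF e, of "of_int :: int \<Rightarrow> rat"] by simp
  define D where "D = (of_nat d :: rat)"
  have D: "D \<noteq> 0" using d by (simp add: D_def)
  have st: "s = (2 * of_int X + of_int Y) / D" "u = (2 * of_int U + of_int V) / D"
    "t = of_int Y / D" "v = of_int V / D"
    using XYUV D by (simp_all add: D_def field_simps)
  have sq: "((2 * a + b) / D) ^ 2 + (4 * of_int k - 1) * (b / D) ^ 2 = 4 * (a ^ 2 + a * b + of_int k * b ^ 2) / D ^ 2" for a b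
    using D by (simp add: field_simps power2_eq_square)
  have "4 + of_nat p * (4 * (of_int X ^ 2 + of_int X * of_int Y + of_int k * of_int Y ^ 2) / D ^ 2)
      = 4 * (of_int U ^ 2 + of_int U * of_int V + of_int k * of_int V ^ 2) / D ^ 2"
    using eq unfolding st e' sq .
  then have "D ^ 2 + of_nat p * (of_int X ^ 2 + of_int X * of_int Y + of_int k * of_int Y ^ 2)
      = of_int U ^ 2 + of_int U * of_int V + of_int k * of_int V ^ 2"
    using D by (simp add: field_simps)
  then have "of_int (int d ^ 2 + int p * (X ^ 2 + X * Y + k * Y ^ 2)) = (of_int (U ^ 2 + U * V + k * V ^ 2) :: rat)"
    by (simp add: D_def)
  then have "int d ^ 2 + int p * (X ^ 2 + X * Y + k * Y ^ 2) = U ^ 2 + U * V + k * V ^ 2"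
    by (simp only: of_int_eq_iff)
  from norm_gap_descent[OF p an d(1) this]
  obtain d' X' Y' where d': "\<not> p dvd d'" "X * int d' = X' * int d" "Y * int d' = Y' * int d" by blast
  have "d' \<noteq> 0" using d'(1) by (intro notI) simp
  moreover have "of_int X * of_nat d' = of_int X' * D" "of_int Y * of_nat d' = of_int Y' * D"
    using arg_cong[OF d'(2), of "of_int :: int \<Rightarrow> rat"] arg_cong[OF d'(3), of "of_int :: int \<Rightarrow> rat"]
    by (simp_all add: D_def)
  ultimately have "s = of_int (2 * X' + Y') / of_int (int d')"
    unfolding st using D by (simp add: field_simps)
  then show ?thesis using d'(1) by (intro p_integralI[of p "int d'" s "2 * X' + Y'"]) simp
qed

lemma norm_gap_set_multiples:
  assumes p: "prime p" and e: "prime e" "[e = 3] (mod 4)" "e \<noteq> p"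
  shows "of_int (8 * int e * m) \<in> norm_gap_set p e"
proof -
  define n where "n = 4 * e * nat \<bar>m\<bar>"
  obtain t u v :: rat where eq: "1 + of_nat p * (of_nat n ^ 2 + of_nat e * t ^ 2) = u ^ 2 + of_nat e * v ^ 2"
    using norm_representation[OF p e, of n] by (auto simp: n_def)
  have "(of_nat n :: rat) ^ 2 = (of_int (4 * int e * m)) ^ 2"
    by (simp add: n_def power_mult_distrib flip: of_int_power)
  then have "4 + of_nat p * ((of_int (8 * int e * m)) ^ 2 + of_nat e * (2 * t) ^ 2)
      = 4 * (1 + of_nat p * (of_nat n ^ 2 + of_nat e * t ^ 2))"
    by (simp add: power2_eq_square algebra_simps)
  also have "\<dots> = (2 * u) ^ 2 + of_nat e * (2 * v) ^ 2"
    unfolding eq by (simp add: power2_eq_square algebra_simps)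
  finally show ?thesis unfolding norm_gap_set_def by blast
qed

text \<open>For odd \<open>p\<close> it is enough that \<open>-e\<close> is a nonresidue, which is a condition on the residue symbol of the
  prime \<open>e\<close>; for \<open>p = 2\<close> the form \<open>x\<^sup>2 + x y + y\<^sup>2\<close> of \<open>e = 3\<close> is odd unless \<open>x\<close> and \<open>y\<close> are even.\<close>

lemma exists_anisotropic:
  assumes p: "prime p"
  obtains e k where "prime e" "[e = 3] (mod 4)" "e \<noteq> p" "int e = 4 * k - 1" "anisotropic_mod p k"
proof (cases "p = 2")
  case True
  have "anisotropic_mod 2 1"
    unfolding anisotropic_mod_def by auto
  then show ?thesis using that[of 3 1] True by (simp add: unique_euclidean_semiring_class.cong_def)
next
  case False
  then have p2: "p > 2" using prime_gt_1_nat[OF p] by simp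
  obtain e where e: "prime e" "p < e" "[e = 3] (mod 8)" "Legendre (int e) (int p) = - Legendre (-1) (int p)"
  proof (rule prime_with_prescribed_residues[of "{p}" "\<lambda>_. - Legendre (-1) (int p)" 3])
    have "\<not> int p dvd - 1" using p not_prime_unit by auto
    then show "- Legendre (-1) (int p) \<in> {-1, 1}"
      using Legendre_values[of "-1" "int p"] by (auto simp: Legendre_eq_0_iff)
  qed (use p p2 in auto)
  have e4: "[e = 3] (mod 4)" using e(3) by (rule cong_dvd_modulus_nat) simp
  define m where "m = e div 4"
  define k where "k = int m + 1"
  have "e mod 4 = 3" using e4 by (simp add: unique_euclidean_semiring_class.cong_def)
  then have "e = 4 * m + 3" using div_mult_mod_eq[of e 4] unfolding m_def by linarith
  then have k: "int e = 4 * k - 1" unfolding k_def by simp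
  have L: "Legendre (- int e) (int p) = -1"
  proof -
    have "Legendre (- int e) (int p) = Legendre (-1) (int p) * Legendre (int e) (int p)"
      using Legendre_mult[OF p p2, of "-1" "int e"] by simp
    moreover have "\<not> int p dvd - 1" using p not_prime_unit by auto
    ultimately show ?thesis using e(4) Legendre_values[of "-1" "int p"] by (auto simp: Legendre_eq_0_iff)
  qed
  have "anisotropic_mod p k"
    unfolding anisotropic_mod_def
  proof (intro allI impI)
    fix x y :: int assume dvd: "int p dvd x ^ 2 + x * y + k * y ^ 2"
    have "int p dvd y"
    proof (rule ccontr)
      assume y: "\<not> int p dvd y"
      have "(2 * x + y) ^ 2 - (- int e * y ^ 2) = 4 * (x ^ 2 + x * y + k * y ^ 2)"
        by (simp add: k power2_eq_square algebra_simps)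
      then have "int p dvd (2 * x + y) ^ 2 - (- int e * y ^ 2)" using dvd by (simp only: dvd_mult)
      then have c: "[(2 * x + y) ^ 2 = - int e * y ^ 2] (mod int p)" by (simp add: cong_iff_dvd_diff)
      have "\<not> int p dvd - int e" using L Legendre_eq_0_iff[of "- int e" "int p"] by auto
      then have "\<not> int p dvd - int e * y ^ 2" using y p by (auto simp: prime_dvd_mult_iff prime_dvd_power_iff)
      then have "Legendre (- int e * (y * y)) (int p) = 1" using Legendre_square[OF _ c] by (simp add: power2_eq_square)
      then have "Legendre y (int p) * Legendre y (int p) = -1"
        using L by (simp only: Legendre_mult[OF p p2]) 
      then show False using Legendre_values[of y "int p"] by auto
    qed
    then have "int p dvd x * y + k * y ^ 2" by (simp add: power2_eq_square)
    then have "int p dvd x ^ 2" using dvd by (metis add.assoc dvd_add_left_iff)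
    then have "int p dvd x" using p by (simp add: prime_dvd_power)
    then show "int p dvd x \<and> int p dvd y" using \<open>int p dvd y\<close> by blast
  qed
  then show ?thesis using that[of e k] e e4 k by simp
qed

text \<open>The norm gap set contains the multiples of \<open>8e\<close> and consists of \<open>p\<close>-integral numbers. Its translates by
  \<open>0, \<dots>, 8e - 1\<close> therefore cover \<open>\<int>\<close> and stay \<open>p\<close>-integral, as \<open>p_integral_iff_quotient\<close> requires.\<close>

theorem p_integral_criterion:
  assumes p: "prime p"
  obtains e h :: nat where
    "\<And>x. p_integral p x \<longleftrightarrow>
       (\<exists>a c. (\<exists>r<h. a - of_nat r \<in> norm_gap_set p e) \<and> (\<exists>r<h. c - of_nat r \<in> norm_gap_set p e) \<and>
          x * (1 + of_nat p * c) = a)"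
proof -
  obtain e k where e: "prime e" "[e = 3] (mod 4)" "e \<noteq> p" "int e = 4 * k - 1" "anisotropic_mod p k"
    using exists_anisotropic[OF p] by blast
  define h where "h = 8 * e"
  define D where "D = {a. \<exists>r<h. a - of_nat r \<in> norm_gap_set p e}"
  have h: "h > 0" using prime_gt_0_nat[OF e(1)] by (simp add: h_def)
  have 1: "of_int m \<in> D" for m
  proof -
    define r where "r = nat (m mod int h)"
    have "r < h" using h by (simp add: r_def nat_less_iff)
    moreover have "of_int m - of_nat r = (of_int (8 * int e * (m div int h)) :: rat)"
    proof -
      have "m - int r = 8 * int e * (m div int h)"
        using h mult_div_mod_eq[of "int h" m] by (simp add: r_def h_def algebra_simps)
      then have "of_int (m - int r) = (of_int (8 * int e * (m div int h)) :: rat)" by (simp only:)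
      then show ?thesis by simp
    qed
    ultimately show ?thesis unfolding D_def using norm_gap_set_multiples[OF p e(1-3)] by auto
  qed
  have 2: "p_integral p x" if x: "x \<in> D" for x
  proof -
    obtain r where "x - of_nat r \<in> norm_gap_set p e" using x unfolding D_def by blast
    then have "p_integral p (x - of_nat r)" by (rule norm_gap_set_p_integral[OF p e(5,4)])
    then have "p_integral p (x - of_nat r + of_int (int r))" using p p_integral_of_int by (blast intro: p_integral_add)
    then show ?thesis by simp
  qed
  have iff: "p_integral p x \<longleftrightarrow> (\<exists>a\<in>D. \<exists>c\<in>D. x * (1 + of_nat p * c) = a)" for x
    by (rule p_integral_iff_quotient[OF p 1 2])
  show ?thesis
  proof (rule that)
    show "p_integral p x \<longleftrightarrow>
       (\<exists>a c. (\<exists>r<h. a - of_nat r \<in> norm_gap_set p e) \<and> (\<exists>r<h. c - of_nat r \<in> norm_gap_set p e) \<and>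
          x * (1 + of_nat p * c) = a)" for x
      unfolding iff D_def by blast
  qed
qed

section \<open>Polynomial functions and integer polynomials\<close>

text \<open>Polynomial functions with integer coefficients in infinitely many variables. Representing them by
  ring terms makes closure under substitution an easy induction, and formulas contain such terms anyway.
  By \<open>polyfun_zpoly_eval\<close> and \<open>polyfun_imp_zpoly\<close> they are exactly the evaluations of integer polynomials.\<close>

definition polyfun :: "((nat \<Rightarrow> rat) \<Rightarrow> rat) \<Rightarrow> bool" where
  "polyfun F \<longleftrightarrow> (\<exists>t. \<forall>e. F e = term_val e t)"

lemma polyfun_term_val [intro]: "polyfun (\<lambda>e. term_val e t)"
  by (auto simp: polyfun_def)

lemma polyfun_var [intro]: "polyfun (\<lambda>e. e i)"
  unfolding polyfun_def by (rule exI[of _ "TVar i"]) simp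

lemma polyfun_add [intro]: "polyfun F \<Longrightarrow> polyfun G \<Longrightarrow> polyfun (\<lambda>e. F e + G e)"
  unfolding polyfun_def by (metis term_val.simps(5))

lemma polyfun_mult [intro]: "polyfun F \<Longrightarrow> polyfun G \<Longrightarrow> polyfun (\<lambda>e. F e * G e)"
  unfolding polyfun_def by (metis term_val.simps(6))

lemma polyfun_uminus [intro]: "polyfun F \<Longrightarrow> polyfun (\<lambda>e. - F e)"
  unfolding polyfun_def by (metis term_val.simps(4))

lemma polyfun_diff [intro]: "polyfun F \<Longrightarrow> polyfun G \<Longrightarrow> polyfun (\<lambda>e. F e - G e)"
  using polyfun_add[OF _ polyfun_uminus, of F G] by simp

lemma polyfun_0 [intro]: "polyfun (\<lambda>e. 0)"
  unfolding polyfun_def by (rule exI[of _ TZero]) simp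

lemma polyfun_1 [intro]: "polyfun (\<lambda>e. 1)"
  unfolding polyfun_def by (rule exI[of _ TOne]) simp

lemma polyfun_of_nat [intro]: "polyfun (\<lambda>e. of_nat n)"
  by (induction n) auto

lemma polyfun_of_int [intro]: "polyfun (\<lambda>e. of_int k)"
  by (cases k rule: int_cases2) auto

lemma polyfun_numeral [intro]: "polyfun (\<lambda>e. numeral n)"
  using polyfun_of_nat[of "numeral n"] by simp

lemma polyfun_power [intro]: "polyfun F \<Longrightarrow> polyfun (\<lambda>e. F e ^ n)"
  by (induction n) auto

lemma polyfun_sum: "(\<And>i. i \<in> I \<Longrightarrow> polyfun (F i)) \<Longrightarrow> polyfun (\<lambda>e. \<Sum>i\<in>I. F i e)"
  by (induction I rule: infinite_finite_induct) auto

lemma polyfun_prod: "(\<And>i. i \<in> I \<Longrightarrow> polyfun (F i)) \<Longrightarrow> polyfun (\<lambda>e. \<Prod>i\<in>I. F i e)"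
  by (induction I rule: infinite_finite_induct) auto

lemma polyfun_compose:
  assumes "polyfun F" "\<And>i. polyfun (G i)"
  shows "polyfun (\<lambda>e. F (\<lambda>i. G i e))"
proof -
  obtain t where "\<And>e. F e = term_val e t" using assms by (auto simp: polyfun_def)
  moreover have "polyfun (\<lambda>e. term_val (\<lambda>i. G i e) t)"
    by (induction t) (use assms(2) in auto)
  ultimately show ?thesis by simp
qed

lemma polyfun_finite_support:
  assumes "polyfun F"
  shows "\<exists>N. \<forall>e e'. (\<forall>i<N. e i = e' i) \<longrightarrow> F e = F e'"
proof -
  obtain t where t: "\<And>e. F e = term_val e t" using assms by (auto simp: polyfun_def)
  have "\<exists>N. \<forall>e e'. (\<forall>i<N. e i = e' i) \<longrightarrow> term_val e t = term_val e' t"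
  proof (induction t)
    case (TVar i)
    then show ?case by (intro exI[of _ "Suc i"]) auto
  next
    case (TAdd s t)
    then obtain M N where "\<forall>e e'. (\<forall>i<M. e i = e' i) \<longrightarrow> term_val e s = term_val e' s"
      "\<forall>e e'. (\<forall>i<N. e i = e' i) \<longrightarrow> term_val e t = term_val e' t" by blast
    then show ?case by (intro exI[of _ "max M N"]) (metis less_max_iff_disj term_val.simps(5))
  next
    case (TMul s t)
    then obtain M N where "\<forall>e e'. (\<forall>i<M. e i = e' i) \<longrightarrow> term_val e s = term_val e' s"
      "\<forall>e e'. (\<forall>i<N. e i = e' i) \<longrightarrow> term_val e t = term_val e' t" by blast
    then show ?case by (intro exI[of _ "max M N"]) (metis less_max_iff_disj term_val.simps(6))
  qed auto
  then show ?thesis by (simp add: t)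
qed

definition monomial_eval :: "(nat \<Rightarrow>\<^sub>0 nat) \<Rightarrow> (nat \<Rightarrow> rat) \<Rightarrow> rat" where
  "monomial_eval m x = (\<Prod>i\<in>Poly_Mapping.keys m. x i ^ Poly_Mapping.lookup m i)"

lemma monomial_eval_superset:
  assumes "finite A" "Poly_Mapping.keys m \<subseteq> A"
  shows "monomial_eval m x = (\<Prod>i\<in>A. x i ^ Poly_Mapping.lookup m i)"
  unfolding monomial_eval_def using assms
  by (intro prod.mono_neutral_left) (auto simp: in_keys_iff)

lemma monomial_eval_add: "monomial_eval (m + n) x = monomial_eval m x * monomial_eval n x"
proof -
  let ?A = "Poly_Mapping.keys m \<union> Poly_Mapping.keys n"
  have "Poly_Mapping.keys (m + n) \<subseteq> ?A" by (rule keys_add)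
  then show ?thesis
    by (simp add: monomial_eval_superset[of ?A] lookup_add power_add prod.distrib)
qed

lemma zpoly_eval_superset:
  assumes "finite A" "Poly_Mapping.keys f \<subseteq> A"
  shows "zpoly_eval f x = (\<Sum>m\<in>A. of_int (Poly_Mapping.lookup f m) * monomial_eval m x)"
  unfolding zpoly_eval_def monomial_eval_def[symmetric] using assms
  by (intro sum.mono_neutral_left) (auto simp: in_keys_iff)

lemma zpoly_eval_add: "zpoly_eval (f + g) x = zpoly_eval f x + zpoly_eval g x"
proof -
  let ?A = "Poly_Mapping.keys f \<union> Poly_Mapping.keys g"
  have "Poly_Mapping.keys (f + g) \<subseteq> ?A" by (rule keys_add)
  then show ?thesis
    by (simp add: zpoly_eval_superset[of ?A] lookup_add distrib_right sum.distrib)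
qed

lemma zpoly_eval_0: "zpoly_eval 0 x = 0"
  by (simp add: zpoly_eval_def)

lemma zpoly_eval_sum: "zpoly_eval (\<Sum>i\<in>I. f i) x = (\<Sum>i\<in>I. zpoly_eval (f i) x)"
  by (induction I rule: infinite_finite_induct) (auto simp: zpoly_eval_0 zpoly_eval_add)

lemma zpoly_eval_single: "zpoly_eval (Poly_Mapping.single m c) x = of_int c * monomial_eval m x"
  by (subst zpoly_eval_superset[of "{m}"]) auto

lemma sum_of_monomials: "(\<Sum>m\<in>Poly_Mapping.keys f. Poly_Mapping.single m (Poly_Mapping.lookup f m)) = (f :: zpoly)"
  by (rule poly_mapping_eqI) (simp add: lookup_sum lookup_single when_def in_keys_iff)

lemma zpoly_eval_mult: "zpoly_eval (f * g) x = zpoly_eval f x * zpoly_eval g x"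
proof -
  have "f * g = (\<Sum>m\<in>Poly_Mapping.keys f. Poly_Mapping.single m (Poly_Mapping.lookup f m)) *
      (\<Sum>n\<in>Poly_Mapping.keys g. Poly_Mapping.single n (Poly_Mapping.lookup g n))"
    by (simp only: sum_of_monomials)
  then have "zpoly_eval (f * g) x = (\<Sum>m\<in>Poly_Mapping.keys f. \<Sum>n\<in>Poly_Mapping.keys g.
      (of_int (Poly_Mapping.lookup f m) * monomial_eval m x) * (of_int (Poly_Mapping.lookup g n) * monomial_eval n x))"
    by (simp add: sum_product mult_single zpoly_eval_sum zpoly_eval_single monomial_eval_add mult_ac)
  then show ?thesis
    by (simp add: zpoly_eval_def monomial_eval_def[symmetric] sum_product)
qed

lemma polyfun_zpoly_eval: "polyfun (zpoly_eval f)"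
  unfolding zpoly_eval_def by (intro polyfun_sum polyfun_mult polyfun_of_int polyfun_prod polyfun_power polyfun_var)

lemma polyfun_imp_zpoly:
  assumes "polyfun F"
  shows "\<exists>f. \<forall>x. zpoly_eval f x = F x"
proof -
  obtain t where t: "\<And>e. F e = term_val e t" using assms by (auto simp: polyfun_def)
  have const: "zpoly_eval (Poly_Mapping.single 0 c) x = of_int c" for c x
    by (simp add: zpoly_eval_single monomial_eval_def)
  have "\<exists>f. \<forall>x. zpoly_eval f x = term_val x t"
  proof (induction t)
    case (TVar i)
    show ?case
      by (intro exI[of _ "Poly_Mapping.single (Poly_Mapping.single i 1) 1"])
        (simp add: zpoly_eval_single monomial_eval_def)
  next
    case TZero
    then show ?case using const[of 0] by (metis of_int_0 term_val.simps(2))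
  next
    case TOne
    then show ?case using const[of 1] by (metis of_int_1 term_val.simps(3))
  next
    case (TNeg t)
    then obtain f where "\<forall>x. zpoly_eval f x = term_val x t" by blast
    then have "zpoly_eval (Poly_Mapping.single 0 (-1) * f) x = term_val x (TNeg t)" for x
      by (simp only: zpoly_eval_mult const) simp
    then show ?case by blast
  next
    case (TAdd s t)
    then obtain f g where "\<forall>x. zpoly_eval f x = term_val x s" "\<forall>x. zpoly_eval g x = term_val x t" by blast
    then have "zpoly_eval (f + g) x = term_val x (TAdd s t)" for x by (simp add: zpoly_eval_add)
    then show ?case by blast
  next
    case (TMul s t)
    then obtain f g where "\<forall>x. zpoly_eval f x = term_val x s" "\<forall>x. zpoly_eval g x = term_val x t" by blast
    then have "zpoly_eval (f * g) x = term_val x (TMul s t)" for x by (simp add: zpoly_eval_mult)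
    then show ?case by blast
  qed
  then show ?thesis by (simp add: t)
qed

section \<open>Diophantine predicates over the rationals\<close>

text \<open>Parameters sit at the even and unknowns at the odd positions, so that there is room for arbitrarily
  many of both, and further unknowns can be added by interleaving once more.\<close>

definition interleave :: "(nat \<Rightarrow> rat) \<Rightarrow> (nat \<Rightarrow> rat) \<Rightarrow> nat \<Rightarrow> rat" where
  "interleave e y i = (if even i then e (i div 2) else y (i div 2))"

lemma interleave_simps [simp]: "interleave e y (2 * i) = e i" "interleave e y (Suc (2 * i)) = y i"
  by (simp_all add: interleave_def)

lemma interleave_0_1 [simp]: "interleave e y 0 = e 0" "interleave e y (Suc 0) = y 0"
  by (simp_all add: interleave_def)

definition diophantine :: "((nat \<Rightarrow> rat) \<Rightarrow> bool) \<Rightarrow> bool" where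
  "diophantine P \<longleftrightarrow> (\<exists>F. polyfun F \<and> (\<forall>e. P e \<longleftrightarrow> (\<exists>y. F (interleave e y) = 0)))"

lemma diophantineI: "polyfun F \<Longrightarrow> (\<And>e. P e \<longleftrightarrow> (\<exists>y. F (interleave e y) = 0)) \<Longrightarrow> diophantine P"
  by (auto simp: diophantine_def)

lemma diophantine_eq_0:
  assumes "polyfun F"
  shows "diophantine (\<lambda>e. F e = 0)"
proof (rule diophantineI)
  show "polyfun (\<lambda>w. F (\<lambda>i. w (2 * i)))" by (intro polyfun_compose[OF assms] polyfun_var)
qed simp

lemma diophantine_eq:
  assumes "polyfun F" "polyfun G"
  shows "diophantine (\<lambda>e. F e = G e)"
  using diophantine_eq_0[OF polyfun_diff[OF assms]] by simp

lemma diophantine_subst: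
  assumes "diophantine P" "\<And>i. polyfun (G i)"
  shows "diophantine (\<lambda>e. P (\<lambda>i. G i e))"
proof -
  obtain F where F: "polyfun F" "\<And>e. P e \<longleftrightarrow> (\<exists>y. F (interleave e y) = 0)"
    using assms by (auto simp: diophantine_def)
  define H where "H i w = (if even i then G (i div 2) (\<lambda>j. w (2 * j)) else w i)" for i and w :: "nat \<Rightarrow> rat"
  have "polyfun (H i)" for i
    unfolding H_def by (cases "even i") (simp_all add: polyfun_var polyfun_compose[OF assms(2) polyfun_var])
  then have "polyfun (\<lambda>w. F (\<lambda>i. H i w))" by (rule polyfun_compose[OF F(1)])
  moreover have "(\<lambda>i. H i (interleave e y)) = interleave (\<lambda>i. G i e) y" for e y
    by (auto simp: H_def interleave_def fun_eq_iff)
  ultimately show ?thesis using F(2) by (intro diophantineI) auto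
qed

lemma diophantine_conj:
  assumes "diophantine P" "diophantine Q"
  shows "diophantine (\<lambda>e. P e \<and> Q e)"
proof -
  obtain F where F: "polyfun F" "\<And>e. P e \<longleftrightarrow> (\<exists>y. F (interleave e y) = 0)"
    using assms by (auto simp: diophantine_def)
  obtain G where G: "polyfun G" "\<And>e. Q e \<longleftrightarrow> (\<exists>y. G (interleave e y) = 0)"
    using assms by (auto simp: diophantine_def)
  (* The unknowns of P are read from the even and those of Q from the odd positions of a common
     sequence of unknowns; a sum of two squares joins the equations. *)
  define r s where "r i = (if even i then i else 2 * (2 * (i div 2)) + 1)"
    and "s i = (if even i then i else 2 * (2 * (i div 2) + 1) + 1)" for i :: nat
  define H where "H w = F (\<lambda>i. w (r i)) ^ 2 + G (\<lambda>i. w (s i)) ^ 2" for w :: "nat \<Rightarrow> rat"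
  show ?thesis
  proof (rule diophantineI)
    show "polyfun H" unfolding H_def
      by (intro polyfun_add polyfun_power polyfun_compose[OF F(1)] polyfun_compose[OF G(1)] polyfun_var)
    have rs: "(\<lambda>i. interleave e w (r i)) = interleave e (\<lambda>i. w (2 * i))"
      "(\<lambda>i. interleave e w (s i)) = interleave e (\<lambda>i. w (2 * i + 1))" for e w
      by (auto simp: interleave_def r_def s_def fun_eq_iff)
    have H: "H (interleave e w) = 0 \<longleftrightarrow>
        F (interleave e (\<lambda>i. w (2 * i))) = 0 \<and> G (interleave e (\<lambda>i. w (2 * i + 1))) = 0" for e w
      unfolding H_def rs by (simp add: sum_power2_eq_zero_iff)
    show "P e \<and> Q e \<longleftrightarrow> (\<exists>w. H (interleave e w) = 0)" for e
    proof
      assume "P e \<and> Q e"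
      then obtain y z where "F (interleave e y) = 0" "G (interleave e z) = 0" using F G by blast
      then have "H (interleave e (interleave y z)) = 0" unfolding H by simp
      then show "\<exists>w. H (interleave e w) = 0" by blast
    qed (use H F G in blast)
  qed
qed

lemma diophantine_disj:
  assumes "diophantine P" "diophantine Q"
  shows "diophantine (\<lambda>e. P e \<or> Q e)"
proof -
  obtain F where F: "polyfun F" "\<And>e. P e \<longleftrightarrow> (\<exists>y. F (interleave e y) = 0)"
    using assms by (auto simp: diophantine_def)
  obtain G where G: "polyfun G" "\<And>e. Q e \<longleftrightarrow> (\<exists>y. G (interleave e y) = 0)"
    using assms by (auto simp: diophantine_def)
  show ?thesis
    by (rule diophantineI[OF polyfun_mult[OF F(1) G(1)]]) (use F G in auto)
qed

lemma diophantine_ex_sequence: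
  assumes "diophantine P"
  shows "diophantine (\<lambda>e. \<exists>x. P (interleave e x))"
proof -
  obtain F where F: "polyfun F" "\<And>e. P e \<longleftrightarrow> (\<exists>y. F (interleave e y) = 0)"
    using assms by (auto simp: diophantine_def)
  (* r i is the position, in the interleaving of e with both sequences of unknowns merged into
     one, of the entry that the nested interleaving has at position i. *)
  define r where "r i = (if odd i then 2 * i + 1 else if even (i div 2) then i div 2 else i - 1)" for i :: nat
  show ?thesis
  proof (rule diophantineI)
    show "polyfun (\<lambda>w. F (\<lambda>i. w (r i)))" by (intro polyfun_compose[OF F(1)] polyfun_var)
    have r: "(\<lambda>i. interleave e w (r i)) = interleave (interleave e (\<lambda>i. w (2 * i))) (\<lambda>i. w (2 * i + 1))" for e w
      by (auto simp: interleave_def r_def fun_eq_iff elim!: oddE evenE)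
    show "(\<exists>x. P (interleave e x)) \<longleftrightarrow> (\<exists>w. F (\<lambda>i. interleave e w (r i)) = 0)" for e
    proof
      assume "\<exists>x. P (interleave e x)"
      then obtain x y where "F (interleave (interleave e x) y) = 0" using F by blast
      then have "F (\<lambda>i. interleave e (interleave x y) (r i)) = 0" unfolding r by simp
      then show "\<exists>w. F (\<lambda>i. interleave e w (r i)) = 0" by blast
    qed (use r F in auto)
  qed
qed

lemma diophantine_ex:
  assumes "diophantine P"
  shows "diophantine (\<lambda>e. \<exists>a. P (e(i := a)))"
proof -
  define G where "G j w = (if j = i then w (Suc 0) else w (2 * j))" for j and w :: "nat \<Rightarrow> rat"
  have "polyfun (G j)" for j unfolding G_def by (cases "j = i") auto
  then have "diophantine (\<lambda>e. \<exists>x. P (\<lambda>j. G j (interleave e x)))"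
    using diophantine_ex_sequence[of "\<lambda>w. P (\<lambda>j. G j w)"] diophantine_subst[OF assms, of G] by blast
  moreover have "(\<lambda>j. G j (interleave e x)) = e(i := x 0)" for e x
    by (auto simp: G_def fun_eq_iff)
  moreover have "(\<exists>x::nat \<Rightarrow> rat. P (e(i := x 0))) \<longleftrightarrow> (\<exists>a. P (e(i := a)))" for e
    by (auto intro: exI[of _ "\<lambda>_. a" for a])
  ultimately show ?thesis by simp
qed

text \<open>In a field, a difference is nonzero iff it has an inverse.\<close>

lemma diophantine_neq:
  assumes "polyfun F" "polyfun G"
  shows "diophantine (\<lambda>e. F e \<noteq> G e)"
proof -
  have "diophantine (\<lambda>e. \<exists>x. (F (\<lambda>i. interleave e x (2 * i)) - G (\<lambda>i. interleave e x (2 * i))) * interleave e x 1 = 1)"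
    by (rule diophantine_ex_sequence, rule diophantine_eq)
       (intro polyfun_mult polyfun_diff polyfun_compose[OF assms(1)] polyfun_compose[OF assms(2)] polyfun_var polyfun_1)+
  moreover have "(\<exists>x. (F (\<lambda>i. interleave e x (2 * i)) - G (\<lambda>i. interleave e x (2 * i))) * interleave e x 1 = 1) \<longleftrightarrow> F e \<noteq> G e" for e
  proof
    assume "F e \<noteq> G e"
    then show "\<exists>x. (F (\<lambda>i. interleave e x (2 * i)) - G (\<lambda>i. interleave e x (2 * i))) * interleave e x 1 = 1"
      by (intro exI[of _ "\<lambda>_. 1 / (F e - G e)"]) simp
  qed auto
  ultimately show ?thesis by simp
qed

lemma diophantine_const: "diophantine (\<lambda>e. c)"
  using diophantine_eq[OF polyfun_0 polyfun_0] diophantine_eq[OF polyfun_0 polyfun_1]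
  by (cases c) simp_all

lemma diophantine_bex_less:
  "(\<And>r. r < (h::nat) \<Longrightarrow> diophantine (P r)) \<Longrightarrow> diophantine (\<lambda>e. \<exists>r<h. P r e)"
proof (induction h)
  case (Suc h)
  then have "diophantine (\<lambda>e. (\<exists>r<h. P r e) \<or> P h e)" by (intro diophantine_disj) simp_all
  then show ?case by (simp add: less_Suc_eq ex_disj_distrib conj_disj_distribR)
qed (simp add: diophantine_const)

lemma diophantine_ball:
  "finite I \<Longrightarrow> (\<And>r. r \<in> I \<Longrightarrow> diophantine (P r)) \<Longrightarrow> diophantine (\<lambda>e. \<forall>r\<in>I. P r e)"
proof (induction I rule: finite_induct)
  case (insert r I)
  then have "diophantine (\<lambda>e. P r e \<and> (\<forall>r\<in>I. P r e))" by (intro diophantine_conj) simp_all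
  then show ?case by simp
qed (simp add: diophantine_const)

definition diophantine_set :: "rat set \<Rightarrow> bool" where
  "diophantine_set D \<longleftrightarrow> diophantine (\<lambda>e. e 0 \<in> D)"

lemma diophantine_mem:
  assumes "diophantine_set D" "polyfun F"
  shows "diophantine (\<lambda>e. F e \<in> D)"
  using diophantine_subst[of "\<lambda>e. e 0 \<in> D" "\<lambda>_. F"] assms by (simp add: diophantine_set_def)

lemma ints_existentially_definable_if_diophantine:
  assumes "diophantine_set \<int>"
  shows "ints_existentially_definable UNIV"
proof -
  obtain F where F: "polyfun F" "\<And>e. e 0 \<in> \<int> \<longleftrightarrow> (\<exists>y. F (interleave e y) = 0)"
    using assms unfolding diophantine_set_def diophantine_def by blast
  have "polyfun (\<lambda>x. F (\<lambda>i. if even i then x 0 else x (Suc (i div 2))))"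
  proof (rule polyfun_compose[OF F(1)])
    show "polyfun (\<lambda>x. if even i then x 0 else x (Suc (i div 2)))" for i
      by (cases "even i") (simp_all add: polyfun_var)
  qed
  then obtain g where g: "\<And>x. zpoly_eval g x = F (\<lambda>i. if even i then x 0 else x (Suc (i div 2)))"
    using polyfun_imp_zpoly by blast
  have "zpoly_eval g (case_nat q y) = F (interleave (\<lambda>_. q) y)" for q y
    unfolding g by (rule arg_cong[of _ _ F]) (auto simp: interleave_def fun_eq_iff)
  then have "q \<in> \<int> \<longleftrightarrow> (\<exists>y. zpoly_eval g (case_nat q y) = 0)" for q
    using F(2)[of "\<lambda>_. q"] by simp
  then have "existentially_defines_ints g UNIV"
    unfolding existentially_defines_ints_def by simp
  then show ?thesis unfolding ints_existentially_definable_def by blast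
qed

lemma diophantine_set_norm_gap: "diophantine_set (norm_gap_set p e)"
proof -
  define c d where "c = (of_nat p :: rat)" and "d = (of_nat e :: rat)"
  define P where "P = (\<lambda>w::nat \<Rightarrow> rat. 4 + c * (w 0 ^ 2 + d * w 1 ^ 2) = w 2 ^ 2 + d * w 3 ^ 2)"
  have "diophantine P" unfolding P_def c_def d_def
    by (intro diophantine_eq polyfun_add polyfun_mult polyfun_power polyfun_var[of "_::nat"] polyfun_of_nat polyfun_numeral)
  from diophantine_ex[OF diophantine_ex[OF diophantine_ex[OF this, of 3], of 2], of 1]
  show ?thesis by (simp add: diophantine_set_def norm_gap_set_def P_def c_def d_def)
qed

lemma diophantine_set_p_integral:
  assumes "prime p"
  shows "diophantine_set {x. p_integral p x}"
proof -
  obtain e h :: nat where crit: "\<And>x. p_integral p x \<longleftrightarrow>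
       (\<exists>a c. (\<exists>r<h. a - of_nat r \<in> norm_gap_set p e) \<and> (\<exists>r<h. c - of_nat r \<in> norm_gap_set p e) \<and>
          x * (1 + of_nat p * c) = a)"
    by (rule p_integral_criterion[OF assms], rule that)
  define D where "D = {a :: rat. \<exists>r<h. a - of_nat r \<in> norm_gap_set p e}"
  have "diophantine (\<lambda>w. \<exists>r<h. w 0 - of_nat r \<in> norm_gap_set p e)"
    by (intro diophantine_bex_less diophantine_mem[OF diophantine_set_norm_gap] polyfun_diff polyfun_var polyfun_of_nat)
  then have D: "diophantine_set D" by (simp add: diophantine_set_def D_def)
  define P where "P = (\<lambda>w::nat \<Rightarrow> rat. w 1 \<in> D \<and> w 2 \<in> D \<and> w 0 * (1 + of_nat p * w 2) = w 1)"
  have "diophantine P" unfolding P_def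
    by (intro diophantine_conj diophantine_mem[OF D] diophantine_eq polyfun_add polyfun_mult polyfun_var polyfun_of_nat polyfun_1)
  from diophantine_ex[OF diophantine_ex[OF this, of 2], of 1]
  have "diophantine (\<lambda>w. \<exists>a c. a \<in> D \<and> c \<in> D \<and> w 0 * (1 + of_nat p * c) = a)"
    by (simp add: P_def)
  moreover have "p_integral p x \<longleftrightarrow> (\<exists>a c. a \<in> D \<and> c \<in> D \<and> x * (1 + of_nat p * c) = a)" for x
    unfolding crit D_def by blast
  ultimately show ?thesis unfolding diophantine_set_def by simp
qed

section \<open>Subrings of the rationals\<close>

lemma p_integral_reduced:
  assumes "prime p" "p_integral p (of_int a / of_int b)" "coprime a b" "b \<noteq> 0"
  shows "\<not> int p dvd b"
proof
  assume pb: "int p dvd b"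
  obtain c d where cd: "\<not> int p dvd d" "of_int a / of_int b = (of_int c / of_int d :: rat)"
    using assms(2) by (auto simp: p_integral_def)
  have "d \<noteq> 0" using cd by auto
  then have "of_int (a * d) = (of_int (c * b) :: rat)" using cd(2) assms(4) by (simp add: field_simps)
  then have "a * d = c * b" by (simp only: of_int_eq_iff)
  then have "int p dvd a * d" using pb by simp
  then have "int p dvd a" using cd(1) assms(1) by (simp add: prime_dvd_mult_iff)
  then show False using pb assms(1,3) by (auto dest!: coprime_common_divisor)
qed

lemma ring_inverting_iff:
  assumes "W \<subseteq> primes"
  shows "x \<in> ring_inverting W \<longleftrightarrow> (\<forall>p. prime p \<and> p \<notin> W \<longrightarrow> p_integral p x)"
proof
  let ?T = "{x. \<forall>p. prime p \<and> p \<notin> W \<longrightarrow> p_integral p x}"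
  have "ring_inverting W \<subseteq> ?T"
    unfolding ring_inverting_def
  proof (rule hull_minimal)
    show "{1 / rat_of_nat p |p. p \<in> W} \<subseteq> ?T"
    proof clarify
      fix q p assume q: "q \<in> W" and p: "prime p" "p \<notin> W"
      have "prime q" using q assms by blast
      then have "\<not> int p dvd int q" using p q primes_dvd_imp_eq by auto
      then show "p_integral p (1 / of_nat q)" by (intro p_integralI[of p "int q" _ 1]) simp_all
    qed
    have "p_integral p (x - y)" if p: "prime p" and x: "p_integral p x" and y: "p_integral p y" for p x y
    proof -
      have "p_integral p (- y)"
      proof -
        obtain a b where "\<not> int p dvd b" "y = of_int a / of_int b" using y by (auto simp: p_integral_def)
        then show ?thesis by (intro p_integralI[of p b _ "- a"]) simp_all
      qed
      then show ?thesis using p_integral_add[OF p x, of "- y"] by simp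
    qed
    moreover have "p_integral p (x * y)" if p: "prime p" and x: "p_integral p x" and y: "p_integral p y" for p x y
    proof -
      obtain a b where ab: "\<not> int p dvd b" "x = of_int a / of_int b" using x by (auto simp: p_integral_def)
      obtain c d where cd: "\<not> int p dvd d" "y = of_int c / of_int d" using y by (auto simp: p_integral_def)
      show ?thesis
        using ab cd p by (intro p_integralI[of p "b * d" _ "a * c"]) (simp_all add: prime_dvd_mult_iff)
    qed
    moreover have "p_integral p 1" if "prime p" for p using p_integral_of_int[OF that, of 1] by simp
    ultimately show "rat_subring ?T" unfolding rat_subring_def by simp
  qed
  then show "x \<in> ring_inverting W \<Longrightarrow> \<forall>p. prime p \<and> p \<notin> W \<longrightarrow> p_integral p x" by blast
next
  assume int: "\<forall>p. prime p \<and> p \<notin> W \<longrightarrow> p_integral p x"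
  obtain a b where x: "x = Fract a b" "b > 0" "coprime a b" by (cases x)
  have eq: "x = of_int a / of_int b" using x by (simp add: Fract_of_int_quotient)
  have R: "rat_subring (ring_inverting W)" by (rule rat_subring_ring_inverting)
  have inv: "1 / of_nat n \<in> ring_inverting W" if "n > 0" "\<And>p. prime p \<Longrightarrow> p dvd n \<Longrightarrow> p \<in> W" for n :: nat
    using that
  proof (induction n rule: less_induct)
    case (less n)
    show ?case
    proof (cases "n = 1")
      case True
      then show ?thesis using R by (simp add: rat_subring_def)
    next
      case False
      then obtain p where p: "prime p" "p dvd n" using prime_factor_nat by blast
      then obtain m where m: "n = p * m" by (elim dvdE)
      have "m > 0" "m < n" using m less.prems(1) prime_gt_1_nat[OF p(1)] by auto
      then have "1 / of_nat m \<in> ring_inverting W" using less.IH less.prems(2) m by simp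
      moreover have "1 / of_nat p \<in> ring_inverting W"
        unfolding ring_inverting_def by (rule hull_inc) (use p less.prems(2) in blast)
      ultimately have "1 / of_nat p * (1 / of_nat m) \<in> ring_inverting W" using R by (simp only: rat_subring_def)
      then show ?thesis by (simp add: m)
    qed
  qed
  have "1 / of_nat (nat b) \<in> ring_inverting W"
  proof (rule inv)
    fix p assume p: "prime p" "p dvd nat b"
    show "p \<in> W"
    proof (rule ccontr)
      assume "p \<notin> W"
      then have "\<not> int p dvd b" using p(1) int p_integral_reduced[of p a b] x eq by auto
      moreover have "int p dvd int (nat b)" using p(2) by (simp only: of_nat_dvd_iff)
      ultimately show False using x(2) by simp
    qed
  qed (use x in simp)
  then have "of_int a * (1 / of_nat (nat b)) \<in> ring_inverting W"
    using R rat_subring_of_int[OF R, of a] unfolding rat_subring_def by blast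
  then show "x \<in> ring_inverting W" using x(2) by (simp add: eq)
qed

lemma ring_inverting_mono: "V \<subseteq> W \<Longrightarrow> ring_inverting V \<subseteq> ring_inverting W"
  unfolding ring_inverting_def by (rule hull_mono) blast

text \<open>Only the primes dividing the denominator of \<open>x\<close> matter.\<close>

lemma ring_inverting_finite_information:
  assumes V: "V \<subseteq> primes" and x: "x \<in> ring_inverting V"
  shows "\<exists>n. \<forall>W. W \<subseteq> primes \<longrightarrow> (\<forall>p. prime p \<and> p < n \<and> p \<in> V \<longrightarrow> p \<in> W) \<longrightarrow> x \<in> ring_inverting W"
proof -
  obtain a b where ab: "x = Fract a b" "b > 0" "coprime a b" by (cases x)
  have eq: "x = of_int a / of_int b" using ab by (simp add: Fract_of_int_quotient)
  show ?thesis
  proof (intro exI[of _ "nat b + 1"] allI impI)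
    fix W :: "nat set" assume W: "W \<subseteq> primes" "\<forall>p. prime p \<and> p < nat b + 1 \<and> p \<in> V \<longrightarrow> p \<in> W"
    have "p_integral p x" if p: "prime p" "p \<notin> W" for p
    proof (cases "p < nat b + 1")
      case True
      then show ?thesis using p W x ring_inverting_iff[OF V] by blast
    next
      case False
      then have "\<not> int p dvd b" using ab(2) by (auto dest: zdvd_imp_le)
      then show ?thesis using eq by (rule p_integralI)
    qed
    then show "x \<in> ring_inverting W" using ring_inverting_iff[OF W(1)] by blast
  qed
qed

lemma inverse_not_in_ring_inverting:
  assumes "W \<subseteq> primes" "prime p" "p \<notin> W"
  shows "1 / of_nat p \<notin> ring_inverting W"
proof
  assume "1 / of_nat p \<in> ring_inverting W"
  then have "p_integral p (of_int 1 / of_int (int p))" using ring_inverting_iff[OF assms(1)] assms by auto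
  then show False using p_integral_reduced[of p 1 "int p"] assms(2) by auto
qed

section \<open>Transfer of a definition from the rationals to subrings\<close>

text \<open>The unknowns, all variables but the first, are written with a common denominator \<open>b\<close>, which becomes the
  second variable.\<close>

lemma polyfun_homogenize:
  assumes "polyfun F"
  obtains G d where "polyfun G"
    "\<And>q b a. b \<noteq> 0 \<Longrightarrow> G (case_nat q (case_nat b a)) = b ^ d * F (case_nat q (\<lambda>i. a i / b))"
proof -
  obtain t where t: "\<And>e. F e = term_val e t" using assms by (auto simp: polyfun_def)
  define hom where "hom t G d \<longleftrightarrow> (\<forall>q b a. b \<noteq> 0 \<longrightarrow>
      G (case_nat q (case_nat b a)) = b ^ d * term_val (case_nat q (\<lambda>i. a i / b)) t)" for t and G and d :: nat
  have "\<exists>G d. polyfun G \<and> hom t G d"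
  proof (induction t)
    case (TVar i)
    show ?case
    proof (cases i)
      case 0
      then have "hom (TVar i) (\<lambda>e. e 0) 0" by (simp add: hom_def)
      then show ?thesis using polyfun_var by blast
    next
      case (Suc j)
      then have "hom (TVar i) (\<lambda>e. e (Suc (Suc j))) 1" by (simp add: hom_def)
      then show ?thesis using polyfun_var by blast
    qed
  next
    case TZero
    have "hom TZero (\<lambda>e. 0) 0" by (simp add: hom_def)
    then show ?case using polyfun_0 by blast
  next
    case TOne
    have "hom TOne (\<lambda>e. 1) 0" by (simp add: hom_def)
    then show ?case using polyfun_1 by blast
  next
    case (TNeg t)
    then obtain G d where G: "polyfun G" "hom t G d" by blast
    then have "hom (TNeg t) (\<lambda>e. - G e) d" by (simp add: hom_def)
    then show ?case using polyfun_uminus[OF G(1)] by blast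
  next
    case (TAdd s t)
    then obtain G d G' d' where G: "polyfun G" "hom s G d" "polyfun G'" "hom t G' d'" by blast
    have "hom (TAdd s t) (\<lambda>e. e (Suc 0) ^ d' * G e + e (Suc 0) ^ d * G' e) (d + d')"
      using G by (simp add: hom_def power_add distrib_left mult_ac)
    moreover have "polyfun (\<lambda>e. e (Suc 0) ^ d' * G e + e (Suc 0) ^ d * G' e)"
      by (intro polyfun_add polyfun_mult polyfun_power polyfun_var G(1,3))
    ultimately show ?case by blast
  next
    case (TMul s t)
    then obtain G d G' d' where G: "polyfun G" "hom s G d" "polyfun G'" "hom t G' d'" by blast
    have "hom (TMul s t) (\<lambda>e. G e * G' e) (d + d')"
      using G by (simp add: hom_def power_add mult_ac)
    then show ?case using polyfun_mult[OF G(1,3)] by blast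
  qed
  then obtain G d where "polyfun G" "hom t G d" by blast
  then show ?thesis using that unfolding hom_def t by blast
qed

text \<open>The point of the asymmetry: rational solutions with \<open>b \<noteq> 0\<close> exist only for integers \<open>q\<close>, and for these
  there are already integer solutions. Membership in \<open>\<int>\<close> is thus captured by solutions in any ring
  between \<open>\<int>\<close> and \<open>\<rat>\<close>.\<close>

lemma ints_definition_homogeneous:
  assumes "existentially_defines_ints g UNIV"
  obtains G where "polyfun G"
    "\<And>q b a. b \<noteq> 0 \<Longrightarrow> G (case_nat q (case_nat b a)) = 0 \<Longrightarrow> q \<in> \<int>"
    "\<And>q. q \<in> \<int> \<Longrightarrow> \<exists>b a. b > 0 \<and> G (case_nat q (case_nat (of_nat b) (\<lambda>i. of_int (a i)))) = 0"
proof -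
  obtain G d where G: "polyfun G" "\<And>q b a. b \<noteq> 0 \<Longrightarrow>
      G (case_nat q (case_nat b a)) = b ^ d * zpoly_eval g (case_nat q (\<lambda>i. a i / b))"
    by (rule polyfun_homogenize[OF polyfun_zpoly_eval[of g]]) blast
  have def: "q \<in> \<int> \<longleftrightarrow> (\<exists>y. zpoly_eval g (case_nat q y) = 0)" for q
    using assms by (simp add: existentially_defines_ints_def)
  show ?thesis
  proof (rule that)
    show "polyfun G" by (rule G(1))
    show "q \<in> \<int>" if "b \<noteq> 0" "G (case_nat q (case_nat b a)) = 0" for q b a
    proof -
      have "zpoly_eval g (case_nat q (\<lambda>i. a i / b)) = 0" using that G(2)[OF that(1), of q a] by simp
      then show ?thesis unfolding def by blast
    qed
    show "\<exists>b a. b > 0 \<and> G (case_nat q (case_nat (of_nat b) (\<lambda>i. of_int (a i)))) = 0" if qZ: "q \<in> \<int>" for q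
    proof -
      obtain y where y: "zpoly_eval g (case_nat q y) = 0" using qZ unfolding def by blast
      from polyfun_finite_support[OF polyfun_zpoly_eval[of g]]
      obtain N where N: "\<forall>e e'. (\<forall>i<N. e i = e' i) \<longrightarrow> zpoly_eval g e = zpoly_eval g e'" ..
      obtain b where b: "b > 0" "\<forall>i\<in>{..<N}. \<exists>a. y i = of_int a / of_nat b"
        using common_denominator[of "{..<N}" y] by auto
      then have "\<forall>i. \<exists>a. i < N \<longrightarrow> y i = of_int a / of_nat b" by auto
      then obtain a where a: "\<And>i. i < N \<Longrightarrow> y i = of_int (a i) / of_nat b" by metis
      have "zpoly_eval g (case_nat q (\<lambda>i. of_int (a i) / of_nat b)) = zpoly_eval g (case_nat q y)"
        using N[rule_format, of "case_nat q (\<lambda>i. of_int (a i) / of_nat b)" "case_nat q y"] by (auto simp: a split: nat.split)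
      then have "G (case_nat q (case_nat (of_nat b) (\<lambda>i. of_int (a i)))) = 0"
        using G(2)[of "of_nat b" q "\<lambda>i. of_int (a i)"] b(1) y by simp
      then show ?thesis using b(1) by blast
    qed
  qed
qed

lemma ex_sat_foldr:
  "ex_sat R e (foldr Ex xs \<phi>) \<longleftrightarrow>
     (\<exists>e'. (\<forall>i. i \<notin> set xs \<longrightarrow> e' i = e i) \<and> (\<forall>i\<in>set xs. e' i \<in> R) \<and> ex_sat R e' \<phi>)"
proof (induction xs arbitrary: e)
  case Nil
  have "(\<exists>e'. (\<forall>i. e' i = e i) \<and> ex_sat R e' \<phi>) \<longleftrightarrow> ex_sat R e \<phi>"
    by (metis ext)
  then show ?case by simp
next
  case (Cons x xs)
  show ?case
  proof
    assume "ex_sat R e (foldr Ex (x # xs) \<phi>)"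
    then obtain a e' where "a \<in> R" "\<forall>i. i \<notin> set xs \<longrightarrow> e' i = (e(x := a)) i" "\<forall>i\<in>set xs. e' i \<in> R" "ex_sat R e' \<phi>"
      using Cons.IH by auto
    then show "\<exists>e'. (\<forall>i. i \<notin> set (x # xs) \<longrightarrow> e' i = e i) \<and> (\<forall>i\<in>set (x # xs). e' i \<in> R) \<and> ex_sat R e' \<phi>"
      by (intro exI[of _ e']) (metis fun_upd_apply list.set_intros set_ConsD)
  next
    assume "\<exists>e'. (\<forall>i. i \<notin> set (x # xs) \<longrightarrow> e' i = e i) \<and> (\<forall>i\<in>set (x # xs). e' i \<in> R) \<and> ex_sat R e' \<phi>"
    then obtain e' where e': "\<forall>i. i \<notin> set (x # xs) \<longrightarrow> e' i = e i" "\<forall>i\<in>set (x # xs). e' i \<in> R" "ex_sat R e' \<phi>" by blast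
    then have "ex_sat R (e(x := e' x)) (foldr Ex xs \<phi>)"
      unfolding Cons.IH by (intro exI[of _ e']) auto
    then show "ex_sat R e (foldr Ex (x # xs) \<phi>)" using e'(2) by auto
  qed
qed

lemma free_vars_foldr: "free_vars (foldr Ex xs \<phi>) = free_vars \<phi> - set xs"
  by (induction xs) auto

lemma finite_term_vars: "finite (term_vars t)"
  by (induction t) auto

lemma term_val_cong: "(\<And>i. i \<in> term_vars t \<Longrightarrow> e i = e' i) \<Longrightarrow> term_val e t = term_val e' t"
  by (induction t) auto

text \<open>The formula says that \<open>G(x\<^sub>0, x\<^sub>1, \<dots>) = 0\<close> and \<open>x\<^sub>1 \<noteq> 0\<close> for some \<open>x\<^sub>1, x\<^sub>2, \<dots>\<close>.\<close>

theorem uniform_formula_if_definable_in_rationals: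
  assumes "existentially_defines_ints g UNIV"
  shows "\<exists>\<phi>. free_vars \<phi> = {0} \<and> (\<forall>R. rat_subring R \<longrightarrow> formula_defines_ints \<phi> R)"
proof -
  obtain G where G: "polyfun G"
    "\<And>q b a. b \<noteq> 0 \<Longrightarrow> G (case_nat q (case_nat b a)) = 0 \<Longrightarrow> q \<in> \<int>"
    "\<And>q. q \<in> \<int> \<Longrightarrow> \<exists>b a. b > 0 \<and> G (case_nat q (case_nat (of_nat b) (\<lambda>i. of_int (a i)))) = 0"
    using ints_definition_homogeneous[OF assms] by blast
  obtain t where t: "\<And>e. G e = term_val e t" using G(1) by (auto simp: polyfun_def)
  define K where "K = Suc (Max (insert 1 (term_vars t)))"
  have K: "1 < K" "\<And>i. i \<in> term_vars t \<Longrightarrow> i < K"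
    using finite_term_vars[of t] by (auto simp: K_def less_Suc_eq_le)
  (* The trivial equation ensures that variable 0 occurs in the formula. *)
  define A where "A = QAnd (QAnd (QEq (TVar 0) (TVar 0)) (QNot (QEq (TVar 1) TZero))) (QEq t TZero)"
  define \<phi> where "\<phi> = foldr Ex [1..<K] (Matrix A)"
  have set: "set [1..<K] = {1..<K}" by simp
  show ?thesis
  proof (intro exI[of _ \<phi>] conjI allI impI)
    show "free_vars \<phi> = {0}"
      unfolding \<phi>_def free_vars_foldr set using K by (auto simp: A_def)
    fix R assume R: "rat_subring R"
    have "q \<in> \<int> \<longleftrightarrow> ex_sat R (\<lambda>_. q) \<phi>" if q: "q \<in> R" for q
    proof
      assume "q \<in> \<int>"
      then obtain b a where ba: "b > 0" "G (case_nat q (case_nat (of_nat b) (\<lambda>i. of_int (a i)))) = 0"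
        using G(3) by blast
      define e where "e = case_nat q (case_nat (of_nat b) (\<lambda>i. of_int (a i) :: rat))"
      define e' where "e' i = (if i < K then e i else q)" for i
      have "term_val e' t = term_val e t" by (rule term_val_cong) (simp add: e'_def K)
      then have "qf_sat e' A" using ba K by (simp add: A_def t e_def e'_def)
      moreover have "e i \<in> R" if "i \<ge> 1" for i
        using that rat_subring_of_int[OF R] rat_subring_of_int[OF R, of "int b"]
        by (auto simp: e_def split: nat.split)
      ultimately show "ex_sat R (\<lambda>_. q) \<phi>"
        unfolding \<phi>_def ex_sat_foldr set
      proof (intro exI[of _ e'] conjI allI impI ballI)
        fix i assume "i \<notin> {1..<K}"
        then show "e' i = q" by (cases "i = 0") (auto simp: e'_def e_def)
      qed (auto simp: e'_def)
    next
      assume "ex_sat R (\<lambda>_. q) \<phi>"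
      then obtain e where e: "e 0 = q" "qf_sat e A"
        unfolding \<phi>_def ex_sat_foldr set by auto
      have "e = case_nat (e 0) (case_nat (e 1) (\<lambda>i. e (Suc (Suc i))))"
        by (auto simp: fun_eq_iff split: nat.split)
      then have "G (case_nat q (case_nat (e 1) (\<lambda>i. e (Suc (Suc i))))) = 0"
        using e by (simp add: A_def t)
      moreover have "e 1 \<noteq> 0" using e by (simp add: A_def)
      ultimately show "q \<in> \<int>" using G(2) by blast
    qed
    then show "formula_defines_ints \<phi> R" by (simp add: formula_defines_ints_def)
  qed
qed

lemma diophantine_qf_sat: "diophantine (\<lambda>e. qf_sat e a)" "diophantine (\<lambda>e. \<not> qf_sat e a)"
  by (induction a)
    (simp_all only: qf_sat.simps not_not de_Morgan_conj de_Morgan_disj diophantine_eq diophantine_neq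
      polyfun_term_val diophantine_conj diophantine_disj)

lemma diophantine_ex_sat: "diophantine (\<lambda>e. ex_sat UNIV e \<phi>)"
proof (induction \<phi>)
  case (Matrix a)
  show ?case using diophantine_qf_sat(1) by simp
next
  case (Ex i \<phi>)
  then show ?case using diophantine_ex[of "\<lambda>e. ex_sat UNIV e \<phi>" i] by simp
qed

lemma definable_in_rationals_if_formula:
  assumes "formula_defines_ints \<phi> UNIV"
  shows "ints_existentially_definable UNIV"
proof -
  have "diophantine (\<lambda>e. ex_sat UNIV (\<lambda>_. e 0) \<phi>)"
    using diophantine_subst[OF diophantine_ex_sat, of "\<lambda>_ e. e 0"] by (simp add: polyfun_var)
  then have "diophantine_set \<int>" using assms by (simp add: diophantine_set_def formula_defines_ints_def)
  then show ?thesis by (rule ints_existentially_definable_if_diophantine)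
qed

text \<open>An odd \<open>d\<close> divides some \<open>2u - 1\<close>. A factor 2 of \<open>d\<close> can be absorbed in the other factor, because
  \<open>4 (3v - 1) = 3 (4v - 1) - 1\<close>.\<close>

lemma nonzero_multiple_product: "\<exists>u v w :: int. int d * w = (2 * u - 1) * (3 * v - 1)" if "d > 0"
  using that
proof (induction d rule: less_induct)
  case (less d)
  show ?case
  proof (cases "even d")
    case True
    then obtain d1 where d1: "d = 2 * d1" by (elim evenE)
    then have "d1 < d" "d1 > 0" using less.prems by auto
    then obtain u v w where "int d1 * w = (2 * u - 1) * (3 * v - 1)" using less.IH by blast
    then have "int d * (2 * w) = (2 * u - 1) * (3 * (4 * v - 1) - 1)" by (simp add: d1 algebra_simps)
    then show ?thesis by blast
  next
    case False
    then obtain m where "d = 2 * m + 1" by (elim oddE)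
    then have "int d * (-1) = (2 * (int m + 1) - 1) * (3 * 0 - 1)" by simp
    then show ?thesis by blast
  qed
qed

text \<open>Over such a ring \<open>b \<noteq> 0\<close> may be replaced by solvability of \<open>b w = (2u - 1)(3v - 1)\<close>: the right-hand side
  never vanishes because 1/2 and 1/3 are absent, and for a positive integer \<open>b\<close> there is a solution by
  \<open>nonzero_multiple_product\<close>. The two equations are joined by a sum of squares.\<close>

theorem uniform_definition_if_2_3_not_inverted:
  assumes "existentially_defines_ints g UNIV"
  shows "\<exists>h. \<forall>V. V \<subseteq> primes \<and> 2 \<notin> V \<and> 3 \<notin> V \<longrightarrow> existentially_defines_ints h (ring_inverting V)"
proof -
  obtain G where G: "polyfun G"
    "\<And>q b a. b \<noteq> 0 \<Longrightarrow> G (case_nat q (case_nat b a)) = 0 \<Longrightarrow> q \<in> \<int>"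
    "\<And>q. q \<in> \<int> \<Longrightarrow> \<exists>b a. b > 0 \<and> G (case_nat q (case_nat (of_nat b) (\<lambda>i. of_int (a i)))) = 0"
    using ints_definition_homogeneous[OF assms] by blast
  define H where "H x = G (case_nat (x 0) (case_nat (x (Suc 0)) (\<lambda>i. x (Suc (i + 4))))) ^ 2
      + (x (Suc 0) * x (Suc 1) - (2 * x (Suc 2) - 1) * (3 * x (Suc 3) - 1)) ^ 2" for x :: "nat \<Rightarrow> rat"
  have "polyfun (\<lambda>x. case_nat (x 0) (case_nat (x (Suc 0)) (\<lambda>i. x (Suc (i + 4)))) i)" for i
  proof (cases i)
    case (Suc j)
    then show ?thesis by (cases j) (simp_all add: polyfun_var)
  qed (simp add: polyfun_var)
  then have "polyfun (\<lambda>x. G (\<lambda>i. case_nat (x 0) (case_nat (x (Suc 0)) (\<lambda>i. x (Suc (i + 4)))) i))"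
    by (rule polyfun_compose[OF G(1)])
  then have "polyfun H" unfolding H_def
    by (intro polyfun_add polyfun_power polyfun_mult polyfun_diff polyfun_var polyfun_numeral polyfun_1)
  then obtain h where h: "\<forall>x. zpoly_eval h x = H x" using polyfun_imp_zpoly by blast
  have H_eq: "H (case_nat q y) = G (case_nat q (case_nat (y 0) (\<lambda>i. y (i + 4)))) ^ 2
      + (y 0 * y 1 - (2 * y 2 - 1) * (3 * y 3 - 1)) ^ 2" for q y
    by (simp only: H_def nat.case)
  show ?thesis
  proof (intro exI[of _ h] allI impI)
    fix V :: "nat set" assume "V \<subseteq> primes \<and> 2 \<notin> V \<and> 3 \<notin> V"
    then have V: "V \<subseteq> primes" "2 \<notin> V" "3 \<notin> V" by simp_all
    have R: "rat_subring (ring_inverting V)" by (rule rat_subring_ring_inverting)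
    have not_half: "2 * u - 1 \<noteq> 0" "3 * u - 1 \<noteq> 0" if "u \<in> ring_inverting V" for u
    proof -
      have "1 / 2 \<notin> ring_inverting V" "1 / 3 \<notin> ring_inverting V"
        using inverse_not_in_ring_inverting[OF V(1), of 2] inverse_not_in_ring_inverting[OF V(1), of 3] V by simp_all
      then have u: "u \<noteq> 1 / 2" "u \<noteq> 1 / 3" using that by blast+
      have "u = 1 / 2" if "2 * u - 1 = 0" using that by (simp add: field_simps)
      then show "2 * u - 1 \<noteq> 0" using u by blast
      have "u = 1 / 3" if "3 * u - 1 = 0" using that by (simp add: field_simps)
      then show "3 * u - 1 \<noteq> 0" using u by blast
    qed
    have iff: "q \<in> \<int> \<longleftrightarrow> (\<exists>y. (\<forall>i. y i \<in> ring_inverting V) \<and> H (case_nat q y) = 0)" for q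
    proof
      assume "q \<in> \<int>"
      then obtain b a where ba: "b > 0" "G (case_nat q (case_nat (of_nat b) (\<lambda>i. of_int (a i)))) = 0"
        using G(3) by blast
      obtain u v w :: int where uvw: "int b * w = (2 * u - 1) * (3 * v - 1)"
        using nonzero_multiple_product[OF ba(1)] by blast
      define z :: "nat \<Rightarrow> int" where "z = case_nat (int b) (case_nat w (case_nat u (case_nat v a)))"
      have z: "z 0 = int b" "z 1 = w" "z 2 = u" "z 3 = v" "z (i + 4) = a i" for i
        by (simp_all add: z_def numeral_eq_Suc)
      define y :: "nat \<Rightarrow> rat" where "y i = of_int (z i)" for i
      have "y 0 * y 1 = (2 * y 2 - 1) * (3 * y 3 - 1)"
      proof -
        have "of_int (int b * w) = (of_int ((2 * u - 1) * (3 * v - 1)) :: rat)" unfolding uvw ..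
        then show ?thesis unfolding y_def z by simp
      qed
      moreover have "case_nat q (case_nat (y 0) (\<lambda>i. y (i + 4))) = case_nat q (case_nat (of_nat b) (\<lambda>i. of_int (a i)))"
        unfolding y_def z by simp
      ultimately have "H (case_nat q y) = 0" unfolding H_eq using ba(2) by simp
      moreover have "y i \<in> ring_inverting V" for i unfolding y_def by (rule rat_subring_of_int[OF R])
      ultimately show "\<exists>y. (\<forall>i. y i \<in> ring_inverting V) \<and> H (case_nat q y) = 0" by blast
    next
      assume "\<exists>y. (\<forall>i. y i \<in> ring_inverting V) \<and> H (case_nat q y) = 0"
      then obtain y where y: "\<And>i. y i \<in> ring_inverting V" "H (case_nat q y) = 0" by blast
      then have G0: "G (case_nat q (case_nat (y 0) (\<lambda>i. y (i + 4)))) = 0"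
        and yy: "y 0 * y 1 = (2 * y 2 - 1) * (3 * y 3 - 1)"
        unfolding H_eq by (simp_all add: sum_power2_eq_zero_iff)
      have "(2 * y 2 - 1) * (3 * y 3 - 1) \<noteq> 0" using not_half y(1) by simp
      then have "y 0 \<noteq> 0" using yy by auto
      then show "q \<in> \<int>" using G0 by (rule G(2))
    qed
    then show "existentially_defines_ints h (ring_inverting V)"
      unfolding existentially_defines_ints_def h[rule_format] by (intro ballI)
  qed
qed

section \<open>The Cantor space of sets of primes\<close>

text \<open>For \<open>V \<subseteq> primes\<close> these sets are the cylinders, described by a centre and a length instead of a partial
  function. They form a neighbourhood base at \<open>V\<close>.\<close>

definition same_below :: "nat set \<Rightarrow> nat \<Rightarrow> nat set set" where
  "same_below V n = {W. W \<subseteq> primes \<and> (\<forall>p. prime p \<and> p < n \<longrightarrow> (p \<in> W \<longleftrightarrow> p \<in> V))}"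

lemma same_below_self: "V \<subseteq> primes \<Longrightarrow> V \<in> same_below V n"
  by (simp add: same_below_def)

lemma same_below_antimono: "m \<le> n \<Longrightarrow> same_below V n \<subseteq> same_below V m"
  by (auto simp: same_below_def)

definition char_fun :: "nat set \<Rightarrow> nat \<Rightarrow> bool" where
  "char_fun W = restrict (\<lambda>p. p \<in> W) primes"

abbreviation bool_product :: "(nat \<Rightarrow> bool) topology" where
  "bool_product \<equiv> product_topology (\<lambda>_. discrete_topology (UNIV :: bool set)) primes"

lemma openin_cantor: "openin cantor_topology U \<longleftrightarrow> (\<exists>T. openin bool_product T \<and> U = char_fun -` T \<inter> Pow primes)"
  unfolding cantor_topology_def openin_pullback_topology char_fun_def ..

lemma inj_on_char_fun: "inj_on char_fun (Pow primes)"
proof (rule inj_onI)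
  fix V W assume VW: "V \<in> Pow primes" "W \<in> Pow primes" "char_fun V = char_fun W"
  have "p \<in> V \<longleftrightarrow> p \<in> W" if "p \<in> primes" for p
    using fun_cong[OF VW(3), of p] that by (simp add: char_fun_def)
  then show "V = W" using VW(1,2) by blast
qed

lemma char_fun_image: "char_fun ` Pow primes = (\<Pi>\<^sub>E p\<in>primes. UNIV)"
proof (intro subset_antisym subsetI)
  fix f assume f: "f \<in> (\<Pi>\<^sub>E p\<in>primes. (UNIV :: bool set))"
  have "f = char_fun {p \<in> primes. f p}"
  proof
    show "f p = char_fun {p \<in> primes. f p} p" for p
      using PiE_arb[OF f, of p] by (cases "p \<in> primes") (simp_all add: char_fun_def)
  qed
  then show "f \<in> char_fun ` Pow primes" by blast
qed (auto simp: char_fun_def)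

lemma homeomorphic_cantor: "cantor_topology homeomorphic_space bool_product"
proof -
  have "homeomorphic_map cantor_topology bool_product char_fun"
  proof (rule bijective_open_imp_homeomorphic_map)
    show "continuous_map cantor_topology bool_product char_fun"
      unfolding continuous_map_def topspace_cantor_topology topspace_product_topology topspace_discrete_topology
    proof (intro conjI allI impI)
      show "char_fun \<in> Pow primes \<rightarrow> (\<Pi>\<^sub>E p\<in>primes. UNIV)" using char_fun_image by blast
      fix T assume "openin bool_product T"
      moreover have "{W \<in> Pow primes. char_fun W \<in> T} = char_fun -` T \<inter> Pow primes" by blast
      ultimately show "openin cantor_topology {W \<in> Pow primes. char_fun W \<in> T}"
        unfolding openin_cantor by blast
    qed
    show "open_map cantor_topology bool_product char_fun"
      unfolding open_map_def
    proof (intro allI impI)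
      fix U assume "openin cantor_topology U"
      then obtain T where T: "openin bool_product T" "U = char_fun -` T \<inter> Pow primes"
        unfolding openin_cantor by blast
      have "T \<subseteq> char_fun ` Pow primes" using openin_subset[OF T(1)] char_fun_image by simp
      then have "char_fun ` U = T" unfolding T(2) by blast
      then show "openin bool_product (char_fun ` U)" using T(1) by simp
    qed
    show "char_fun ` topspace cantor_topology = topspace bool_product"
      using char_fun_image by (simp add: topspace_cantor_topology)
    show "inj_on char_fun (topspace cantor_topology)"
      using inj_on_char_fun by (simp add: topspace_cantor_topology)
  qed
  then show ?thesis by (rule homeomorphic_map_imp_homeomorphic_space)
qed

lemma cantor_locally_compact_regular:
  "locally_compact_space cantor_topology" "regular_space cantor_topology"
proof -
  have "compact_space bool_product"
    by (simp add: compact_space_product_topology compact_space_discrete_topology)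
  then have c: "compact_space cantor_topology"
    using homeomorphic_compact_space[OF homeomorphic_cantor] by blast
  have "Hausdorff_space bool_product"
    unfolding Hausdorff_space_product_topology by (simp add: Hausdorff_space_discrete_topology)
  then have "Hausdorff_space cantor_topology"
    using homeomorphic_Hausdorff_space[OF homeomorphic_cantor] by blast
  then show "regular_space cantor_topology" using c by (intro compact_Hausdorff_imp_regular_space)
  show "locally_compact_space cantor_topology" using c by (rule compact_imp_locally_compact_space)
qed

lemma openin_same_below: "openin cantor_topology (same_below V n)"
proof -
  define X where "X p = (if p < n then {p \<in> V} else UNIV)" for p
  have "{p. X p \<noteq> UNIV} \<subseteq> {..<n}" by (auto simp: X_def)
  then have "finite {p. X p \<noteq> UNIV}" using finite_subset by blast
  then have "openin bool_product (\<Pi>\<^sub>E p\<in>primes. X p)"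
    by (intro product_topology_basis) simp_all
  moreover have "same_below V n = char_fun -` (\<Pi>\<^sub>E p\<in>primes. X p) \<inter> Pow primes"
    by (auto simp: same_below_def char_fun_def X_def PiE_iff split: if_splits)
  ultimately show ?thesis unfolding openin_cantor by blast
qed

lemma openin_cantor_contains_same_below:
  assumes "openin cantor_topology U" "V \<in> U"
  shows "\<exists>n. same_below V n \<subseteq> U"
proof -
  obtain T where T: "openin bool_product T" "U = char_fun -` T \<inter> Pow primes"
    using assms(1) unfolding openin_cantor by blast
  have "char_fun V \<in> T" using assms(2) T by blast
  have "\<exists>X. char_fun V \<in> (\<Pi>\<^sub>E p\<in>primes. X p) \<and> finite {p. X p \<noteq> (UNIV :: bool set)} \<and> (\<Pi>\<^sub>E p\<in>primes. X p) \<subseteq> T"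
    using product_topology_open_contains_basis[OF T(1) \<open>char_fun V \<in> T\<close>] by simp
  then obtain X where X: "char_fun V \<in> (\<Pi>\<^sub>E p\<in>primes. X p)"
    "finite {p. X p \<noteq> (UNIV :: bool set)}" "(\<Pi>\<^sub>E p\<in>primes. X p) \<subseteq> T"
    by blast
  obtain n where n: "\<And>p. X p \<noteq> UNIV \<Longrightarrow> p < n"
    using X(2) finite_nat_set_iff_bounded by auto
  have "same_below V n \<subseteq> U"
  proof
    fix W assume W: "W \<in> same_below V n"
    have "char_fun W p \<in> X p" if "p \<in> primes" for p
    proof (cases "p < n")
      case True
      then have "char_fun W p = char_fun V p" using W that by (simp add: same_below_def char_fun_def)
      then show ?thesis using X(1) that by (auto simp: PiE_iff)
    next
      case False
      then show ?thesis using n[of p] by auto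
    qed
    then have "char_fun W \<in> (\<Pi>\<^sub>E p\<in>primes. X p)" by (auto simp: PiE_iff char_fun_def)
    then show "W \<in> U" using X(3) T(2) W by (auto simp: same_below_def)
  qed
  then show ?thesis ..
qed

lemma nowhere_dense_in_subset: "nowhere_dense_in X T \<Longrightarrow> S \<subseteq> T \<Longrightarrow> nowhere_dense_in X S"
  unfolding nowhere_dense_in_def by (metis closure_of_mono interior_of_mono order_trans subset_empty)

text \<open>Baire's category theorem; the space is compact and Hausdorff because it is homeomorphic to a product
  of finite discrete spaces.\<close>

lemma same_below_not_meager:
  assumes V: "V \<subseteq> primes" and N: "countable \<N>" "\<And>N. N \<in> \<N> \<Longrightarrow> nowhere_dense_in cantor_topology N"
  shows "\<exists>W\<in>same_below V n. W \<notin> \<Union>\<N>"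
proof (rule ccontr)
  assume "\<not> ?thesis"
  then have sub: "same_below V n \<subseteq> \<Union>\<N>" by blast
  let ?C = "(\<lambda>N. cantor_topology closure_of N) ` \<N>"
  have "cantor_topology interior_of \<Union>?C = {}"
  proof (rule Baire_category_aux[OF cantor_locally_compact_regular])
    show "countable ?C" using N(1) by simp
    show "closedin cantor_topology G \<and> cantor_topology interior_of G = {}" if "G \<in> ?C" for G
      using that N(2) by (auto simp: nowhere_dense_in_def)
  qed
  moreover have "N \<subseteq> cantor_topology closure_of N" if "N \<in> \<N>" for N
    using N(2)[OF that] unfolding nowhere_dense_in_def by (blast intro!: closure_of_subset)
  then have "same_below V n \<subseteq> \<Union>?C" using sub by blast
  ultimately have "same_below V n = {}"
    using interior_of_maximal[OF _ openin_same_below[of V n], of "\<Union>?C"] by simp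
  then show False using same_below_self[OF V] by blast
qed

lemma cylinder_eq_same_below:
  assumes "\<sigma> \<in> prime_strings"
  shows "\<exists>n. \<forall>V\<in>cylinder \<sigma>. cylinder \<sigma> = same_below V n"
proof -
  obtain n where n: "dom \<sigma> = {p. prime p \<and> p < n}" using assms by (auto simp: prime_strings_def)
  have "cylinder \<sigma> = same_below V n" if "V \<in> cylinder \<sigma>" for V
    using that unfolding cylinder_def same_below_def n by (auto simp: n)
  then show ?thesis by blast
qed

text \<open>The largest set of a cylinder contains every prime that the string does not exclude.\<close>

lemma cylinder_largest:
  assumes "\<sigma> \<in> prime_strings"
  shows "{p. prime p \<and> \<sigma> p \<noteq> Some False} \<in> cylinder \<sigma>"
proof -
  obtain n where n: "dom \<sigma> = {p. prime p \<and> p < n}" using assms by (auto simp: prime_strings_def)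
  then have "prime p" if "\<sigma> p = Some b" for p b using that by blast
  then show ?thesis
    by (auto simp: cylinder_def)
qed

lemma same_below_eq_cylinder:
  assumes "V \<subseteq> primes"
  shows "\<exists>\<sigma>\<in>prime_strings. cylinder \<sigma> = same_below V n"
proof -
  define \<sigma> where "\<sigma> p = (if prime p \<and> p < n then Some (p \<in> V) else None)" for p
  have "dom \<sigma> = {p. prime p \<and> p < n}" by (auto simp: \<sigma>_def dom_def split: if_splits)
  then have "\<sigma> \<in> prime_strings" unfolding prime_strings_def by blast
  moreover have "cylinder \<sigma> = same_below V n"
    unfolding cylinder_def same_below_def \<open>dom \<sigma> = _\<close> by (auto simp: \<sigma>_def)
  ultimately show ?thesis by blast
qed

instance rterm :: countable
  by countable_datatype

text \<open>Every evaluation function is the value of a ring term, and there are only countably many ring terms.\<close>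

lemma countable_range_if_determined_by_eval:
  assumes "\<And>f g. zpoly_eval f = zpoly_eval g \<Longrightarrow> B f = B g"
  shows "countable (range B)"
proof -
  have "\<forall>f. \<exists>t. zpoly_eval f = (\<lambda>e. term_val e t)"
    using polyfun_zpoly_eval unfolding polyfun_def by blast
  then obtain t where t: "\<And>f. zpoly_eval f = (\<lambda>e. term_val e (t f))" by metis
  define f0 where "f0 s = (SOME f. t f = s)" for s
  have "B f = B (f0 (t f))" for f
  proof (rule assms)
    have "t (f0 (t f)) = t f" unfolding f0_def by (rule someI[of _ f]) simp
    then show "zpoly_eval f = zpoly_eval (f0 (t f))" unfolding t[of f] t[of "f0 (t f)"] by simp
  qed
  then have "range B \<subseteq> range (\<lambda>s. B (f0 s))" by blast
  then show ?thesis using countable_subset by blast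
qed

lemma zero_in_ring_inverting: "0 \<in> ring_inverting W"
  using rat_subring_of_int[OF rat_subring_ring_inverting, of 0] by simp

lemma ring_inverting_finitely_many:
  assumes V: "V \<subseteq> primes" and "finite A" "A \<subseteq> ring_inverting V"
  shows "\<exists>n. \<forall>W. W \<subseteq> primes \<longrightarrow> (\<forall>p. prime p \<and> p < n \<and> p \<in> V \<longrightarrow> p \<in> W) \<longrightarrow> A \<subseteq> ring_inverting W"
  using assms(2,3)
proof (induction A rule: finite_induct)
  case (insert x A)
  have "A \<subseteq> ring_inverting V" using insert.prems by simp
  from insert.IH[OF this] obtain n where n: "\<forall>W. W \<subseteq> primes \<longrightarrow> (\<forall>p. prime p \<and> p < n \<and> p \<in> V \<longrightarrow> p \<in> W) \<longrightarrow> A \<subseteq> ring_inverting W" ..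
  have "x \<in> ring_inverting V" using insert.prems by simp
  from ring_inverting_finite_information[OF V this]
  obtain m where m: "\<forall>W. W \<subseteq> primes \<longrightarrow> (\<forall>p. prime p \<and> p < m \<and> p \<in> V \<longrightarrow> p \<in> W) \<longrightarrow> x \<in> ring_inverting W" ..
  show ?case
  proof (intro exI[of _ "max m n"] allI impI)
    fix W :: "nat set" assume W: "W \<subseteq> primes" "\<forall>p. prime p \<and> p < max m n \<and> p \<in> V \<longrightarrow> p \<in> W"
    have "x \<in> ring_inverting W" by (rule m[rule_format, OF W(1)]) (use W(2) in auto)
    moreover have "A \<subseteq> ring_inverting W" by (rule n[rule_format, OF W(1)]) (use W(2) in auto)
    ultimately show "insert x A \<subseteq> ring_inverting W" by simp
  qed
qed simp

text \<open>A zero involves finitely many variables and hence finitely many denominators; the other coordinates may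
  be replaced by 0. So a zero over \<open>V\<close> uses only the primes of \<open>V\<close> below some bound.\<close>

lemma solution_persists:
  assumes V: "V \<subseteq> primes" and q: "q \<in> ring_inverting V"
    and y: "\<And>i. y i \<in> ring_inverting V" "zpoly_eval g (case_nat q y) = 0"
  shows "\<exists>n. \<forall>W. W \<subseteq> primes \<longrightarrow> (\<forall>p. prime p \<and> p < n \<and> p \<in> V \<longrightarrow> p \<in> W) \<longrightarrow>
      q \<in> ring_inverting W \<and> (\<exists>y. (\<forall>i. y i \<in> ring_inverting W) \<and> zpoly_eval g (case_nat q y) = 0)"
proof -
  from polyfun_finite_support[OF polyfun_zpoly_eval[of g]]
  obtain N where N: "\<forall>e e'. (\<forall>i<N. e i = e' i) \<longrightarrow> zpoly_eval g e = zpoly_eval g e'" ..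
  define y' where "y' i = (if i < N then y i else 0)" for i
  have y': "zpoly_eval g (case_nat q y') = 0"
  proof -
    have "case_nat q y' i = case_nat q y i" if "i < N" for i
      using that by (cases i) (simp_all add: y'_def)
    then have "zpoly_eval g (case_nat q y') = zpoly_eval g (case_nat q y)" using N by blast
    then show ?thesis using y(2) by simp
  qed
  have "finite (insert q (y ` {..<N}))" "insert q (y ` {..<N}) \<subseteq> ring_inverting V" using q y(1) by auto
  from ring_inverting_finitely_many[OF V this]
  obtain n where n: "\<forall>W. W \<subseteq> primes \<longrightarrow> (\<forall>p. prime p \<and> p < n \<and> p \<in> V \<longrightarrow> p \<in> W) \<longrightarrow>
      insert q (y ` {..<N}) \<subseteq> ring_inverting W" ..
  show ?thesis
  proof (intro exI[of _ n] allI impI)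
    fix W :: "nat set" assume W: "W \<subseteq> primes" "\<forall>p. prime p \<and> p < n \<and> p \<in> V \<longrightarrow> p \<in> W"
    have sub: "insert q (y ` {..<N}) \<subseteq> ring_inverting W" using n W by blast
    have "y' i \<in> ring_inverting W" for i
      using sub zero_in_ring_inverting by (cases "i < N") (auto simp: y'_def)
    then show "q \<in> ring_inverting W \<and> (\<exists>y. (\<forall>i. y i \<in> ring_inverting W) \<and> zpoly_eval g (case_nat q y) = 0)"
      using sub y' by blast
  qed
qed

section \<open>Generic sets\<close>

lemma openin_solvable_set: "openin cantor_topology (solvable_set f)"
proof (subst openin_subopen, intro ballI)
  fix V assume "V \<in> solvable_set f"
  then obtain x where V: "V \<subseteq> primes" and x: "\<And>i. x i \<in> ring_inverting V" "zpoly_eval f x = 0"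
    unfolding solvable_set_def HTP_def by blast
  have eq: "case_nat (x 0) (\<lambda>i. x (Suc i)) = x" by (auto simp: fun_eq_iff split: nat.split)
  have "zpoly_eval f (case_nat (x 0) (\<lambda>i. x (Suc i))) = 0" using x(2) eq by simp
  from solution_persists[OF V x(1) x(1) this]
  obtain n where n: "\<forall>W. W \<subseteq> primes \<longrightarrow> (\<forall>p. prime p \<and> p < n \<and> p \<in> V \<longrightarrow> p \<in> W) \<longrightarrow>
      x 0 \<in> ring_inverting W \<and> (\<exists>y. (\<forall>i. y i \<in> ring_inverting W) \<and> zpoly_eval f (case_nat (x 0) y) = 0)" ..
  have "same_below V n \<subseteq> solvable_set f"
  proof
    fix W assume "W \<in> same_below V n"
    then have W: "W \<subseteq> primes" "\<forall>p. prime p \<and> p < n \<and> p \<in> V \<longrightarrow> p \<in> W" by (auto simp: same_below_def)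
    then obtain y where y: "x 0 \<in> ring_inverting W" "\<forall>i. y i \<in> ring_inverting W" "zpoly_eval f (case_nat (x 0) y) = 0"
      using n by blast
    have "\<forall>i. case_nat (x 0) y i \<in> ring_inverting W" using y(1,2) by (simp split: nat.split)
    then show "W \<in> solvable_set f" using y(3) W(1) unfolding solvable_set_def HTP_def by blast
  qed
  then show "\<exists>T. openin cantor_topology T \<and> V \<in> T \<and> T \<subseteq> solvable_set f"
    using openin_same_below same_below_self[OF V] by blast
qed

text \<open>The boundary set is a closed set minus its own interior.\<close>

lemma nowhere_dense_boundary_set: "nowhere_dense_in cantor_topology (boundary_set f)"
proof -
  let ?X = cantor_topology and ?C = "Pow primes - solvable_set f"
  have C: "closedin ?X ?C"
    using closedin_diff[OF closedin_topspace openin_solvable_set]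
    unfolding topspace_cantor_topology .
  have B: "boundary_set f = ?C - ?X interior_of ?C" by (simp add: boundary_set_def)
  have "closedin ?X (boundary_set f)" unfolding B using C by (rule closedin_diff) simp
  moreover have "?X interior_of (boundary_set f) = {}"
  proof -
    have "?X interior_of (boundary_set f) \<subseteq> ?X interior_of ?C"
      unfolding B by (rule interior_of_mono) blast
    moreover have "?X interior_of (boundary_set f) \<subseteq> boundary_set f" by (rule interior_of_subset)
    ultimately show ?thesis unfolding B by blast
  qed
  ultimately show ?thesis
    unfolding nowhere_dense_in_def by (simp add: closedin_subset closure_of_closedin)
qed

lemma countable_boundary_sets: "countable (range boundary_set)"
  by (rule countable_range_if_determined_by_eval) (simp only: boundary_set_def solvable_set_def HTP_def mem_Collect_eq)

lemma exists_generic: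
  assumes "V \<subseteq> primes"
  shows "\<exists>W\<in>same_below V n. HTP_generic W"
proof -
  obtain W where W: "W \<in> same_below V n" "W \<notin> \<Union>(range boundary_set)"
    using same_below_not_meager[OF assms countable_boundary_sets] nowhere_dense_boundary_set by blast
  then have "HTP_generic W" by (auto simp: HTP_generic_def same_below_def)
  then show ?thesis using W(1) by blast
qed

section \<open>The equivalences\<close>

text \<open>The same \<open>g\<close> defines \<open>\<int>\<close> over the largest set \<open>V\<^sub>0\<close> of the cylinder. If \<open>q \<in> \<int>\<close>, take a zero over any
  generic set of the cylinder: it is also a zero over \<open>V\<^sub>0\<close>. Conversely, a zero over \<open>V\<^sub>0\<close> is a zero over
  a generic set sufficiently close to \<open>V\<^sub>0\<close>, which forces \<open>q \<in> \<int>\<close>. Finally, the ring of \<open>V\<^sub>0\<close> is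
  diophantine over \<open>\<rat>\<close>, as the intersection of finitely many sets of \<open>p\<close>-integral numbers.\<close>

theorem definable_in_rationals_if_generically_definable:
  assumes \<sigma>: "\<sigma> \<in> prime_strings"
    and g: "\<And>V. V \<in> cylinder \<sigma> \<Longrightarrow> HTP_generic V \<Longrightarrow> existentially_defines_ints g (ring_inverting V)"
  shows "ints_existentially_definable UNIV"
proof -
  define F where "F = {p. \<sigma> p = Some False}"
  define V0 where "V0 = {p. prime p \<and> \<sigma> p \<noteq> Some False}"
  obtain m where m: "dom \<sigma> = {p. prime p \<and> p < m}" using \<sigma> by (auto simp: prime_strings_def)
  have F_dom: "F \<subseteq> dom \<sigma>" by (auto simp: F_def)
  have F: "finite F" "\<And>p. p \<in> F \<Longrightarrow> prime p"
    using F_dom m finite_subset[of F "{..<m}"] by auto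
  have V0: "V0 \<subseteq> primes" "V0 \<in> cylinder \<sigma>"
    using cylinder_largest[OF \<sigma>] by (auto simp: V0_def)
  obtain n0 where n0: "cylinder \<sigma> = same_below V0 n0"
    using cylinder_eq_same_below[OF \<sigma>] V0(2) by blast
  have R: "ring_inverting V0 = {x. \<forall>p\<in>F. p_integral p x}"
    using ring_inverting_iff[OF V0(1)] F(2) by (auto simp: V0_def F_def)
  have sub: "ring_inverting V \<subseteq> ring_inverting V0" if "V \<in> cylinder \<sigma>" for V
  proof (rule ring_inverting_mono)
    show "V \<subseteq> V0" using that by (force simp: cylinder_def V0_def dom_def)
  qed
  have char: "q \<in> \<int> \<longleftrightarrow> q \<in> ring_inverting V0 \<and> (\<exists>y. (\<forall>i. y i \<in> ring_inverting V0) \<and> zpoly_eval g (case_nat q y) = 0)" for q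
  proof
    assume q: "q \<in> \<int>"
    obtain V where V: "V \<in> cylinder \<sigma>" "HTP_generic V" using exists_generic[OF V0(1)] n0 by blast
    have "q \<in> ring_inverting V" using q rat_subring_of_int[OF rat_subring_ring_inverting] by (auto elim: Ints_cases)
    then have "\<exists>y. (\<forall>i. y i \<in> ring_inverting V) \<and> zpoly_eval g (case_nat q y) = 0"
      using g[OF V] q unfolding existentially_defines_ints_def by blast
    then show "q \<in> ring_inverting V0 \<and> (\<exists>y. (\<forall>i. y i \<in> ring_inverting V0) \<and> zpoly_eval g (case_nat q y) = 0)"
      using sub[OF V(1)] \<open>q \<in> ring_inverting V\<close> by blast
  next
    assume "q \<in> ring_inverting V0 \<and> (\<exists>y. (\<forall>i. y i \<in> ring_inverting V0) \<and> zpoly_eval g (case_nat q y) = 0)"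
    then obtain y where q: "q \<in> ring_inverting V0" and y: "\<And>i. y i \<in> ring_inverting V0" "zpoly_eval g (case_nat q y) = 0"
      by blast
    from solution_persists[OF V0(1) q y]
    obtain n where n: "\<forall>W. W \<subseteq> primes \<longrightarrow> (\<forall>p. prime p \<and> p < n \<and> p \<in> V0 \<longrightarrow> p \<in> W) \<longrightarrow>
      q \<in> ring_inverting W \<and> (\<exists>y. (\<forall>i. y i \<in> ring_inverting W) \<and> zpoly_eval g (case_nat q y) = 0)" ..
    obtain V where V: "V \<in> same_below V0 (max n n0)" "HTP_generic V" using exists_generic[OF V0(1)] by blast
    then have "V \<in> cylinder \<sigma>" unfolding n0 using same_below_antimono[of n0 "max n n0"] by auto
    from g[OF this V(2)] have "existentially_defines_ints g (ring_inverting V)" .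
    moreover have "q \<in> ring_inverting V \<and> (\<exists>y. (\<forall>i. y i \<in> ring_inverting V) \<and> zpoly_eval g (case_nat q y) = 0)"
      using V(1) by (intro n[rule_format]) (auto simp: same_below_def)
    ultimately show "q \<in> \<int>" unfolding existentially_defines_ints_def by blast
  qed
  have "diophantine (\<lambda>e. \<forall>p\<in>F. e 0 \<in> {x. p_integral p x})"
    using F diophantine_set_p_integral by (intro diophantine_ball) (auto simp: diophantine_set_def)
  then have DR: "diophantine_set (ring_inverting V0)" by (simp add: diophantine_set_def R)
  from polyfun_finite_support[OF polyfun_zpoly_eval[of g]]
  obtain N where N: "\<forall>e e'. (\<forall>i<N. e i = e' i) \<longrightarrow> zpoly_eval g e = zpoly_eval g e'" ..
  (* Position 0 holds q and position 2 * i + 1 the unknown y i. Only the first N unknowns are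
     required to be in the ring, to keep the conjunction finite; the others do not affect the value. *)
  define P where "P = (\<lambda>w. w 0 \<in> ring_inverting V0 \<and> (\<forall>i\<in>{..<N}. w (Suc (2 * i)) \<in> ring_inverting V0) \<and>
      zpoly_eval g (\<lambda>i. case_nat (w 0) (\<lambda>i. w (Suc (2 * i))) i) = 0)"
  have "polyfun (\<lambda>w. case_nat (w 0) (\<lambda>i. w (Suc (2 * i))) i)" for i
    by (cases i) (simp_all add: polyfun_var)
  then have "polyfun (\<lambda>w. zpoly_eval g (\<lambda>i. case_nat (w 0) (\<lambda>i. w (Suc (2 * i))) i))"
    by (rule polyfun_compose[OF polyfun_zpoly_eval])
  then have "diophantine P" unfolding P_def
    by (intro diophantine_conj diophantine_ball diophantine_mem[OF DR] polyfun_var diophantine_eq_0) simp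
  then have "diophantine (\<lambda>e. \<exists>x. P (interleave e x))" by (rule diophantine_ex_sequence)
  moreover have "(\<exists>x. P (interleave e x)) \<longleftrightarrow> e 0 \<in> \<int>" for e
  proof
    assume "\<exists>x. P (interleave e x)"
    then obtain x where x: "e 0 \<in> ring_inverting V0" "\<forall>i<N. x i \<in> ring_inverting V0"
      "zpoly_eval g (case_nat (e 0) x) = 0" by (auto simp: P_def)
    define y where "y i = (if i < N then x i else 0)" for i
    have "case_nat (e 0) y i = case_nat (e 0) x i" if "i < N" for i
      using that by (cases i) (simp_all add: y_def)
    then have "zpoly_eval g (case_nat (e 0) y) = zpoly_eval g (case_nat (e 0) x)" by (intro N[rule_format])
    then have "zpoly_eval g (case_nat (e 0) y) = 0" using x(3) by simp
    moreover have "\<forall>i. y i \<in> ring_inverting V0" using x(2) zero_in_ring_inverting by (simp add: y_def)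
    ultimately show "e 0 \<in> \<int>" unfolding char using x(1) by blast
  next
    assume "e 0 \<in> \<int>"
    then obtain y where "e 0 \<in> ring_inverting V0" "\<forall>i. y i \<in> ring_inverting V0"
      "zpoly_eval g (case_nat (e 0) y) = 0" unfolding char by blast
    then have "P (interleave e y)" by (simp add: P_def)
    then show "\<exists>x. P (interleave e x)" by blast
  qed
  ultimately have "diophantine_set \<int>" by (simp add: diophantine_set_def)
  then show ?thesis by (rule ints_existentially_definable_if_diophantine)
qed

text \<open>Countably many sets \<open>E g\<close>, together with the boundary sets, cover the class, so one \<open>E g\<close> is dense in a
  cylinder. Let \<open>V\<close> be generic in that cylinder and \<open>q\<close> in its ring. If \<open>g(q, y) = 0\<close> is solvable over \<open>V\<close>, then
  also over some \<open>W \<in> E g\<close> close to \<open>V\<close>, whence \<open>q \<in> \<int>\<close>. If \<open>q \<in> \<int>\<close> and the equation had no solution over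
  \<open>V\<close>, then by genericity it would have none over any \<open>W\<close> close to \<open>V\<close>, in particular none over some
  \<open>W \<in> E g\<close>.\<close>

theorem generically_definable_if_not_meager:
  assumes "\<not> meager_in cantor_topology ex_definable_class"
  shows "\<exists>\<sigma>\<in>prime_strings. \<exists>g. \<forall>V\<in>cylinder \<sigma>.
             HTP_generic V \<longrightarrow> existentially_defines_ints g (ring_inverting V)"
proof -
  let ?X = cantor_topology
  define E where "E g = {W. HTP_generic W \<and> existentially_defines_ints g (ring_inverting W)}" for g
  have E_sub: "E g \<subseteq> topspace ?X" for g
    by (auto simp: E_def HTP_generic_def topspace_cantor_topology)
  have "\<exists>g. \<not> nowhere_dense_in ?X (E g)"
  proof (rule ccontr)
    assume "\<not> ?thesis"
    then have nd: "nowhere_dense_in ?X (E g)" for g by blast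
    define \<N> where "\<N> = (\<lambda>N. N \<inter> ex_definable_class) ` (range boundary_set \<union> range E)"
    have "countable (range E)"
      by (rule countable_range_if_determined_by_eval) (simp only: E_def existentially_defines_ints_def)
    then have "countable \<N>" using countable_boundary_sets by (simp add: \<N>_def)
    moreover have "\<forall>N\<in>\<N>. nowhere_dense_in ?X N"
      unfolding \<N>_def using nd nowhere_dense_boundary_set by (blast intro: nowhere_dense_in_subset)
    moreover have "ex_definable_class = \<Union>\<N>"
    proof
      show "ex_definable_class \<subseteq> \<Union>\<N>"
      proof
        fix W assume W: "W \<in> ex_definable_class"
        then obtain g where g: "W \<subseteq> primes" "existentially_defines_ints g (ring_inverting W)"
          unfolding ex_definable_class_def ints_existentially_definable_def by blast
        show "W \<in> \<Union>\<N>"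
        proof (cases "HTP_generic W")
          case True
          then have "W \<in> E g" using g by (simp add: E_def)
          then show ?thesis using W unfolding \<N>_def by blast
        next
          case False
          then obtain f where "W \<in> boundary_set f" using g(1) unfolding HTP_generic_def by blast
          then show ?thesis using W unfolding \<N>_def by blast
        qed
      qed
    qed (auto simp: \<N>_def)
    ultimately have "meager_in ?X ex_definable_class" unfolding meager_in_def by blast
    then show False using assms by blast
  qed
  then obtain g where "\<not> nowhere_dense_in ?X (E g)" by blast
  then have "?X interior_of (?X closure_of E g) \<noteq> {}" using E_sub unfolding nowhere_dense_in_def by blast
  then obtain V1 where V1: "V1 \<in> ?X interior_of (?X closure_of E g)" by blast
  from openin_cantor_contains_same_below[OF openin_interior_of V1]
  obtain n where n: "same_below V1 n \<subseteq> ?X interior_of (?X closure_of E g)" ..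
  have V1p: "V1 \<subseteq> primes" 
    using subsetD[OF interior_of_subset_topspace V1] unfolding topspace_cantor_topology by (rule PowD)
  have dense: "\<exists>W\<in>same_below V m. W \<in> E g" if "V \<in> same_below V1 n" for V m
  proof -
    have "V \<in> ?X closure_of E g" by (rule subsetD[OF interior_of_subset subsetD[OF n that]])
    then have "\<forall>T. V \<in> T \<and> openin ?X T \<longrightarrow> (\<exists>W. W \<in> E g \<and> W \<in> T)"
      unfolding in_closure_of by (rule conjunct2)
    moreover have "V \<in> same_below V m"
      using that by (intro same_below_self) (simp add: same_below_def)
    ultimately show ?thesis using openin_same_below[of V m] by blast
  qed
  have def_ints: "existentially_defines_ints g (ring_inverting V)" if V: "V \<in> same_below V1 n" "HTP_generic V" for V
    unfolding existentially_defines_ints_def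
  proof (intro ballI iffI)
    have Vp: "V \<subseteq> primes" using V by (simp add: same_below_def)
    fix q assume qR: "q \<in> ring_inverting V"
    show "\<exists>y. (\<forall>i. y i \<in> ring_inverting V) \<and> zpoly_eval g (case_nat q y) = 0" if qi: "q \<in> \<int>"
    proof -
      obtain k where k: "q = of_int k" using qi by (rule Ints_cases)
      have "polyfun (\<lambda>y. case_nat q y i)" for i
        unfolding k by (cases i) (simp_all add: polyfun_of_int polyfun_var)
      then have "polyfun (\<lambda>y. zpoly_eval g (\<lambda>i. case_nat q y i))"
        by (rule polyfun_compose[OF polyfun_zpoly_eval])
      (* Genericity concerns polynomials f without parameters; the integer q becomes a coefficient. *)
      from polyfun_imp_zpoly[OF this] obtain f where f: "\<forall>y. zpoly_eval f y = zpoly_eval g (case_nat q y)" by blast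
      have solv: "W \<in> solvable_set f \<longleftrightarrow> W \<subseteq> primes \<and> (\<exists>y. (\<forall>i. y i \<in> ring_inverting W) \<and> zpoly_eval g (case_nat q y) = 0)" for W
        unfolding solvable_set_def HTP_def using f by simp
      have "V \<in> solvable_set f"
      proof (rule ccontr)
        assume "V \<notin> solvable_set f"
        moreover have "V \<notin> boundary_set f" using V(2) by (simp add: HTP_generic_def)
        ultimately have "V \<in> ?X interior_of (Pow primes - solvable_set f)"
          using Vp unfolding boundary_set_def by blast
        from openin_cantor_contains_same_below[OF openin_interior_of this]
        obtain m where "same_below V m \<subseteq> ?X interior_of (Pow primes - solvable_set f)" ..
        then have m: "same_below V m \<subseteq> Pow primes - solvable_set f"
          using interior_of_subset by (rule subset_trans)
        obtain W where W: "W \<in> same_below V m" "W \<in> E g" using dense[OF V(1)] by blast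
        have "q \<in> ring_inverting W" unfolding k by (rule rat_subring_of_int[OF rat_subring_ring_inverting])
        then have "\<exists>y. (\<forall>i. y i \<in> ring_inverting W) \<and> zpoly_eval g (case_nat q y) = 0"
          using W(2) qi unfolding E_def existentially_defines_ints_def by blast
        moreover have "W \<subseteq> primes" using W(1) by (simp add: same_below_def)
        ultimately have "W \<in> solvable_set f" unfolding solv by blast
        then show False using m W(1) by blast
      qed
      then show ?thesis unfolding solv by blast
    qed
    show "q \<in> \<int>" if ex: "\<exists>y. (\<forall>i. y i \<in> ring_inverting V) \<and> zpoly_eval g (case_nat q y) = 0"
    proof -
      obtain y where y: "\<And>i. y i \<in> ring_inverting V" "zpoly_eval g (case_nat q y) = 0" using ex by blast
      from solution_persists[OF Vp qR y]
      obtain m where m: "\<forall>W. W \<subseteq> primes \<longrightarrow> (\<forall>p. prime p \<and> p < m \<and> p \<in> V \<longrightarrow> p \<in> W) \<longrightarrow>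
        q \<in> ring_inverting W \<and> (\<exists>y. (\<forall>i. y i \<in> ring_inverting W) \<and> zpoly_eval g (case_nat q y) = 0)" ..
      obtain W where W: "W \<in> same_below V m" "W \<in> E g" using dense[OF V(1)] by blast
      have "q \<in> ring_inverting W \<and> (\<exists>y. (\<forall>i. y i \<in> ring_inverting W) \<and> zpoly_eval g (case_nat q y) = 0)"
        using W(1) by (intro m[rule_format]) (auto simp: same_below_def)
      then show "q \<in> \<int>" using W(2) unfolding E_def existentially_defines_ints_def by blast
    qed
  qed
  from same_below_eq_cylinder[OF V1p]
  obtain \<sigma> where \<sigma>: "\<sigma> \<in> prime_strings" "cylinder \<sigma> = same_below V1 n" ..
  show ?thesis
  proof (intro bexI[of _ \<sigma>] exI[of _ g] ballI impI)
    fix V assume "V \<in> cylinder \<sigma>" "HTP_generic V"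
    then show "existentially_defines_ints g (ring_inverting V)" unfolding \<sigma>(2) by (rule def_ints)
  qed (rule \<sigma>(1))
qed

lemma definable_on_cylinder_if_definable_in_rationals:
  assumes "ints_existentially_definable UNIV"
  shows "\<exists>h. \<forall>V\<in>same_below {} 4. existentially_defines_ints h (ring_inverting V)"
proof -
  obtain g where "existentially_defines_ints g UNIV"
    using assms unfolding ints_existentially_definable_def by blast
  from uniform_definition_if_2_3_not_inverted[OF this]
  obtain h where h: "\<forall>V. V \<subseteq> primes \<and> 2 \<notin> V \<and> 3 \<notin> V \<longrightarrow> existentially_defines_ints h (ring_inverting V)" ..
  have "existentially_defines_ints h (ring_inverting V)" if "V \<in> same_below {} 4" for V
    using that by (intro h[rule_format]) (auto simp: same_below_def)
  then show ?thesis by blast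
qed

theorem theorem5p6:
  shows "((\<not> meager_in cantor_topology ex_definable_class) \<longleftrightarrow>
          (\<exists>\<sigma>\<in>prime_strings. \<exists>g. \<forall>V\<in>cylinder \<sigma>.
             HTP_generic V \<longrightarrow> existentially_defines_ints g (ring_inverting V))) \<and>
         ((\<exists>\<sigma>\<in>prime_strings. \<exists>g. \<forall>V\<in>cylinder \<sigma>.
             HTP_generic V \<longrightarrow> existentially_defines_ints g (ring_inverting V)) \<longleftrightarrow>
          primes \<in> ex_definable_class) \<and>
         (primes \<in> ex_definable_class \<longleftrightarrow>
          (\<exists>\<phi>. free_vars \<phi> = {0} \<and> (\<forall>R. rat_subring R \<longrightarrow> formula_defines_ints \<phi> R)))"
    (is "(?P1 \<longleftrightarrow> ?P2) \<and> (?P2 \<longleftrightarrow> ?P3) \<and> (?P3 \<longleftrightarrow> ?P4)")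
proof -
  have P3: "?P3 \<longleftrightarrow> ints_existentially_definable UNIV"
    by (simp add: ex_definable_class_def ring_inverting_primes)
  have "?P1 \<Longrightarrow> ?P2" by (rule generically_definable_if_not_meager)
  moreover have "?P2 \<Longrightarrow> ?P3"
    unfolding P3 using definable_in_rationals_if_generically_definable by blast
  moreover have "?P3 \<Longrightarrow> ?P2"
  proof -
    assume ?P3
    then obtain h where h: "\<forall>V\<in>same_below {} 4. existentially_defines_ints h (ring_inverting V)"
      using definable_on_cylinder_if_definable_in_rationals unfolding P3 by blast
    obtain \<sigma> where "\<sigma> \<in> prime_strings" "cylinder \<sigma> = same_below {} 4"
      using same_below_eq_cylinder[of "{}" 4] by blast
    then show ?P2 using h by (intro bexI[of _ \<sigma>] exI[of _ h] ballI impI) simp_all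
  qed
  moreover have "?P3 \<Longrightarrow> ?P1"
  proof
    assume ?P3
    then obtain h where h: "\<forall>V\<in>same_below {} 4. existentially_defines_ints h (ring_inverting V)"
      using definable_on_cylinder_if_definable_in_rationals unfolding P3 by blast
    assume "meager_in cantor_topology ex_definable_class"
    then obtain \<N> where \<N>: "countable \<N>" "\<forall>N\<in>\<N>. nowhere_dense_in cantor_topology N"
      "ex_definable_class = \<Union>\<N>"
      unfolding meager_in_def by (elim exE conjE)
    have "\<exists>W\<in>same_below {} 4. W \<notin> \<Union>\<N>"
      by (rule same_below_not_meager[OF empty_subsetI \<N>(1) \<N>(2)[rule_format]])
    then obtain W where W: "W \<in> same_below {} 4" "W \<notin> ex_definable_class" unfolding \<N>(3) by blast
    moreover have "W \<subseteq> primes" using W(1) by (simp add: same_below_def)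
    ultimately show False
      using h unfolding ex_definable_class_def ints_existentially_definable_def by blast
  qed
  moreover have "?P3 \<Longrightarrow> ?P4"
    unfolding P3 ints_existentially_definable_def
    by (elim exE) (rule uniform_formula_if_definable_in_rationals)
  moreover have "?P4 \<Longrightarrow> ?P3"
  proof -
    assume ?P4
    then obtain \<phi> where "\<forall>R. rat_subring R \<longrightarrow> formula_defines_ints \<phi> R" by (elim exE conjE)
    moreover have "rat_subring UNIV" by (simp add: rat_subring_def)
    ultimately have "formula_defines_ints \<phi> UNIV" by simp
    then show ?P3 unfolding P3 by (rule definable_in_rationals_if_formula)
  qed
  ultimately show ?thesis by argo
qed

end
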